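(* Let $p$ be a prime, let $\sigma:\bar{\mathbb F}_p^\times\to\mathbb Q/\mathbb Z$ be an injective group homomorphism, and let $\tilde\sigma: \mathbb W_0(\bar{\mathbb F}_p)\xrightarrow{\sim}\mathbb Z[(\mathbb Q/\mathbb Z)^{(p)}]\subset \mathbb Z[\mathbb Q/\mathbb Z]$ be the associated ring isomorphism. Then the Frobenius maps $F_n$ and the Verschiebung maps $V_n$ on $\mathbb W_0(\bar{\mathbb F}_p)$ are obtained from the ring endomorphisms $\sigma_n$ and the maps $\tilde\rho_n$ of $\mathbb Z[\mathbb Q/\mathbb Z]$ by the formulas $$\tilde\sigma\circ F_n=\sigma_n\circ\tilde\sigma,\qquad \tilde\sigma\circ V_n=r\circ\tilde\rho_n\circ\tilde\sigma\qquad (n\in\mathbb N).$$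
   Context: $\mathbb N$ is the set of positive integers. For a commutative unital ring $A$, let $\underline{\mathrm{End}}_A$ be the category of pairs $(E,f)$ with $E$ a finite projective $A$-module and $f\in\mathrm{End}_A(E)$ (morphisms commute with the endomorphisms). Direct sum and tensor product make $K_0(\underline{\mathrm{End}}_A)$ a commutative ring; the pairs $(E,0)$ generate an ideal $K_0(A)$, and $\mathbb W_0(A):=K_0(\underline{\mathrm{End}}_A)/K_0(A)$. For $n\in\mathbb N$, $F_n:\mathbb W_0(A)\to\mathbb W_0(A)$ is the ring endomorphism $F_n(E,f)=(E,f^n)$, and $V_n:\mathbb W_0(A)\to\mathbb W_0(A)$ is the additive map $V_n(E,f)=(E^{\oplus n},\Phi)$ with $(\Phi\xi)_1=f\xi_n$ and $(\Phi\xi)_j=\xi_{j-1}$ for $2\le j\le n$. $(\mathbb Q/\mathbb Z)^{(p)}\subset\mathbb Q/\mathbb Z$ is the subgroup of fractions with denominator prime to $p$; any injective group homomorphism $\sigma:\bar{\mathbb F}_p^\times\to\mathbb Q/\mathbb Z$ has image $(\mathbb Q/\mathbb Z)^{(p)}$. The canonical generators of the group ring $\mathbb Z[\mathbb Q/\mathbb Z]$ are denoted $e(\gamma)$, $\gamma\in\mathbb Q/\mathbb Z$. The ring isomorphism $\tilde\sigma$ sends the class of $(E,f)$ to $\sum_\alpha e(\sigma(\alpha))$, the sum over the non-zero eigenvalues $\alpha$ of $f$ counted with algebraic multiplicity. For $n\in\mathbb N$: $\sigma_n$ is the ring endomorphism of $\mathbb Z[\mathbb Q/\mathbb Z]$ with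 $\sigma_n(e(\gamma))=e(n\gamma)$, and $\tilde\rho_n$ is the additive map of $\mathbb Z[\mathbb Q/\mathbb Z]$ with $\tilde\rho_n(e(\gamma))=\sum_{n\gamma'=\gamma}e(\gamma')$. Using $\mathbb Q/\mathbb Z=(\mathbb Q/\mathbb Z)^{(p)}\times\mathbb Q_p/\mathbb Z_p$ ($\mathbb Q_p/\mathbb Z_p$ = elements of $p$-power order), $r:\mathbb Z[\mathbb Q/\mathbb Z]\to\mathbb Z[(\mathbb Q/\mathbb Z)^{(p)}]$ is the ring retraction induced by the projection of $\mathbb Q/\mathbb Z$ onto $(\mathbb Q/\mathbb Z)^{(p)}$. *)

theory Defs
  imports
    "HOL-Computational_Algebra.Computational_Algebra"
    "HOL-Library.Poly_Mapping"
    "HOL-Algebra.Free_Abelian_Groups"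
    "HOL-Algebra.QuotRing"
    "HOL-Algebra.Algebraic_Closure_Type"
    "Jordan_Normal_Form.Missing_VectorSpace"
    "Jordan_Normal_Form.Char_Poly"
begin

hide_const (open) Polynomial.smult Multiset.mult

section \<open>The category of endomorphisms of finite projective modules\<close>

definition free_module :: "('a, 'm) ring_scheme \<Rightarrow> 's set \<Rightarrow> ('a, 's \<Rightarrow> 'a) module" where
  "free_module R S =
     \<lparr>carrier = {c \<in> S \<rightarrow>\<^sub>E carrier R. finite {s \<in> S. c s \<noteq> \<zero>\<^bsub>R\<^esub>}},
      mult = undefined, one = undefined,
      zero = (\<lambda>s\<in>S. \<zero>\<^bsub>R\<^esub>),
      add = (\<lambda>c d. \<lambda>s\<in>S. c s \<oplus>\<^bsub>R\<^esub> d s),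
      smult = (\<lambda>r c. \<lambda>s\<in>S. r \<otimes>\<^bsub>R\<^esub> c s)\<rparr>"

text \<open>Projective means: a retract (direct summand) of a free module.  Every module is a quotient of
  the free module on its own carrier, so bases contained in the element type suffice.\<close>

definition projective_module :: "('a, 'm) ring_scheme \<Rightarrow> ('a, 'b) module \<Rightarrow> bool" where
  "projective_module R M \<longleftrightarrow> module R M \<and>
     (\<exists>(S :: 'b set) i s. i \<in> module_hom R M (free_module R S) \<and>
        s \<in> module_hom R (free_module R S) M \<and> (\<forall>x\<in>carrier M. s (i x) = x))"

definition finite_projective :: "('a, 'm) ring_scheme \<Rightarrow> ('a, 'b) module \<Rightarrow> bool" where
  "finite_projective R M \<longleftrightarrow> projective_module R M \<and>
     (\<exists>S. finite S \<and> S \<subseteq> carrier M \<and> module.span R M S = carrier M)"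

type_synonym ('a, 'b) endo = "('a, 'b) module \<times> ('b \<Rightarrow> 'b)"

definition End_obj :: "('a, 'm) ring_scheme \<Rightarrow> ('a, 'b) endo set" where
  "End_obj R = {(M, f). finite_projective R M \<and> f \<in> module_hom R M M}"

definition End_hom :: "('a, 'm) ring_scheme \<Rightarrow> ('a, 'b) endo \<Rightarrow> ('a, 'c) endo \<Rightarrow> ('b \<Rightarrow> 'c) set" where
  "End_hom R E D =
     {h \<in> module_hom R (fst E) (fst D). \<forall>x\<in>carrier (fst E). h (snd E x) = snd D (h x)}"

definition End_iso :: "('a, 'm) ring_scheme \<Rightarrow> ('a, 'b) endo \<Rightarrow> ('a, 'c) endo \<Rightarrow> bool" where
  "End_iso R E D \<longleftrightarrow> (\<exists>h\<in>End_hom R E D. bij_betw h (carrier (fst E)) (carrier (fst D)))"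

definition End_exact ::
  "('a, 'm) ring_scheme \<Rightarrow> ('a, 'b) endo \<Rightarrow> ('a, 'c) endo \<Rightarrow> ('a, 'd) endo \<Rightarrow> bool" where
  "End_exact R E' E E'' \<longleftrightarrow>
     (\<exists>i\<in>End_hom R E' E. \<exists>q\<in>End_hom R E E''.
        inj_on i (carrier (fst E')) \<and>
        q ` carrier (fst E) = carrier (fst E'') \<and>
        {x \<in> carrier (fst E). q x = \<zero>\<^bsub>fst E''\<^esub>} = i ` carrier (fst E'))"


section \<open>Tensor products\<close>

definition tensor_rel ::
  "('a, 'm) ring_scheme \<Rightarrow> ('a, 'b) module \<Rightarrow> ('a, 'c) module \<Rightarrow> ('b \<times> 'c \<Rightarrow>\<^sub>0 int) set" where
  "tensor_rel R M N = generate (free_Abelian_group (carrier M \<times> carrier N))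
     ({frag_of (x \<oplus>\<^bsub>M\<^esub> x', y) - frag_of (x, y) - frag_of (x', y) | x x' y.
         x \<in> carrier M \<and> x' \<in> carrier M \<and> y \<in> carrier N} \<union>
      {frag_of (x, y \<oplus>\<^bsub>N\<^esub> y') - frag_of (x, y) - frag_of (x, y') | x y y'.
         x \<in> carrier M \<and> y \<in> carrier N \<and> y' \<in> carrier N} \<union>
      {frag_of (r \<odot>\<^bsub>M\<^esub> x, y) - frag_of (x, r \<odot>\<^bsub>N\<^esub> y) | r x y.
         r \<in> carrier R \<and> x \<in> carrier M \<and> y \<in> carrier N})"

definition tensor_map ::
  "('a, 'm) ring_scheme \<Rightarrow> ('a, 'b) module \<Rightarrow> ('a, 'c) module \<Rightarrow> ('b \<Rightarrow> 'b) \<Rightarrow> ('c \<Rightarrow> 'c) \<Rightarrow>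
     ('b \<times> 'c \<Rightarrow>\<^sub>0 int) set \<Rightarrow> ('b \<times> 'c \<Rightarrow>\<^sub>0 int) set" where
  "tensor_map R M N f g T = the_elem
     ((\<lambda>c. tensor_rel R M N #>\<^bsub>free_Abelian_group (carrier M \<times> carrier N)\<^esub>
        frag_extend (\<lambda>(x, y). frag_of (f x, g y)) c) ` T)"

definition tensor_module ::
  "('a, 'm) ring_scheme \<Rightarrow> ('a, 'b) module \<Rightarrow> ('a, 'c) module \<Rightarrow>
     ('a, ('b \<times> 'c \<Rightarrow>\<^sub>0 int) set) module" where
  "tensor_module R M N =
     (let Q = free_Abelian_group (carrier M \<times> carrier N) Mod tensor_rel R M N in
      \<lparr>carrier = carrier Q, mult = undefined, one = undefined,
       zero = \<one>\<^bsub>Q\<^esub>, add = (\<otimes>\<^bsub>Q\<^esub>),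
       smult = (\<lambda>r. tensor_map R M N (\<lambda>x. r \<odot>\<^bsub>M\<^esub> x) (\<lambda>y. y))\<rparr>)"

definition End_tensor ::
  "('a, 'm) ring_scheme \<Rightarrow> ('a, 'b) endo \<Rightarrow> ('a, 'c) endo \<Rightarrow>
     ('a, ('b \<times> 'c \<Rightarrow>\<^sub>0 int) set) endo" where
  "End_tensor R E D =
     (tensor_module R (fst E) (fst D), tensor_map R (fst E) (fst D) (snd E) (snd D))"

definition End_unit :: "('a, 'm) ring_scheme \<Rightarrow> ('a, 'a) endo" where
  "End_unit R =
     (\<lparr>carrier = carrier R, mult = undefined, one = undefined,
       zero = \<zero>\<^bsub>R\<^esub>, add = (\<oplus>\<^bsub>R\<^esub>), smult = (\<otimes>\<^bsub>R\<^esub>)\<rparr>, \<lambda>x. x)"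


section \<open>The rings \<open>K\<^sub>0(End\<^sub>R)\<close> and \<open>W\<^sub>0(R)\<close>\<close>

text \<open>The Grothendieck group needs a set of objects.  A finitely generated \<open>R\<close>-module is a quotient
  of some \<open>R\<^sup>n\<close>, so it is isomorphic to a module with carrier contained in \<open>'a list\<close>; the pairs over
  this element type therefore represent all isomorphism classes.  The following function moves a pair
  over an arbitrary element type to an isomorphic pair over \<open>'a list\<close>.\<close>

definition End_rep :: "('a, 'm) ring_scheme \<Rightarrow> ('a, 'b) endo \<Rightarrow> ('a, 'a list) endo" where
  "End_rep R E = (SOME D. D \<in> End_obj R \<and> End_iso R E D)"

text \<open>Formal integer combinations of objects, with the bilinear extension of the tensor product.\<close>

definition End_formal :: "('a, 'm) ring_scheme \<Rightarrow> (('a, 'a list) endo \<Rightarrow>\<^sub>0 int) ring" where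
  "End_formal R =
     \<lparr>carrier = {c. Poly_Mapping.keys c \<subseteq> End_obj R},
      mult = (\<lambda>c d. frag_extend
        (\<lambda>E. frag_extend (\<lambda>D. frag_of (End_rep R (End_tensor R E D))) d) c),
      one = frag_of (End_rep R (End_unit R)),
      zero = 0,
      add = (+)\<rparr>"

text \<open>The relations are given by all short exact sequences.  They identify isomorphic pairs, and a
  split sequence gives \<open>[E \<oplus> D] = [E] + [D]\<close>.\<close>

definition K0_rel :: "('a, 'm) ring_scheme \<Rightarrow> (('a, 'a list) endo \<Rightarrow>\<^sub>0 int) set" where
  "K0_rel R = generate (add_monoid (End_formal R))
     {frag_of E - frag_of E' - frag_of E'' | E' E E''.
        E' \<in> End_obj R \<and> E \<in> End_obj R \<and> E'' \<in> End_obj R \<and> End_exact R E' E E''}"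

definition K0_End :: "('a, 'm) ring_scheme \<Rightarrow> (('a, 'a list) endo \<Rightarrow>\<^sub>0 int) set ring" where
  "K0_End R = End_formal R Quot K0_rel R"

definition K0_class ::
  "('a, 'm) ring_scheme \<Rightarrow> ('a, 'b) endo \<Rightarrow> (('a, 'a list) endo \<Rightarrow>\<^sub>0 int) set" where
  "K0_class R E = K0_rel R +>\<^bsub>End_formal R\<^esub> frag_of (End_rep R E)"

text \<open>\<open>K\<^sub>0(R)\<close> is the additive subgroup generated by the classes of the pairs \<open>(E, 0)\<close>.  It is
  already the ideal they generate, since \<open>(E, 0) \<otimes> (E', f') = (E \<otimes> E', 0)\<close>.\<close>

definition K0_ideal :: "('a, 'm) ring_scheme \<Rightarrow> (('a, 'a list) endo \<Rightarrow>\<^sub>0 int) set set" where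
  "K0_ideal R = generate (add_monoid (K0_End R))
     {K0_class R (M, \<lambda>x. \<zero>\<^bsub>M\<^esub>) | M :: ('a, 'a list) module. finite_projective R M}"

definition W0 :: "('a, 'm) ring_scheme \<Rightarrow> (('a, 'a list) endo \<Rightarrow>\<^sub>0 int) set set ring" where
  "W0 R = K0_End R Quot K0_ideal R"

definition W0_class ::
  "('a, 'm) ring_scheme \<Rightarrow> ('a, 'b) endo \<Rightarrow> (('a, 'a list) endo \<Rightarrow>\<^sub>0 int) set set" where
  "W0_class R E = K0_ideal R +>\<^bsub>K0_End R\<^esub> K0_class R E"

text \<open>The additive map on \<open>W\<^sub>0(R)\<close> with prescribed values on the classes of pairs \<open>(E, f)\<close>; it is
  unique because these classes generate the additive group.\<close>

definition W0_additive ::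
  "('a, 'm) ring_scheme \<Rightarrow> ('g, 'n) monoid_scheme \<Rightarrow> (('a, 'a list) endo \<Rightarrow> 'g) \<Rightarrow>
     (('a, 'a list) endo \<Rightarrow>\<^sub>0 int) set set \<Rightarrow> 'g" where
  "W0_additive R G \<phi> = (THE h. h \<in> extensional (carrier (W0 R)) \<and>
     h \<in> hom (add_monoid (W0 R)) G \<and> (\<forall>E\<in>End_obj R. h (W0_class R E) = \<phi> E))"

definition W0_Frobenius ::
  "('a, 'm) ring_scheme \<Rightarrow> nat \<Rightarrow>
     (('a, 'a list) endo \<Rightarrow>\<^sub>0 int) set set \<Rightarrow> (('a, 'a list) endo \<Rightarrow>\<^sub>0 int) set set" where
  "W0_Frobenius R n =
     W0_additive R (add_monoid (W0 R)) (\<lambda>(M, f). W0_class R (M, f ^^ n))"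

definition power_module :: "nat \<Rightarrow> ('a, 'b) module \<Rightarrow> ('a, nat \<Rightarrow> 'b) module" where
  "power_module n M =
     \<lparr>carrier = {1..n} \<rightarrow>\<^sub>E carrier M, mult = undefined, one = undefined,
      zero = (\<lambda>j\<in>{1..n}. \<zero>\<^bsub>M\<^esub>),
      add = (\<lambda>\<xi> \<eta>. \<lambda>j\<in>{1..n}. \<xi> j \<oplus>\<^bsub>M\<^esub> \<eta> j),
      smult = (\<lambda>r \<xi>. \<lambda>j\<in>{1..n}. r \<odot>\<^bsub>M\<^esub> \<xi> j)\<rparr>"

definition Verschiebung_map :: "nat \<Rightarrow> ('b \<Rightarrow> 'b) \<Rightarrow> (nat \<Rightarrow> 'b) \<Rightarrow> nat \<Rightarrow> 'b" where
  "Verschiebung_map n f \<xi> = (\<lambda>j\<in>{1..n}. if j = 1 then f (\<xi> n) else \<xi> (j - 1))"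

definition W0_Verschiebung ::
  "('a, 'm) ring_scheme \<Rightarrow> nat \<Rightarrow>
     (('a, 'a list) endo \<Rightarrow>\<^sub>0 int) set set \<Rightarrow> (('a, 'a list) endo \<Rightarrow>\<^sub>0 int) set set" where
  "W0_Verschiebung R n =
     W0_additive R (add_monoid (W0 R))
       (\<lambda>(M, f). W0_class R (power_module n M, Verschiebung_map n f))"


section \<open>The group ring of \<open>\<rat>/\<int>\<close>\<close>

quotient_type qmodz = rat / "\<lambda>x y :: rat. x - y \<in> \<int>"
  morphisms rep_qmodz qmodz
proof (rule equivpI)
  show "reflp (\<lambda>x y :: rat. x - y \<in> \<int>)"
    by (simp add: reflp_def)
  show "symp (\<lambda>x y :: rat. x - y \<in> \<int>)"
    by (metis (mono_tags, lifting) Ints_minus minus_diff_eq sympI)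
  show "transp (\<lambda>x y :: rat. x - y \<in> \<int>)"
  proof (rule transpI)
    fix x y z :: rat
    assume "x - y \<in> \<int>" "y - z \<in> \<int>"
    then have "(x - y) + (y - z) \<in> \<int>"
      by (rule Ints_add)
    then show "x - z \<in> \<int>"
      by simp
  qed
qed

instantiation qmodz :: ab_group_add
begin

lift_definition zero_qmodz :: qmodz is "0 :: rat" .

lift_definition plus_qmodz :: "qmodz \<Rightarrow> qmodz \<Rightarrow> qmodz" is "(+) :: rat \<Rightarrow> rat \<Rightarrow> rat"
  by (metis Ints_add add_diff_add)

lift_definition uminus_qmodz :: "qmodz \<Rightarrow> qmodz" is "uminus :: rat \<Rightarrow> rat"
  by (metis Ints_minus minus_diff_minus)

lift_definition minus_qmodz :: "qmodz \<Rightarrow> qmodz \<Rightarrow> qmodz" is "(-) :: rat \<Rightarrow> rat \<Rightarrow> rat"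
  by (metis Ints_diff add_diff_add diff_diff_eq2 diff_add_eq diff_diff_eq add.commute)

instance
  by standard (transfer; simp)+

end

lift_definition qmodz_mult :: "nat \<Rightarrow> qmodz \<Rightarrow> qmodz" is "\<lambda>n x. of_nat n * x :: rat"
  by (metis Ints_mult Ints_of_nat right_diff_distrib')

definition qmodz_prime_to :: "nat \<Rightarrow> qmodz set" where
  "qmodz_prime_to p = {qmodz (of_int a / of_nat b) | a b. b > 0 \<and> coprime b p}"

definition qmodz_primary :: "nat \<Rightarrow> qmodz set" where
  "qmodz_primary p = {\<gamma>. \<exists>k. qmodz_mult (p ^ k) \<gamma> = 0}"

definition qmodz_proj :: "nat \<Rightarrow> qmodz \<Rightarrow> qmodz" where
  "qmodz_proj p \<gamma> = (THE \<gamma>'. \<gamma>' \<in> qmodz_prime_to p \<and> \<gamma> - \<gamma>' \<in> qmodz_primary p)"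

text \<open>For a group \<open>G\<close>, the type \<open>G \<Rightarrow>\<^sub>0 int\<close> with its convolution product is the group ring \<open>\<int>[G]\<close>,
  and \<^term>\<open>frag_of \<gamma>\<close> is the canonical generator \<open>e(\<gamma>)\<close>.\<close>

type_synonym qz_ring = "qmodz \<Rightarrow>\<^sub>0 int"

definition qz_sigma :: "nat \<Rightarrow> qz_ring \<Rightarrow> qz_ring" where
  "qz_sigma n = frag_extend (\<lambda>\<gamma>. frag_of (qmodz_mult n \<gamma>))"

definition qz_rho :: "nat \<Rightarrow> qz_ring \<Rightarrow> qz_ring" where
  "qz_rho n = frag_extend (\<lambda>\<gamma>. \<Sum>\<gamma>' | qmodz_mult n \<gamma>' = \<gamma>. frag_of \<gamma>')"

definition qz_retract :: "nat \<Rightarrow> qz_ring \<Rightarrow> qz_ring" where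
  "qz_retract p = frag_extend (\<lambda>\<gamma>. frag_of (qmodz_proj p \<gamma>))"


section \<open>The map from \<open>W\<^sub>0\<close> of a field to the group ring\<close>

abbreviation type_ring :: "'k::field ring" where
  "type_ring \<equiv> ring_of_type_algebra"

text \<open>The characteristic polynomial of the matrix of \<open>f\<close> in any ordered basis of \<open>M\<close>.\<close>

definition End_char_poly :: "('k::field, 'b) endo \<Rightarrow> 'k poly" where
  "End_char_poly E = (case E of (M, f) \<Rightarrow> THE \<chi>. \<exists>bs A.
     distinct bs \<and> vectorspace.basis type_ring M (set bs) \<and>
     A \<in> carrier_mat (length bs) (length bs) \<and>
     (\<forall>j<length bs. f (bs ! j) = (\<Oplus>\<^bsub>M\<^esub>i\<in>{..<length bs}. (A $$ (i, j)) \<odot>\<^bsub>M\<^esub> (bs ! i))) \<and>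
     \<chi> = char_poly A)"

definition End_eigenvalues :: "('k::field, 'b) endo \<Rightarrow> 'k set" where
  "End_eigenvalues E = (case E of (M, f) \<Rightarrow>
     {\<alpha>. \<exists>v\<in>carrier M. v \<noteq> \<zero>\<^bsub>M\<^esub> \<and> f v = \<alpha> \<odot>\<^bsub>M\<^esub> v})"

definition algebraic_multiplicity :: "('k::field, 'b) endo \<Rightarrow> 'k \<Rightarrow> nat" where
  "algebraic_multiplicity E \<alpha> = Polynomial.order \<alpha> (End_char_poly E)"

definition sigma_tilde ::
  "('k::field \<Rightarrow> qmodz) \<Rightarrow> (('k, 'k list) endo \<Rightarrow>\<^sub>0 int) set set \<Rightarrow> qz_ring" where
  "sigma_tilde \<sigma> = W0_additive type_ring (add_monoid ring_of_type_algebra)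
     (\<lambda>E. \<Sum>\<alpha>\<in>End_eigenvalues E - {0}.
        of_nat (algebraic_multiplicity E \<alpha>) * frag_of (\<sigma> \<alpha>))"

text \<open>For a prime \<open>p\<close>: the prime subfield of a field of characteristic \<open>p\<close> is the range of
  \<^const>\<open>of_int\<close>, so the last condition says that the field is algebraic over \<open>\<int>/p\<close>.\<close>

definition algebraic_closure_of_Fp :: "nat \<Rightarrow> 'k::alg_closed_field itself \<Rightarrow> bool" where
  "algebraic_closure_of_Fp p _ \<longleftrightarrow> CHAR('k) = p \<and>
     (\<forall>x :: 'k. \<exists>q. q \<noteq> 0 \<and> (\<forall>i. coeff q i \<in> range of_int) \<and> poly q x = 0)"

end

theory Submission
  imports Defs
begin

text \<open>All maps in question are additive on \<open>W\<^sub>0\<close>, and every pair \<open>(E, f)\<close> over an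
  algebraically closed field has a filtration with one-dimensional quotients.  Hence both formulas need
  only be checked on the pairs \<open>(k, \<alpha>)\<close>.  Sums over eigenvalues are read off characteristic
  polynomials, which are multiplicative in exact sequences.  The pair \<open>F\<^sub>n (k, \<alpha>)\<close> is
  \<open>(k, \<alpha>\<^sup>n)\<close>, and \<open>V\<^sub>n (k, \<alpha>)\<close> has characteristic polynomial
  \<open>X\<^sup>n - \<alpha>\<close>.  If \<open>n = p\<^sup>a m\<close> with \<open>m\<close> prime to \<open>p\<close>
  and \<open>\<alpha> \<noteq> 0\<close>, each of its \<open>m\<close> roots has multiplicity \<open>p\<^sup>a\<close>, and
  \<open>\<sigma>\<close> maps these roots bijectively to the \<open>n\<close>-th roots of \<open>\<sigma> \<alpha>\<close> of order
  prime to \<open>p\<close>; each of the latter has \<open>p\<^sup>a\<close> preimages among all \<open>n\<close>-th roots of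
  \<open>\<sigma> \<alpha>\<close> under the projection.\<close>

text \<open>Additivity has to be earned: \<open>W0_additive\<close> is a definite description, so no
  value of \<open>W0_Frobenius\<close>, \<open>W0_Verschiebung\<close> or \<open>sigma_tilde\<close>
  is available before existence and uniqueness of the additive map are shown. Existence asks two
  things of a function on pairs: additivity in exact sequences and vanishing on the pairs
  \<open>(M, 0)\<close>. The second is the delicate point for V_n, since V_n (M, 0) is a shift,
  nilpotent but in general not zero. That nilpotent pairs vanish in W_0 is itself drawn from the
  filtration by lines: every quotient line then carries the scalar 0. Likewise
  \<open>End_char_poly\<close> is a definite description over all ordered bases and becomes usable
  once a change of basis is turned into similarity of matrices. The pairs generating W_0 live on
  lists while V_n produces functions on indices, so invariance under isomorphism across element
  types is needed. The relations contain no separate clause for isomorphisms; these are recovered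
  from exact sequences whose first term is a zero module.\<close>

no_notation fps_nth (infixl \<open>$\<close> 75)

section \<open>Linear maps out of coordinate spaces\<close>

abbreviation vec_mod :: "nat \<Rightarrow> ('k::field, 'k vec) module" where
  "vec_mod d \<equiv> module_vec TYPE('k) d"

lemma type_ring_simps [simp]:
  "carrier (type_ring :: 'k::field ring) = UNIV"
  "(\<zero>\<^bsub>(type_ring :: 'k::field ring)\<^esub>) = 0"
  "(\<one>\<^bsub>(type_ring :: 'k::field ring)\<^esub>) = 1"
  "x \<otimes>\<^bsub>(type_ring :: 'k::field ring)\<^esub> y = x * y"
  "x \<oplus>\<^bsub>(type_ring :: 'k::field ring)\<^esub> y = x + y"
  by (simp_all add: ring_of_type_algebra_def)

lemma field_type_ring: "field (type_ring :: 'k::field ring)"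
  by (rule field_from_type_algebra)

lemma vectorspaceI: "module (type_ring :: 'k::field ring) M \<Longrightarrow> vectorspace type_ring M"
  by (simp add: vectorspace_def field_type_ring)

lemma module_vec_mod: "module type_ring (vec_mod d :: ('k::field, 'k vec) module)"
proof (rule module_criteria)
  show "cring (type_ring :: 'k ring)" by (rule cring_from_type_algebra)
  show "\<forall>v\<in>carrier (vec_mod d :: ('k, 'k vec) module). \<exists>neg_v\<in>carrier (vec_mod d). v \<oplus>\<^bsub>vec_mod d\<^esub> neg_v =
      \<zero>\<^bsub>vec_mod d\<^esub>"
    by (auto simp: module_vec_simps intro!: bexI[of _ "- _"])
qed (auto simp: module_vec_simps add_smult_distrib_vec smult_add_distrib_vec smult_smult_assoc)

lemma module_homI:
  assumes "\<And>x. x \<in> carrier M \<Longrightarrow> f x \<in> carrier N"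
    and "\<And>x y. x \<in> carrier M \<Longrightarrow> y \<in> carrier M \<Longrightarrow> f (x \<oplus>\<^bsub>M\<^esub> y) = f x \<oplus>\<^bsub>N\<^esub> f y"
    and "\<And>r x. r \<in> carrier R \<Longrightarrow> x \<in> carrier M \<Longrightarrow> f (r \<odot>\<^bsub>M\<^esub> x) = r \<odot>\<^bsub>N\<^esub> f x"
  shows "f \<in> module_hom R M N"
  using assms by (auto simp: module_hom_def)

lemma module_homD:
  assumes "f \<in> module_hom R M N"
  shows "x \<in> carrier M \<Longrightarrow> f x \<in> carrier N"
    and "x \<in> carrier M \<Longrightarrow> y \<in> carrier M \<Longrightarrow> f (x \<oplus>\<^bsub>M\<^esub> y) = f x \<oplus>\<^bsub>N\<^esub> f y"
    and "r \<in> carrier R \<Longrightarrow> x \<in> carrier M \<Longrightarrow> f (r \<odot>\<^bsub>M\<^esub> x) = r \<odot>\<^bsub>N\<^esub> f x"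
  using assms by (auto simp: module_hom_def)

lemma module_hom_zero:
  assumes "module R M" "module R N" "f \<in> module_hom R M N"
  shows "f \<zero>\<^bsub>M\<^esub> = \<zero>\<^bsub>N\<^esub>"
  by (metis assms mod_hom.f0_is_0 mod_hom.intro mod_hom_axioms.intro)

lemma module_hom_comp:
  "f \<in> module_hom R M N \<Longrightarrow> g \<in> module_hom R N L \<Longrightarrow> g \<circ> f \<in> module_hom R M L"
  by (auto simp: module_hom_def Pi_iff)

lemma module_hom_inv_into:
  assumes M: "module R M" and f: "f \<in> module_hom R M N" and bij: "bij_betw f (carrier M) (carrier N)"
  shows "inv_into (carrier M) f \<in> module_hom R N M"
proof -
  interpret module R M by (rule M)
  let ?g = "inv_into (carrier M) f"
  have g: "?g y \<in> carrier M" "f (?g y) = y" if "y \<in> carrier N" for y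
    using bij that by (auto simp: bij_betw_def f_inv_into_f intro!: inv_into_into)
  have gf: "?g (f x) = x" if "x \<in> carrier M" for x
    using bij that by (simp add: bij_betw_def)
  show ?thesis
  proof (rule module_homI)
    fix x y assume xy: "x \<in> carrier N" "y \<in> carrier N"
    have "f (?g x \<oplus>\<^bsub>M\<^esub> ?g y) = x \<oplus>\<^bsub>N\<^esub> y"
      using module_homD[OF f] g xy by simp
    then show "?g (x \<oplus>\<^bsub>N\<^esub> y) = ?g x \<oplus>\<^bsub>M\<^esub> ?g y"
      by (metis g(1) xy gf a_closed)
  next
    fix r x assume r: "r \<in> carrier R" and x: "x \<in> carrier N"
    have "f (r \<odot>\<^bsub>M\<^esub> ?g x) = r \<odot>\<^bsub>N\<^esub> x"
      using module_homD[OF f] g r x by simp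
    then show "?g (r \<odot>\<^bsub>N\<^esub> x) = r \<odot>\<^bsub>M\<^esub> ?g x"
      by (metis g(1) r x gf smult_closed)
  qed (use g in auto)
qed

text \<open>The linear map from \<open>k^d\<close> to \<open>M\<close> with prescribed values on the
  unit vectors; by \<open>vec_hom_eq_comb\<close> every linear map out of \<open>k^d\<close> has
  this form.\<close>

definition vec_comb :: "('k::field, 'b) module \<Rightarrow> (nat \<Rightarrow> 'b) \<Rightarrow> nat \<Rightarrow> 'k vec \<Rightarrow> 'b" where
  "vec_comb M t d v = (\<Oplus>\<^bsub>M\<^esub>j\<in>{..<d}. (v $ j) \<odot>\<^bsub>M\<^esub> t j)"

lemma vec_comb_hom:
  fixes M :: "('k::field, 'b) module"
  assumes M: "module type_ring M" and t: "\<And>j. j < d \<Longrightarrow> t j \<in> carrier M"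
  shows "vec_comb M t d \<in> module_hom type_ring (vec_mod d) M"
proof -
  interpret module "type_ring :: 'k ring" M by (rule M)
  have [simp]: "c \<odot>\<^bsub>M\<^esub> t j \<in> carrier M" if "j < d" for c j
    using t[OF that] smult_closed[of c "t j"] by simp
  show ?thesis
  proof (rule module_homI)
    fix v assume "v \<in> carrier (vec_mod d :: ('k, 'k vec) module)"
    show "vec_comb M t d v \<in> carrier M"
      unfolding vec_comb_def by (rule M.finsum_closed) auto
  next
    fix v w assume vw: "v \<in> carrier (vec_mod d :: ('k, 'k vec) module)"
        "w \<in> carrier (vec_mod d :: ('k, 'k vec) module)"
    have "vec_comb M t d (v + w) = (\<Oplus>\<^bsub>M\<^esub>j\<in>{..<d}. (v $ j) \<odot>\<^bsub>M\<^esub> t j \<oplus>\<^bsub>M\<^esub> (w $ j) \<odot>\<^bsub>M\<^esub> t j)"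
      unfolding vec_comb_def
      by (rule M.finsum_cong') (use vw t smult_l_distr in \<open>auto simp: module_vec_simps\<close>)
    also have "\<dots> = vec_comb M t d v \<oplus>\<^bsub>M\<^esub> vec_comb M t d w"
      unfolding vec_comb_def by (rule M.finsum_addf) auto
    finally show "vec_comb M t d (v \<oplus>\<^bsub>vec_mod d\<^esub> w) = vec_comb M t d v \<oplus>\<^bsub>M\<^esub> vec_comb M t d w"
      by (simp add: module_vec_simps)
  next
    fix r v assume v: "v \<in> carrier (vec_mod d :: ('k, 'k vec) module)"
    have "vec_comb M t d (r \<cdot>\<^sub>v v) = (\<Oplus>\<^bsub>M\<^esub>j\<in>{..<d}. r \<odot>\<^bsub>M\<^esub> ((v $ j) \<odot>\<^bsub>M\<^esub> t j))"
      unfolding vec_comb_def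
      by (rule M.finsum_cong') (use v t smult_assoc1 in \<open>auto simp: module_vec_simps\<close>)
    also have "\<dots> = r \<odot>\<^bsub>M\<^esub> vec_comb M t d v"
      unfolding vec_comb_def by (rule finsum_smult[symmetric]) auto
    finally show "vec_comb M t d (r \<odot>\<^bsub>vec_mod d\<^esub> v) = r \<odot>\<^bsub>M\<^esub> vec_comb M t d v"
      by (simp add: module_vec_simps)
  qed
qed

lemma vec_comb_unit:
  fixes M :: "('k::field, 'b) module"
  assumes M: "module type_ring M" and t: "\<And>j. j < d \<Longrightarrow> t j \<in> carrier M" and i: "i < d"
  shows "vec_comb M t d (unit_vec d i) = t i"
proof -
  interpret module "type_ring :: 'k ring" M by (rule M)
  have "vec_comb M t d (unit_vec d i) = (\<Oplus>\<^bsub>M\<^esub>j\<in>{..<d}. if i = j then t j else \<zero>\<^bsub>M\<^esub>)"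
    unfolding vec_comb_def
    by (rule M.finsum_cong') (use t smult_one lmult_0 i in \<open>auto simp: unit_vec_def\<close>)
  also have "\<dots> = t i"
    by (rule M.finsum_singleton) (use i t in auto)
  finally show ?thesis .
qed

lemma vec_hom_eq_comb:
  fixes M :: "('k::field, 'b) module"
  assumes M: "module type_ring M" and f: "f \<in> module_hom type_ring (vec_mod d) M" and v: "v \<in> carrier_vec d"
  shows "f v = vec_comb M (\<lambda>j. f (unit_vec d j)) d v"
proof -
  interpret module "type_ring :: 'k ring" M by (rule M)
  \<comment> \<open>Truncations of \<open>v\<close> to the first \<open>m\<close> coordinates:
    passing from \<open>m\<close> to \<open>Suc m\<close> adds a multiple of one unit vector, so
    additivity of \<open>f\<close> is applied one coordinate at a time until
    \<open>w d = v\<close>.\<close>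
  define w where "w m = vec d (\<lambda>i. if i < m then v $ i else 0)" for m
  have f_in: "f x \<in> carrier M" if "x \<in> carrier_vec d" for x
    using module_homD(1)[OF f] that by (simp add: module_vec_simps)
  have [simp]: "c \<odot>\<^bsub>M\<^esub> f x \<in> carrier M" if "x \<in> carrier_vec d" for c x
    using f_in[OF that] smult_closed[of c "f x"] by simp
  have sum: "f (w m) = (\<Oplus>\<^bsub>M\<^esub>j\<in>{..<m}. (v $ j) \<odot>\<^bsub>M\<^esub> f (unit_vec d j))" if "m \<le> d" for m
    using that
  proof (induction m)
    case 0
    have "w 0 = 0\<^sub>v d" by (auto simp: w_def)
    then show ?case
      using module_hom_zero[OF module_vec_mod M f] by (simp add: module_vec_simps)
  next
    case (Suc m)
    have "w (Suc m) = w m + (v $ m) \<cdot>\<^sub>v unit_vec d m"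
      by (rule eq_vecI) (use Suc.prems in \<open>auto simp: w_def unit_vec_def less_Suc_eq\<close>)
    then have "f (w (Suc m)) = f (w m) \<oplus>\<^bsub>M\<^esub> (v $ m) \<odot>\<^bsub>M\<^esub> f (unit_vec d m)"
      using module_homD(2)[OF f, of "w m" "(v $ m) \<cdot>\<^sub>v unit_vec d m"] module_homD(3)[OF f, of "v $ m"
          "unit_vec d m"]
      by (simp add: module_vec_simps w_def)
    also have "\<dots> = (\<Oplus>\<^bsub>M\<^esub>j\<in>{..<Suc m}. (v $ j) \<odot>\<^bsub>M\<^esub> f (unit_vec d j))"
      using Suc by (subst lessThan_Suc, subst M.finsum_insert) (auto simp: f_in M.a_comm Pi_iff)
    finally show ?case .
  qed
  have "w d = v" using v by (auto simp: w_def)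
  with sum[of d] show ?thesis by (simp only: vec_comb_def order_refl)
qed

lemma vec_hom_eqI:
  fixes M :: "('k::field, 'b) module"
  assumes M: "module type_ring M" and f: "f \<in> module_hom type_ring (vec_mod d) M" and g:
      "g \<in> module_hom type_ring (vec_mod d) M"
    and eq: "\<And>j. j < d \<Longrightarrow> f (unit_vec d j) = g (unit_vec d j)" and v: "v \<in> carrier_vec d"
  shows "f v = g v"
proof -
  interpret module "type_ring :: 'k ring" M by (rule M)
  have "vec_comb M (\<lambda>j. f (unit_vec d j)) d v = vec_comb M (\<lambda>j. g (unit_vec d j)) d v"
    unfolding vec_comb_def
    by (rule M.finsum_cong') (use eq in \<open>auto intro!: smult_closed module_homD(1)[OF g]
        simp: module_vec_simps\<close>)
  then show ?thesis
    using vec_hom_eq_comb[OF M f v] vec_hom_eq_comb[OF M g v] by simp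
qed

lemma mult_mat_vec_hom:
  "A \<in> carrier_mat m d \<Longrightarrow> (\<lambda>v. A *\<^sub>v v) \<in> module_hom type_ring (vec_mod d) (vec_mod m :: ('k::field, 'k vec)
      module)"
  by (rule module_homI) (auto simp: module_vec_simps mult_add_distrib_mat_vec mult_mat_vec)

lemma vec_hom_matrix:
  assumes f: "f \<in> module_hom type_ring (vec_mod d) (vec_mod m :: ('k::field, 'k vec) module)"
  obtains A where "A \<in> carrier_mat m d" "\<And>v. v \<in> carrier_vec d \<Longrightarrow> f v = A *\<^sub>v v"
proof
  let ?A = "mat m d (\<lambda>(i, j). f (unit_vec d j) $ i)"
  show A: "?A \<in> carrier_mat m d" by simp
  fix v :: "'k vec" assume v: "v \<in> carrier_vec d"
  have fu: "f (unit_vec d j) \<in> carrier_vec m" for j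
    using module_homD(1)[OF f, of "unit_vec d j"] by (simp add: module_vec_simps)
  show "f v = ?A *\<^sub>v v"
    by (rule vec_hom_eqI[OF module_vec_mod f mult_mat_vec_hom[OF A] _ v])
      (use fu in \<open>auto intro!: eq_vecI simp: carrier_vecD[OF fu]\<close>)
qed

section \<open>Coordinates and finite projective modules over a field\<close>

text \<open>Coordinates are kept as an isomorphism from \<open>k^d\<close> rather than as a basis,
  so that linear maps become matrices by mere composition. Bases, which \<open>End_char_poly\<close>
  speaks of, are reached through \<open>basis_iff_coord\<close> and
  \<open>coord_basis\<close>.\<close>

definition coord :: "('k::field, 'b) module \<Rightarrow> nat \<Rightarrow> ('k vec \<Rightarrow> 'b) \<Rightarrow> bool" where
  "coord M d \<Phi> \<longleftrightarrow> \<Phi> \<in> module_hom type_ring (vec_mod d) M \<and> bij_betw \<Phi> (carrier_vec d) (carrier M)"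

lemma coordD:
  assumes "coord M d \<Phi>"
  shows "v \<in> carrier_vec d \<Longrightarrow> \<Phi> v \<in> carrier M"
    and "v \<in> carrier_vec d \<Longrightarrow> w \<in> carrier_vec d \<Longrightarrow> \<Phi> (v + w) = \<Phi> v \<oplus>\<^bsub>M\<^esub> \<Phi> w"
    and "v \<in> carrier_vec d \<Longrightarrow> \<Phi> (c \<cdot>\<^sub>v v) = c \<odot>\<^bsub>M\<^esub> \<Phi> v"
    and "v \<in> carrier_vec d \<Longrightarrow> w \<in> carrier_vec d \<Longrightarrow> \<Phi> v = \<Phi> w \<longleftrightarrow> v = w"
  using assms module_homD[of \<Phi> type_ring "vec_mod d" M]
  by (auto simp: coord_def module_vec_simps bij_betw_def inj_on_eq_iff)

lemma coord_surj:
  assumes "coord M d \<Phi>" "x \<in> carrier M"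
  obtains v where "v \<in> carrier_vec d" "x = \<Phi> v"
  using assms by (auto simp: coord_def bij_betw_def)

lemma coord_inv:
  assumes "coord M d \<Phi>"
  shows "inv_into (carrier_vec d) \<Phi> \<in> module_hom type_ring M (vec_mod d)"
    and "x \<in> carrier M \<Longrightarrow> inv_into (carrier_vec d) \<Phi> x \<in> carrier_vec d"
    and "x \<in> carrier M \<Longrightarrow> \<Phi> (inv_into (carrier_vec d) \<Phi> x) = x"
    and "v \<in> carrier_vec d \<Longrightarrow> inv_into (carrier_vec d) \<Phi> (\<Phi> v) = v"
  using assms module_hom_inv_into[OF module_vec_mod, of \<Phi> d M]
  by (auto simp: coord_def module_vec_simps bij_betw_def f_inv_into_f intro: inv_into_into)

lemma coordI:
  assumes "\<Phi> \<in> module_hom type_ring (vec_mod d) M"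
    and "\<And>x. x \<in> carrier M \<Longrightarrow> \<Psi> x \<in> carrier_vec d"
    and "\<And>x. x \<in> carrier M \<Longrightarrow> \<Phi> (\<Psi> x) = x"
    and "\<And>v. v \<in> carrier_vec d \<Longrightarrow> \<Psi> (\<Phi> v) = v"
  shows "coord M d \<Phi>"
  unfolding coord_def
proof
  show "bij_betw \<Phi> (carrier_vec d) (carrier M)"
    by (rule bij_betw_byWitness[where f' = \<Psi>])
      (use assms module_homD(1)[OF assms(1)] in \<open>auto simp: module_vec_simps\<close>)
qed (rule assms(1))

lemma coord_comp:
  assumes "coord M d \<Phi>" "h \<in> module_hom type_ring M N" "bij_betw h (carrier M) (carrier N)"
  shows "coord N d (h \<circ> \<Phi>)"
  using assms by (auto simp: coord_def intro: module_hom_comp bij_betw_trans)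

text \<open>Links \<open>basis_criterion\<close>, which speaks of unique existence of coefficients,
  with the bijectivity demanded by \<open>coord\<close>.\<close>

lemma bij_betw_iff_ex1:
  assumes "\<And>a. a \<in> A \<Longrightarrow> f a \<in> B"
  shows "bij_betw f A B \<longleftrightarrow> (\<forall>b\<in>B. \<exists>!a. a \<in> A \<and> f a = b)"
proof
  assume "bij_betw f A B"
  then show "\<forall>b\<in>B. \<exists>!a. a \<in> A \<and> f a = b"
    unfolding bij_betw_def inj_on_def by blast
next
  assume ex1: "\<forall>b\<in>B. \<exists>!a. a \<in> A \<and> f a = b"
  have "inj_on f A"
  proof (rule inj_onI)
    fix x y assume "x \<in> A" "y \<in> A" "f x = f y"
    then show "x = y" using ex1 assms[of x] by metis
  qed
  moreover have "f ` A = B"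
  proof
    show "B \<subseteq> f ` A" using ex1 by (metis image_eqI subsetI)
  qed (use assms in auto)
  ultimately show "bij_betw f A B" by (simp add: bij_betw_def)
qed

lemma basis_iff_coord:
  fixes M :: "('k::field, 'b) module"
  assumes M: "module type_ring M" and bs: "distinct bs" "set bs \<subseteq> carrier M"
  shows "vectorspace.basis type_ring M (set bs) \<longleftrightarrow> coord M (length bs) (vec_comb M ((!) bs) (length bs))"
proof -
  interpret vectorspace "type_ring :: 'k ring" M by (rule vectorspaceI[OF M])
  let ?d = "length bs"
  \<comment> \<open>Reads a coefficient function along the list. Distinctness of \<open>bs\<close>
    makes this a bijection from functions on \<open>set bs\<close> onto \<open>k^d\<close>; the
    inverse looks up the position of an element in the list.\<close>
  define F :: "('b \<Rightarrow> 'k) \<Rightarrow> 'k vec" where "F a = vec ?d (\<lambda>i. a (bs ! i))" for a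
  have in_M: "bs ! i \<in> carrier M" if "i < ?d" for i
    using bs that by auto
  have inj: "inj_on ((!) bs) {..<?d}"
    using inj_on_nth[OF bs(1), of "{..<length bs}"] by simp
  have img: "(!) bs ` {..<?d} = set bs"
    unfolding set_conv_nth by blast
  have F: "bij_betw F (set bs \<rightarrow>\<^sub>E UNIV) (carrier_vec ?d)"
  proof (rule bij_betw_byWitness[where f' = "\<lambda>v. \<lambda>b\<in>set bs. v $ the_inv_into {..<?d} ((!) bs) b"])
    show "\<forall>a\<in>set bs \<rightarrow>\<^sub>E UNIV. (\<lambda>b\<in>set bs. F a $ the_inv_into {..<?d} ((!) bs) b) = a"
    proof
      fix a :: "'b \<Rightarrow> 'k" assume a: "a \<in> set bs \<rightarrow>\<^sub>E UNIV"
      show "(\<lambda>b\<in>set bs. F a $ the_inv_into {..<?d} ((!) bs) b) = a"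
      proof (rule PiE_ext[where k = "set bs" and s = "\<lambda>_. UNIV"])
        fix b assume b: "b \<in> set bs"
        then obtain i where i: "i < ?d" "b = bs ! i" by (auto simp: in_set_conv_nth)
        then have "the_inv_into {..<?d} ((!) bs) b = i"
          using the_inv_into_f_f[OF inj, of i] by simp
        then show "(\<lambda>b\<in>set bs. F a $ the_inv_into {..<?d} ((!) bs) b) b = a b"
          using i b by (simp add: F_def)
      qed (use a in auto)
    qed
    show "\<forall>v\<in>carrier_vec ?d. F (\<lambda>b\<in>set bs. v $ the_inv_into {..<?d} ((!) bs) b) = v"
      using the_inv_into_f_f[OF inj] by (auto simp: F_def)
  qed (auto simp: F_def)
  have L: "lincomb a (set bs) = (vec_comb M ((!) bs) ?d \<circ> F) a" for a
  proof -
    have "lincomb a (set bs) = (\<Oplus>\<^bsub>M\<^esub>v\<in>(!) bs ` {..<?d}. a v \<odot>\<^bsub>M\<^esub> v)"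
      by (simp only: lincomb_def img)
    also have "\<dots> = (\<Oplus>\<^bsub>M\<^esub>i\<in>{..<?d}. a (bs ! i) \<odot>\<^bsub>M\<^esub> (bs ! i))"
      by (rule M.finsum_reindex) (use inj in_M in auto)
    also have "\<dots> = vec_comb M ((!) bs) ?d (F a)"
      unfolding vec_comb_def by (rule M.finsum_cong') (use in_M in \<open>auto simp: F_def\<close>)
    finally show ?thesis by simp
  qed
  have hom: "vec_comb M ((!) bs) ?d \<in> module_hom type_ring (vec_mod ?d) M"
    by (rule vec_comb_hom[OF M in_M])
  have "basis (set bs) \<longleftrightarrow> (\<forall>v\<in>carrier M. \<exists>!a. a \<in> set bs \<rightarrow>\<^sub>E UNIV \<and> lincomb a (set bs) = v)"
    using basis_criterion[of "set bs"] bs by (auto simp: Ball_def)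
  also have "\<dots> \<longleftrightarrow> bij_betw (\<lambda>a. lincomb a (set bs)) (set bs \<rightarrow>\<^sub>E UNIV) (carrier M)"
    by (rule bij_betw_iff_ex1[symmetric]) (use bs in auto)
  also have "(\<lambda>a. lincomb a (set bs)) = vec_comb M ((!) bs) ?d \<circ> F"
    using L by auto
  also have "bij_betw (vec_comb M ((!) bs) ?d \<circ> F) (set bs \<rightarrow>\<^sub>E UNIV) (carrier M)
      \<longleftrightarrow> bij_betw (vec_comb M ((!) bs) ?d) (carrier_vec ?d) (carrier M)"
    using bij_betw_comp_iff[OF F] by blast
  also have "\<dots> \<longleftrightarrow> coord M ?d (vec_comb M ((!) bs) ?d)"
    using hom by (simp add: coord_def)
  finally show ?thesis .
qed

text \<open>The combination map of the images of the unit vectors agrees with \<open>\<Phi>\<close>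
  on unit vectors, hence everywhere, and so inherits its bijectivity.\<close>

lemma coord_basis:
  fixes M :: "('k::field, 'b) module"
  assumes M: "module type_ring M" and \<Phi>: "coord M d \<Phi>"
  defines "bs \<equiv> map (\<lambda>j. \<Phi> (unit_vec d j)) [0..<d]"
  shows "distinct bs" "length bs = d" "set bs \<subseteq> carrier M"
    "vectorspace.basis type_ring M (set bs)"
    "\<And>v. v \<in> carrier_vec d \<Longrightarrow> vec_comb M ((!) bs) d v = \<Phi> v"
proof -
  have inj: "\<Phi> (unit_vec d i) = \<Phi> (unit_vec d j) \<longleftrightarrow> i = j" if "i < d" "j < d" for i j
    using that coordD(4)[OF \<Phi>, of "unit_vec d i" "unit_vec d j"] by simp
  show d: "distinct bs"
    by (auto simp: bs_def distinct_map inj_on_def inj)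
  show l: "length bs = d" by (simp add: bs_def)
  show c: "set bs \<subseteq> carrier M"
    using coordD(1)[OF \<Phi>] by (auto simp: bs_def)
  show comb: "vec_comb M ((!) bs) d v = \<Phi> v" if "v \<in> carrier_vec d" for v
  proof -
    have nth: "bs ! j \<in> carrier M" if "j < d" for j using that c l by auto
    show ?thesis
      by (rule vec_hom_eqI[OF M vec_comb_hom[OF M nth] _ _ that])
        (use \<Phi> vec_comb_unit[OF M nth] in \<open>auto simp: coord_def bs_def\<close>)
  qed
  have "coord M d (vec_comb M ((!) bs) d)"
  proof -
    have "bij_betw (vec_comb M ((!) bs) d) (carrier_vec d) (carrier M)"
      using \<Phi> comb bij_betw_cong[of "carrier_vec d" \<Phi> "vec_comb M ((!) bs) d" "carrier M"]
          by (simp add: coord_def)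
    moreover have "vec_comb M ((!) bs) d \<in> module_hom type_ring (vec_mod d) M"
      by (rule vec_comb_hom[OF M]) (use c l in auto)
    ultimately show ?thesis by (simp add: coord_def)
  qed
  then show "vectorspace.basis type_ring M (set bs)"
    using basis_iff_coord[OF M d c] l by simp
qed

lemma coord_dim:
  fixes M :: "('k::field, 'b) module"
  assumes M: "module type_ring M" and \<Phi>: "coord M d \<Phi>"
  shows "vectorspace.dim type_ring M = d"
proof -
  interpret vectorspace "type_ring :: 'k ring" M by (rule vectorspaceI[OF M])
  show ?thesis
    using coord_basis(1-4)[OF M \<Phi>] dim_basis distinct_card by (metis List.finite_set)
qed

lemma coord_if_fin_dim:
  fixes M :: "('k::field, 'b) module"
  assumes M: "module type_ring M" and "vectorspace.fin_dim type_ring M"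
  obtains d \<Phi> where "coord M d \<Phi>"
proof -
  interpret vectorspace "type_ring :: 'k ring" M by (rule vectorspaceI[OF M])
  obtain B where B: "finite B" "basis B" using assms finite_basis_exists by blast
  then obtain bs where bs: "set bs = B" "distinct bs" using finite_distinct_list by blast
  then have "coord M (length bs) (vec_comb M ((!) bs) (length bs))"
    using basis_iff_coord[OF M, of bs] B by (auto simp: basis_def)
  then show thesis by (rule that)
qed

lemma finite_projective_if_coord:
  fixes M :: "('k::field, 'b) module"
  assumes M: "module type_ring M" and \<Phi>: "coord M d \<Phi>"
  shows "finite_projective type_ring M"
proof -
  interpret vectorspace "type_ring :: 'k ring" M by (rule vectorspaceI[OF M])
  define bs where "bs = map (\<lambda>j. \<Phi> (unit_vec d j)) [0..<d]"
  note bs = coord_basis[OF M \<Phi>, folded bs_def]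
  define \<Psi> where "\<Psi> = inv_into (carrier_vec d) \<Phi>"
  note \<Psi> = coord_inv[OF \<Phi>, folded \<Psi>_def]
  define ix where "ix = the_inv_into {..<d} ((!) bs)"
  have inj: "inj_on ((!) bs) {..<d}"
    using bs by (simp add: inj_on_nth)
  have ix: "ix (bs ! j) = j" if "j < d" for j
    using that the_inv_into_f_f[OF inj, of j] by (simp add: ix_def)
  have ix_less: "ix b < d" if "b \<in> set bs" for b
    using that ix bs(2) by (auto simp: in_set_conv_nth)
  \<comment> \<open>\<open>projective_module\<close> asks for a free module whose basis lies in the
    element type of \<open>M\<close>, so the basis vectors of \<open>M\<close> themselves serve as
    index set. The maps \<open>i\<close> and \<open>s\<close> pass to coordinates and back.\<close>
  let ?F = "free_module (type_ring :: 'k ring) (set bs)"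
  define i where "i x = (\<lambda>b\<in>set bs. \<Psi> x $ ix b)" for x
  define s where "s c = \<Phi> (vec d (\<lambda>j. c (bs ! j)))" for c
  have bsS: "bs ! j \<in> set bs" if "j < d" for j using that bs(2) by auto
  have "i \<in> module_hom type_ring M ?F"
  proof (rule module_homI)
    show "i x \<in> carrier ?F" for x by (auto simp: free_module_def i_def)
    fix x assume x: "x \<in> carrier M"
    show "i (x \<oplus>\<^bsub>M\<^esub> y) = i x \<oplus>\<^bsub>?F\<^esub> i y" if y: "y \<in> carrier M" for y
      using module_homD(2)[OF \<Psi>(1) x y] carrier_vecD[OF \<Psi>(2)[OF x]] carrier_vecD[OF \<Psi>(2)[OF y]]
      by (auto simp: free_module_def i_def module_vec_simps ix_less restrict_def fun_eq_iff)
    show "i (r \<odot>\<^bsub>M\<^esub> x) = r \<odot>\<^bsub>?F\<^esub> i x" for r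
      using module_homD(3)[OF \<Psi>(1) _ x, of r] carrier_vecD[OF \<Psi>(2)[OF x]]
      by (auto simp: free_module_def i_def module_vec_simps ix_less restrict_def fun_eq_iff)
  qed
  moreover have "s \<in> module_hom type_ring ?F M"
  proof (rule module_homI)
    show "s c \<in> carrier M" for c using coordD(1)[OF \<Phi>] by (simp add: s_def)
    fix c e assume "c \<in> carrier ?F" "e \<in> carrier ?F"
    have "vec d (\<lambda>j. (c \<oplus>\<^bsub>?F\<^esub> e) (bs ! j)) = vec d (\<lambda>j. c (bs ! j)) + vec d (\<lambda>j. e (bs ! j))"
      by (rule eq_vecI) (auto simp: free_module_def bsS)
    then show "s (c \<oplus>\<^bsub>?F\<^esub> e) = s c \<oplus>\<^bsub>M\<^esub> s e"
      using coordD(2)[OF \<Phi>] by (simp add: s_def)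
  next
    fix r c assume "c \<in> carrier ?F"
    have "vec d (\<lambda>j. (r \<odot>\<^bsub>?F\<^esub> c) (bs ! j)) = r \<cdot>\<^sub>v vec d (\<lambda>j. c (bs ! j))"
      by (rule eq_vecI) (auto simp: free_module_def bsS)
    then show "s (r \<odot>\<^bsub>?F\<^esub> c) = r \<odot>\<^bsub>M\<^esub> s c"
      using coordD(3)[OF \<Phi>] by (simp add: s_def)
  qed
  moreover have "\<forall>x\<in>carrier M. s (i x) = x"
  proof
    fix x assume x: "x \<in> carrier M"
    have "vec d (\<lambda>j. i x (bs ! j)) = \<Psi> x"
      by (rule eq_vecI) (use \<Psi>(2)[OF x] in \<open>auto simp: i_def bsS ix\<close>)
    then show "s (i x) = x" using \<Psi>(3)[OF x] by (simp add: s_def)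
  qed
  ultimately have "projective_module type_ring M"
    using M unfolding projective_module_def by blast
  moreover have "span (set bs) = carrier M"
    using bs(4) by (simp add: basis_def)
  ultimately show ?thesis
    using bs(3) unfolding finite_projective_def by blast
qed

text \<open>Over a field a finite generating set contains a basis, and a space with finite
  coordinates is a retract of a finite free module. From here on finite projective modules are
  handled through coordinates.\<close>

lemma finite_projective_iff_coord:
  "finite_projective type_ring (M :: ('k::field, 'b) module) \<longleftrightarrow> module type_ring M \<and> (\<exists>d \<Phi>. coord M d \<Phi>)"
proof
  assume fp: "finite_projective type_ring M"
  then have M: "module type_ring M"
    by (simp add: finite_projective_def projective_module_def)
  interpret vectorspace "type_ring :: 'k ring" M by (rule vectorspaceI[OF M])
  have "fin_dim"
    using fp by (auto simp: finite_projective_def fin_dim_def)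
  then show "module type_ring M \<and> (\<exists>d \<Phi>. coord M d \<Phi>)"
    using M coord_if_fin_dim[OF M] by metis
qed (auto intro: finite_projective_if_coord)

section \<open>Matrices and characteristic polynomials of endomorphisms\<close>

text \<open>Bundles module axioms, coordinates and matrix. Linearity of the endomorphism is not a
  clause: it follows from the matrix description, see \<open>mat_rep_hom\<close>.\<close>

definition mat_rep :: "('k::field, 'b) endo \<Rightarrow> nat \<Rightarrow> 'k mat \<Rightarrow> ('k vec \<Rightarrow> 'b) \<Rightarrow> bool" where
  "mat_rep E d A \<Phi> \<longleftrightarrow> module type_ring (fst E) \<and> coord (fst E) d \<Phi> \<and> A \<in> carrier_mat d d \<and>
     (\<forall>v\<in>carrier_vec d. snd E (\<Phi> v) = \<Phi> (A *\<^sub>v v))"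

lemma mat_repD:
  assumes "mat_rep E d A \<Phi>"
  shows "module type_ring (fst E)" "coord (fst E) d \<Phi>" "A \<in> carrier_mat d d"
    "v \<in> carrier_vec d \<Longrightarrow> snd E (\<Phi> v) = \<Phi> (A *\<^sub>v v)"
  using assms by (auto simp: mat_rep_def)

lemma mat_rep_hom:
  fixes E :: "('k::field, 'b) endo"
  assumes "mat_rep E d A \<Phi>"
  shows "snd E \<in> module_hom type_ring (fst E) (fst E)"
proof -
  note rep = mat_repD[OF assms]
  note \<Phi> = coordD[OF rep(2)]
  have A: "A *\<^sub>v v \<in> carrier_vec d" if "v \<in> carrier_vec d" for v
    using rep(3) that by auto
  interpret module type_ring "fst E" by (rule rep(1))
  show ?thesis
  proof (rule module_homI)
    fix x assume "x \<in> carrier (fst E)"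
    then obtain v where v: "v \<in> carrier_vec d" "x = \<Phi> v" by (rule coord_surj[OF rep(2)])
    show "snd E x \<in> carrier (fst E)"
      using v A \<Phi>(1) rep(4) by simp
    show "snd E (r \<odot>\<^bsub>fst E\<^esub> x) = r \<odot>\<^bsub>fst E\<^esub> snd E x" for r
    proof -
      have "A *\<^sub>v (r \<cdot>\<^sub>v v) = r \<cdot>\<^sub>v (A *\<^sub>v v)"
        using rep(3) v by (simp add: mult_mat_vec)
      then show ?thesis
        using v A[OF v(1)] rep(4)[OF v(1)] rep(4)[of "r \<cdot>\<^sub>v v"] \<Phi>(3)[of v r] \<Phi>(3)[of "A *\<^sub>v v" r] by simp
    qed
    fix y assume "y \<in> carrier (fst E)"
    then obtain w where w: "w \<in> carrier_vec d" "y = \<Phi> w" by (rule coord_surj[OF rep(2)])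
    have "A *\<^sub>v (v + w) = A *\<^sub>v v + A *\<^sub>v w"
      using rep(3) v w by (simp add: mult_add_distrib_mat_vec)
    then show "snd E (x \<oplus>\<^bsub>fst E\<^esub> y) = snd E x \<oplus>\<^bsub>fst E\<^esub> snd E y"
      using v w A rep(4) rep(4)[of "v + w"] \<Phi>(2)[of v w] \<Phi>(2)[of "A *\<^sub>v v" "A *\<^sub>v w"] by simp
  qed
qed

lemma mat_rep_exists:
  assumes M: "module type_ring M" and \<Phi>: "coord M d \<Phi>" and f: "f \<in> module_hom type_ring M M"
  obtains A where "mat_rep (M, f) d A \<Phi>"
proof -
  have "inv_into (carrier_vec d) \<Phi> \<circ> (f \<circ> \<Phi>) \<in> module_hom type_ring (vec_mod d) (vec_mod d)"
    using \<Phi> f coord_inv(1)[OF \<Phi>] by (auto simp: coord_def intro!: module_hom_comp)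
  then obtain A where A: "A \<in> carrier_mat d d"
    "\<And>v. v \<in> carrier_vec d \<Longrightarrow> (inv_into (carrier_vec d) \<Phi> \<circ> (f \<circ> \<Phi>)) v = A *\<^sub>v v"
    by (rule vec_hom_matrix) blast
  have "f (\<Phi> v) = \<Phi> (A *\<^sub>v v)" if v: "v \<in> carrier_vec d" for v
    using A(2)[OF v] coord_inv(3)[OF \<Phi>, of "f (\<Phi> v)"] module_homD(1)[OF f] coordD(1)[OF \<Phi> v] by simp
  then have "mat_rep (M, f) d A \<Phi>"
    using M \<Phi> A by (auto simp: mat_rep_def)
  then show thesis by (rule that)
qed

lemma End_objD:
  assumes "E \<in> End_obj type_ring"
  shows "module type_ring (fst E)" "snd E \<in> module_hom type_ring (fst E) (fst E)"
  using assms by (auto simp: End_obj_def finite_projective_iff_coord)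

lemma End_obj_iff_mat_rep:
  "E \<in> End_obj type_ring \<longleftrightarrow> (\<exists>d A \<Phi>. mat_rep E d A \<Phi>)"
proof
  assume E: "E \<in> End_obj type_ring"
  then obtain d \<Phi> where "coord (fst E) d \<Phi>"
    by (auto simp: End_obj_def finite_projective_iff_coord)
  with End_objD[OF E] show "\<exists>d A \<Phi>. mat_rep E d A \<Phi>"
    by (metis mat_rep_exists prod.collapse)
next
  assume "\<exists>d A \<Phi>. mat_rep E d A \<Phi>"
  then obtain d A \<Phi> where rep: "mat_rep E d A \<Phi>" by blast
  then have "finite_projective type_ring (fst E)"
    using mat_repD[OF rep] finite_projective_iff_coord by blast
  then show "E \<in> End_obj type_ring"
    using mat_rep_hom[OF rep] by (simp add: End_obj_def split_beta)
qed

lemma mat_eqI_unit: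
  assumes A: "A \<in> carrier_mat n d" and B: "B \<in> carrier_mat n d"
    and eq: "\<And>j. j < d \<Longrightarrow> A *\<^sub>v unit_vec d j = B *\<^sub>v (unit_vec d j :: 'k::field vec)"
  shows "A = B"
proof (rule eq_matI)
  fix i j assume ij: "i < dim_row B" "j < dim_col B"
  have "(A *\<^sub>v unit_vec d j) $ i = (B *\<^sub>v unit_vec d j) $ i"
    using eq ij B by simp
  then show "A $$ (i, j) = B $$ (i, j)"
    using A B ij by simp
qed (use A B in auto)

text \<open>Change of coordinates: the two coordinate maps differ by mutually inverse matrices
  \<open>P\<close> and \<open>Q\<close>, which conjugate \<open>A'\<close> into \<open>A\<close>.
  The sizes agree because both are the dimension of the space.\<close>

lemma mat_rep_unique:
  fixes E :: "('k::field, 'b) endo"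
  assumes 1: "mat_rep E d A \<Phi>" and 2: "mat_rep E d' A' \<Phi>'"
  shows "d' = d" "char_poly A' = char_poly A"
proof -
  note r1 = mat_repD[OF 1] and r2 = mat_repD[OF 2]
  show d: "d' = d"
    using coord_dim[OF r1(1,2)] coord_dim[OF r2(1,2)] by simp
  note r2 = r2[unfolded d]
  let ?p = "inv_into (carrier_vec d) \<Phi>' \<circ> \<Phi>" and ?q = "inv_into (carrier_vec d) \<Phi> \<circ> \<Phi>'"
  have "?p \<in> module_hom type_ring (vec_mod d) (vec_mod d)" "?q \<in> module_hom type_ring (vec_mod d) (vec_mod d)"
    using r1(2) r2(2) coord_inv(1)[OF r1(2)] coord_inv(1)[OF r2(2)]
    by (auto simp: coord_def intro!: module_hom_comp)
  then obtain P Q where P: "P \<in> carrier_mat d d" "\<And>v. v \<in> carrier_vec d \<Longrightarrow> ?p v = P *\<^sub>v v"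
    and Q: "Q \<in> carrier_mat d d" "\<And>v. v \<in> carrier_vec d \<Longrightarrow> ?q v = Q *\<^sub>v v"
    by (metis vec_hom_matrix)
  have \<Phi>P: "\<Phi>' (P *\<^sub>v v) = \<Phi> v" and \<Phi>Q: "\<Phi> (Q *\<^sub>v v) = \<Phi>' v" if "v \<in> carrier_vec d" for v
    using P(2)[OF that] Q(2)[OF that] coord_inv(3)[OF r1(2) coordD(1)[OF r2(2) that]]
        coord_inv(3)[OF r2(2) coordD(1)[OF r1(2) that]]
    by auto
  have cl: "P *\<^sub>v v \<in> carrier_vec d" "Q *\<^sub>v v \<in> carrier_vec d" "A *\<^sub>v v \<in> carrier_vec d"
      "A' *\<^sub>v v \<in> carrier_vec d"
    if "v \<in> carrier_vec d" for v
    using P(1) Q(1) r1(3) r2(3) that by auto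
  have "P * Q = 1\<^sub>m d"
  proof (rule mat_eqI_unit)
    fix j assume "j < d"
    have "\<Phi>' (P *\<^sub>v (Q *\<^sub>v unit_vec d j)) = \<Phi>' (unit_vec d j)"
      using \<Phi>P \<Phi>Q cl by simp
    then have "P *\<^sub>v (Q *\<^sub>v unit_vec d j) = unit_vec d j"
      using coordD(4)[OF r2(2)] cl by simp
    then show "(P * Q) *\<^sub>v unit_vec d j = 1\<^sub>m d *\<^sub>v unit_vec d j"
      using P(1) Q(1) by simp
  qed (use P Q in auto)
  moreover have "Q * P = 1\<^sub>m d"
  proof (rule mat_eqI_unit)
    fix j assume "j < d"
    have "\<Phi> (Q *\<^sub>v (P *\<^sub>v unit_vec d j)) = \<Phi> (unit_vec d j)"
      using \<Phi>P \<Phi>Q cl by simp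
    then have "Q *\<^sub>v (P *\<^sub>v unit_vec d j) = unit_vec d j"
      using coordD(4)[OF r1(2)] cl by simp
    then show "(Q * P) *\<^sub>v unit_vec d j = 1\<^sub>m d *\<^sub>v unit_vec d j"
      using P(1) Q(1) by simp
  qed (use P Q in auto)
  \<comment> \<open>Both sides describe the endomorphism in the coordinates \<open>\<Phi>\<close>,
    the right one by a detour through \<open>\<Phi>'\<close>; injectivity of \<open>\<Phi>\<close>
    then compares columns.\<close>
  moreover have "A = Q * A' * P"
  proof (rule mat_eqI_unit)
    fix j assume "j < d"
    let ?e = "unit_vec d j :: 'k vec"
    have "\<Phi> (A *\<^sub>v ?e) = snd E (\<Phi>' (P *\<^sub>v ?e))"
      using \<Phi>P r1(4) by simp
    also have "\<dots> = \<Phi> (Q *\<^sub>v (A' *\<^sub>v (P *\<^sub>v ?e)))"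
      using \<Phi>Q r2(4) cl by simp
    finally have "A *\<^sub>v ?e = Q *\<^sub>v (A' *\<^sub>v (P *\<^sub>v ?e))"
      using coordD(4)[OF r1(2)] cl by simp
    then show "A *\<^sub>v ?e = (Q * A' * P) *\<^sub>v ?e"
      using P(1) Q(1) r2(3) by (simp add: assoc_mult_mat_vec[of _ d d _ d])
  qed (use P Q r1 r2 in auto)
  ultimately have "similar_mat_wit A A' Q P"
    using P(1) Q(1) r1(3) r2(3) by (simp add: similar_mat_wit_def Let_def)
  then have "similar_mat A A'"
    unfolding similar_mat_def by blast
  then show "char_poly A' = char_poly A"
    by (simp add: char_poly_similar)
qed

text \<open>The images of the unit vectors satisfy the definite description, and any other ordered
  basis satisfying it yields a second matrix representation, which has the same characteristic
  polynomial by \<open>mat_rep_unique\<close>.\<close>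

lemma End_char_poly_mat_rep:
  fixes E :: "('k::field, 'b) endo"
  assumes rep: "mat_rep E d A \<Phi>"
  shows "End_char_poly E = char_poly A"
proof -
  obtain M f where E: "E = (M, f)" by fastforce
  note r = mat_repD[OF rep, unfolded E fst_conv snd_conv]
  have f: "f \<in> module_hom type_ring M M"
    using mat_rep_hom[OF rep] by (simp add: E)
  define bs where "bs = map (\<lambda>j. \<Phi> (unit_vec d j)) [0..<d]"
  note bs = coord_basis[OF r(1,2), folded bs_def]
  let ?R = "\<lambda>bs B. distinct bs \<and> vectorspace.basis type_ring M (set bs) \<and>
      B \<in> carrier_mat (length bs) (length bs) \<and>
     (\<forall>j<length bs. f (bs ! j) = (\<Oplus>\<^bsub>M\<^esub>i\<in>{..<length bs}. (B $$ (i, j)) \<odot>\<^bsub>M\<^esub> (bs ! i)))"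
  interpret vectorspace type_ring M by (rule vectorspaceI[OF r(1)])
  \<comment> \<open>The sum in the definition is column \<open>j\<close> of the matrix, pushed into
    \<open>M\<close>. It is stated for a general list because it is applied both to
    \<open>bs\<close> and to an arbitrary basis \<open>cs\<close>.\<close>
  have comb: "(\<Oplus>\<^bsub>M\<^esub>i\<in>{..<n}. (B $$ (i, j)) \<odot>\<^bsub>M\<^esub> (bs ! i)) = vec_comb M ((!) bs) n (B *\<^sub>v unit_vec n j)"
    if "B \<in> carrier_mat n n" "j < n" "set bs \<subseteq> carrier M" "n = length bs" for B n j bs
    unfolding vec_comb_def
    by (rule M.finsum_cong') (use that in \<open>auto intro!: smult_closed\<close>)
  have "?R bs A"
  proof (intro conjI allI impI)
    fix j assume j: "j < length bs"
    have "f (bs ! j) = \<Phi> (A *\<^sub>v unit_vec d j)"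
      using j r(4) bs(2) by (simp add: bs_def)
    also have "\<dots> = vec_comb M ((!) bs) d (A *\<^sub>v unit_vec d j)"
      using bs(5)[of "A *\<^sub>v unit_vec d j"] r(3) by simp
    finally show "f (bs ! j) = (\<Oplus>\<^bsub>M\<^esub>i\<in>{..<length bs}. (A $$ (i, j)) \<odot>\<^bsub>M\<^esub> (bs ! i))"
      using comb[OF r(3) _ bs(3) bs(2)[symmetric], of j] j by (simp only: bs(2))
  qed (use bs r in auto)
  moreover have "char_poly B = char_poly A" if R: "?R cs B" for cs B
  proof -
    let ?n = "length cs"
    have cs: "set cs \<subseteq> carrier M" using R by (simp add: basis_def)
    have in_M: "cs ! j \<in> carrier M" if "j < ?n" for j using cs that by auto
    have co: "coord M ?n (vec_comb M ((!) cs) ?n)"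
      using basis_iff_coord[OF r(1) _ cs] R by blast
    have B: "B \<in> carrier_mat ?n ?n" using R by blast
    have "(f \<circ> vec_comb M ((!) cs) ?n) v = (vec_comb M ((!) cs) ?n \<circ> (\<lambda>v. B *\<^sub>v v)) v" if "v \<in> carrier_vec ?n"
        for v
    proof (rule vec_hom_eqI[OF r(1) _ _ _ that])
      show "f \<circ> vec_comb M ((!) cs) ?n \<in> module_hom type_ring (vec_mod ?n) M"
        using co f by (auto simp: coord_def intro: module_hom_comp)
      show "vec_comb M ((!) cs) ?n \<circ> (\<lambda>v. B *\<^sub>v v) \<in> module_hom type_ring (vec_mod ?n) M"
        using co mult_mat_vec_hom[OF B] by (auto simp: coord_def intro: module_hom_comp)
      fix j assume j: "j < ?n"
      show "(f \<circ> vec_comb M ((!) cs) ?n) (unit_vec ?n j) =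
          (vec_comb M ((!) cs) ?n \<circ> (\<lambda>v. B *\<^sub>v v)) (unit_vec ?n j)"
        using comb[OF B j cs] R j vec_comb_unit[OF r(1) in_M j] by simp
    qed
    then have "mat_rep E ?n B (vec_comb M ((!) cs) ?n)"
      using co B r(1) by (simp add: mat_rep_def E)
    then show ?thesis using mat_rep_unique(2)[OF rep] by simp
  qed
  ultimately have "\<exists>cs B. ?R cs B \<and> char_poly A = char_poly B"
    and "\<And>\<chi>. \<exists>cs B. ?R cs B \<and> \<chi> = char_poly B \<Longrightarrow> \<chi> = char_poly A"
    by blast+
  then have "(THE \<chi>. \<exists>cs B. ?R cs B \<and> \<chi> = char_poly B) = char_poly A"
    by (rule the_equality)
  then show ?thesis
    by (simp only: End_char_poly_def E prod.case conj_assoc)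
qed

lemma End_eigenvalues_mat_rep:
  fixes E :: "('k::field, 'b) endo"
  assumes rep: "mat_rep E d A \<Phi>"
  shows "End_eigenvalues E = {\<alpha>. poly (char_poly A) \<alpha> = 0}"
proof -
  note r = mat_repD[OF rep]
  have zero: "\<Phi> (0\<^sub>v d) = \<zero>\<^bsub>fst E\<^esub>"
    using module_hom_zero[OF module_vec_mod r(1)] r(2) by (simp add: coord_def module_vec_simps)
  have "\<alpha> \<in> End_eigenvalues E \<longleftrightarrow> eigenvalue A \<alpha>" for \<alpha>
  proof -
    have "\<alpha> \<in> End_eigenvalues E \<longleftrightarrow> (\<exists>x\<in>carrier (fst E). x \<noteq> \<zero>\<^bsub>fst E\<^esub> \<and> snd E x = \<alpha> \<odot>\<^bsub>fst E\<^esub> x)"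
      by (simp add: End_eigenvalues_def split_beta)
    also have "carrier (fst E) = \<Phi> ` carrier_vec d"
      using r(2) by (simp add: coord_def bij_betw_def)
    also have "(\<exists>x\<in>\<Phi> ` carrier_vec d. x \<noteq> \<zero>\<^bsub>fst E\<^esub> \<and> snd E x = \<alpha> \<odot>\<^bsub>fst E\<^esub> x) \<longleftrightarrow>
      (\<exists>v\<in>carrier_vec d. \<Phi> v \<noteq> \<Phi> (0\<^sub>v d) \<and> \<Phi> (A *\<^sub>v v) = \<Phi> (\<alpha> \<cdot>\<^sub>v v))"
      using r(4) zero coordD(3)[OF r(2)] by auto
    also have "\<dots> \<longleftrightarrow> (\<exists>v\<in>carrier_vec d. v \<noteq> 0\<^sub>v d \<and> A *\<^sub>v v = \<alpha> \<cdot>\<^sub>v v)"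
      using r(3) coordD(4)[OF r(2)] by (intro bex_cong refl) (metis mult_mat_vec_carrier smult_carrier_vec
          zero_carrier_vec)
    also have "\<dots> \<longleftrightarrow> eigenvalue A \<alpha>"
      using r(3) by (auto simp: eigenvalue_def eigenvector_def)
    finally show ?thesis .
  qed
  then show ?thesis using eigenvalue_root_char_poly[OF r(3)] by auto
qed

lemma mat_rep_iso:
  assumes rep: "mat_rep E d A \<Phi>" and D: "module type_ring (fst D)"
    and h: "h \<in> End_hom type_ring E D" "bij_betw h (carrier (fst E)) (carrier (fst D))"
  shows "mat_rep D d A (h \<circ> \<Phi>)"
proof -
  note r = mat_repD[OF rep]
  have "coord (fst D) d (h \<circ> \<Phi>)"
    using coord_comp[OF r(2)] h by (auto simp: End_hom_def)
  moreover have "snd D ((h \<circ> \<Phi>) v) = (h \<circ> \<Phi>) (A *\<^sub>v v)" if "v \<in> carrier_vec d" for v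
    using h(1) r(4)[OF that] coordD(1)[OF r(2) that] by (metis (mono_tags, lifting) End_hom_def comp_apply
        mem_Collect_eq)
  ultimately show ?thesis
    using D r by (simp add: mat_rep_def)
qed

text \<open>The characteristic matrix is again block upper triangular, now with polynomial entries,
  so its determinant is the product of those of the diagonal blocks.\<close>

lemma char_poly_four_block_lower_left_zero:
  fixes A :: "'k::idom mat"
  assumes A: "A \<in> carrier_mat n n" and B: "B \<in> carrier_mat n m" and C: "C \<in> carrier_mat m m"
  shows "char_poly (four_block_mat A B (0\<^sub>m m n) C) = char_poly A * char_poly C"
proof -
  have "char_poly_matrix (four_block_mat A B (0\<^sub>m m n) C) =
      four_block_mat (char_poly_matrix A) (map_mat (\<lambda>a. [:- a:]) B) (0\<^sub>m m n) (char_poly_matrix C)"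
    by (rule eq_matI) (use A B C in \<open>auto simp: char_poly_matrix_def four_block_mat_def Let_def one_poly_def\<close>)
  then show ?thesis
    unfolding char_poly_def
    using det_four_block_mat_lower_left_zero[of "char_poly_matrix A" n "map_mat (\<lambda>a. [:- a:]) B" m _
        "char_poly_matrix C"] A B C
    by simp
qed

lemma vec_mod_homD:
  assumes "f \<in> module_hom type_ring (vec_mod d) M"
  shows "v \<in> carrier_vec d \<Longrightarrow> f v \<in> carrier M"
    and "v \<in> carrier_vec d \<Longrightarrow> w \<in> carrier_vec d \<Longrightarrow> f (v + w) = f v \<oplus>\<^bsub>M\<^esub> f w"
    and "v \<in> carrier_vec d \<Longrightarrow> f (c \<cdot>\<^sub>v v) = c \<odot>\<^bsub>M\<^esub> f v"
  using module_homD[OF assms] by (simp_all add: module_vec_simps)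

text \<open>The image of a basis of the subspace together with lifts of a basis of the quotient is a
  basis of the middle term. Invariance of the subspace makes the lower left block zero;
  compatibility of \<open>i\<close> and \<open>q\<close> with the endomorphisms identifies the
  diagonal blocks.\<close>

lemma exact_mat_rep:
  fixes E' :: "('k::field, 'b) endo" and E :: "('k, 'c) endo" and E'' :: "('k, 'd) endo"
  assumes E: "module type_ring (fst E)" "snd E \<in> module_hom type_ring (fst E) (fst E)"
    and rep': "mat_rep E' m A \<Phi>'" and rep'': "mat_rep E'' n C \<Phi>''"
    and exact: "End_exact type_ring E' E E''"
  obtains B \<Phi> where "B \<in> carrier_mat m n" "mat_rep E (m + n) (four_block_mat A B (0\<^sub>m n m) C) \<Phi>"
proof -
  note r' = mat_repD[OF rep'] and r'' = mat_repD[OF rep'']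
  let ?M' = "fst E'" and ?M = "fst E" and ?M'' = "fst E''"
  obtain i q where "i \<in> End_hom type_ring E' E" "q \<in> End_hom type_ring E E''"
    and inj: "inj_on i (carrier ?M')" and surj: "q ` carrier ?M = carrier ?M''"
    and ker: "{x \<in> carrier ?M. q x = \<zero>\<^bsub>?M''\<^esub>} = i ` carrier ?M'"
    using exact unfolding End_exact_def by blast
  then have i: "i \<in> module_hom type_ring ?M' ?M" "\<And>x. x \<in> carrier ?M' \<Longrightarrow> i (snd E' x) = snd E (i x)"
    and q: "q \<in> module_hom type_ring ?M ?M''" "\<And>x. x \<in> carrier ?M \<Longrightarrow> q (snd E x) = snd E'' (q x)"
    by (auto simp: End_hom_def)
  interpret M: module "type_ring :: 'k ring" ?M by (rule E(1))
  interpret M'': module "type_ring :: 'k ring" ?M'' by (rule r''(1))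
  have qi: "q (i x) = \<zero>\<^bsub>?M''\<^esub>" if "x \<in> carrier ?M'" for x
    using ker that by blast
  have "\<forall>j. \<exists>x\<in>carrier ?M. q x = \<Phi>'' (unit_vec n j)"
    using surj coordD(1)[OF r''(2)] by (metis imageE unit_vec_carrier)
  \<comment> \<open>Arbitrary lifts of the basis of the quotient. Their linear extension
    \<open>T\<close> is a section of \<open>q\<close> as a linear map only; it need not commute with
    the endomorphisms, which is why a block \<open>B\<close> appears.\<close>
  then obtain t where t: "\<And>j. t j \<in> carrier ?M" "\<And>j. q (t j) = \<Phi>'' (unit_vec n j)"
    by metis
  define T where "T = vec_comb ?M t n"
  have T: "T \<in> module_hom type_ring (vec_mod n) ?M"
    unfolding T_def by (rule vec_comb_hom[OF E(1) t(1)])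
  have qT: "q (T w) = \<Phi>'' w" if "w \<in> carrier_vec n" for w
  proof -
    have "(q \<circ> T) w = \<Phi>'' w"
    proof (rule vec_hom_eqI[OF r''(1) module_hom_comp[OF T q(1)] _ _ that])
      show "\<Phi>'' \<in> module_hom type_ring (vec_mod n) ?M''" using r''(2) by (simp add: coord_def)
      show "(q \<circ> T) (unit_vec n j) = \<Phi>'' (unit_vec n j)" if "j < n" for j
        using vec_comb_unit[OF E(1) t(1) that] t(2) by (simp add: T_def)
    qed
    then show ?thesis by simp
  qed
  define I where "I = i \<circ> \<Phi>'"
  have I: "I \<in> module_hom type_ring (vec_mod m) ?M"
    unfolding I_def using r'(2) i(1) by (auto simp: coord_def intro: module_hom_comp)
  have inj_I: "I u = I v \<longleftrightarrow> u = v" if "u \<in> carrier_vec m" "v \<in> carrier_vec m" for u v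
    using inj that coordD(1)[OF r'(2)] coordD(4)[OF r'(2) that] by (simp add: I_def inj_on_eq_iff)
  \<comment> \<open>The first \<open>m\<close> and the last \<open>n\<close> coordinates:
    \<open>u\<close> is fed into the subspace, \<open>l\<close> into the lifts.\<close>
  define u where "u v = vec m (\<lambda>j. v $ j)" for v :: "'k vec"
  define l where "l v = vec n (\<lambda>j. v $ (m + j))" for v :: "'k vec"
  have ul [simp]: "u v \<in> carrier_vec m" "l v \<in> carrier_vec n" for v by (simp_all add: u_def l_def)
  have eq_ul: "v = w" if "u v = u w" "l v = l w" "v \<in> carrier_vec (m + n)" "w \<in> carrier_vec (m + n)" for v w
  proof (rule eq_vecI)
    fix j assume "j < dim_vec w"
    then have j: "j < m + n" using that by simp
    show "v $ j = w $ j"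
    proof (cases "j < m")
      case True
      then have "u v $ j = v $ j" "u w $ j = w $ j" by (simp_all add: u_def)
      then show ?thesis using that by simp
    next
      case False
      then have "l v $ (j - m) = v $ j" "l w $ (j - m) = w $ j" using j add_diff_inverse_nat[OF False]
          by (simp_all add: l_def not_less)
      then show ?thesis using that by simp
    qed
  qed (use that in simp)
  define \<Phi> where "\<Phi> v = I (u v) \<oplus>\<^bsub>?M\<^esub> T (l v)" for v
  have Ic: "I (u v) \<in> carrier ?M" and Tc: "T (l v) \<in> carrier ?M" for v
    using vec_mod_homD(1)[OF I] vec_mod_homD(1)[OF T] by simp_all
  have q\<Phi>: "q (\<Phi> v) = \<Phi>'' (l v)" for v
    using module_homD(2)[OF q(1) Ic Tc] qT[of "l v"] qi[OF coordD(1)[OF r'(2)], of "u v"]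
        coordD(1)[OF r''(2), of "l v"]
    by (simp add: \<Phi>_def I_def)
  have co: "coord ?M (m + n) \<Phi>"
    unfolding coord_def
  proof
    show "\<Phi> \<in> module_hom type_ring (vec_mod (m + n)) ?M"
    proof (rule module_homI)
      show "\<Phi> v \<in> carrier ?M" for v using Ic Tc by (simp add: \<Phi>_def)
      fix v assume v: "v \<in> carrier (vec_mod (m + n) :: ('k, 'k vec) module)"
      { fix w assume w: "w \<in> carrier (vec_mod (m + n) :: ('k, 'k vec) module)"
        have "u (v + w) = u v + u w" "l (v + w) = l v + l w"
          using v w by (auto simp: u_def l_def module_vec_simps intro!: eq_vecI)
        then show "\<Phi> (v \<oplus>\<^bsub>vec_mod (m + n)\<^esub> w) = \<Phi> v \<oplus>\<^bsub>?M\<^esub> \<Phi> w"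
          using vec_mod_homD(2)[OF I, of "u v" "u w"] vec_mod_homD(2)[OF T, of "l v" "l w"]
            Ic[of v] Ic[of w] Tc[of v] Tc[of w]
          by (simp add: \<Phi>_def module_vec_simps M.M.add.m_ac M.M.a_assoc) }
      show "\<Phi> (c \<odot>\<^bsub>vec_mod (m + n)\<^esub> v) = c \<odot>\<^bsub>?M\<^esub> \<Phi> v" for c
      proof -
        have "u (c \<cdot>\<^sub>v v) = c \<cdot>\<^sub>v u v" "l (c \<cdot>\<^sub>v v) = c \<cdot>\<^sub>v l v"
          using v by (auto simp: u_def l_def module_vec_simps intro!: eq_vecI)
        then show ?thesis
          using vec_mod_homD(3)[OF I, of "u v" c] vec_mod_homD(3)[OF T, of "l v" c]
              M.smult_r_distr[OF _ Ic[of v] Tc[of v], of c]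
          by (simp add: \<Phi>_def module_vec_simps)
      qed
    qed
    show "bij_betw \<Phi> (carrier_vec (m + n)) (carrier ?M)"
      unfolding bij_betw_def
    proof
      show "inj_on \<Phi> (carrier_vec (m + n))"
      proof (rule inj_onI)
        fix v w assume vw: "v \<in> carrier_vec (m + n)" "w \<in> carrier_vec (m + n)" and eq: "\<Phi> v = \<Phi> w"
        then have "\<Phi>'' (l v) = \<Phi>'' (l w)" using q\<Phi> by metis
        then have l: "l v = l w" using coordD(4)[OF r''(2)] by simp
        then have "I (u v) = I (u w)"
          using eq Ic[of v] Ic[of w] Tc[of w] by (simp add: \<Phi>_def)
        then have "u v = u w" using inj_I by simp
        with l vw show "v = w" using eq_ul by blast
      qed
      show "\<Phi> ` carrier_vec (m + n) = carrier ?M"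
      proof
        show "\<Phi> ` carrier_vec (m + n) \<subseteq> carrier ?M" using Ic Tc by (auto simp: \<Phi>_def)
        show "carrier ?M \<subseteq> \<Phi> ` carrier_vec (m + n)"
        proof
          fix x assume x: "x \<in> carrier ?M"
          obtain w where w: "w \<in> carrier_vec n" "q x = \<Phi>'' w"
            using coord_surj[OF r''(2)] module_homD(1)[OF q(1) x] by blast
          have Tw: "T w \<in> carrier ?M" using vec_mod_homD(1)[OF T] w by simp
          \<comment> \<open>Subtracting the section of the image of \<open>x\<close> leaves an
            element of the kernel of \<open>q\<close>, hence one coming from the subspace.\<close>
          define y where "y = x \<ominus>\<^bsub>?M\<^esub> T w"
          have y: "y \<in> carrier ?M" "x = y \<oplus>\<^bsub>?M\<^esub> T w"
            using x Tw by (simp_all add: y_def M.M.minus_eq M.M.a_assoc M.M.l_neg)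
          have "\<Phi>'' w = q y \<oplus>\<^bsub>?M''\<^esub> \<Phi>'' w"
            using module_homD(2)[OF q(1) y(1) Tw] w y(2) qT by simp
          then have "q y = \<zero>\<^bsub>?M''\<^esub>"
            using module_homD(1)[OF q(1) y(1)] coordD(1)[OF r''(2) w(1)]
                by (metis M''.M.l_zero M''.M.add.r_cancel M''.M.zero_closed)
          then obtain z where z: "z \<in> carrier ?M'" "y = i z" using ker y(1) by blast
          then obtain a where a: "a \<in> carrier_vec m" "y = I a"
            using coord_surj[OF r'(2)] by (metis I_def comp_apply)
          have "u (a @\<^sub>v w) = a" "l (a @\<^sub>v w) = w"
            using a(1) w(1) by (auto simp: u_def l_def)
          then have "\<Phi> (a @\<^sub>v w) = x" using a(2) y(2) by (simp add: \<Phi>_def)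
          moreover have "a @\<^sub>v w \<in> carrier_vec (m + n)" using a(1) w(1) by simp
          ultimately show "x \<in> \<Phi> ` carrier_vec (m + n)" by blast
        qed
      qed
    qed
  qed
  obtain G where G: "mat_rep E (m + n) G \<Phi>"
    using mat_rep_exists[OF E(1) co E(2)] by auto
  note rG = mat_repD[OF G]
  \<comment> \<open>\<open>B\<close> is just the upper right block of the matrix that was found; the
    content is in the other three blocks.\<close>
  define B where "B = mat m n (\<lambda>(i, j). G $$ (i, m + j))"
  have col': "u (G *\<^sub>v unit_vec (m + n) j) = A *\<^sub>v unit_vec m j" "l (G *\<^sub>v unit_vec (m + n) j) = 0\<^sub>v n"
    if j: "j < m" for j
  proof -
    let ?e = "unit_vec (m + n) j :: 'k vec"
    let ?z = "(A *\<^sub>v unit_vec m j) @\<^sub>v 0\<^sub>v n"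
    have Ae: "A *\<^sub>v unit_vec m j \<in> carrier_vec m" using r'(3) by simp
    have T0: "T (0\<^sub>v n) = \<zero>\<^bsub>?M\<^esub>"
      using module_hom_zero[OF module_vec_mod E(1) T] by (simp add: module_vec_simps)
    have e: "u ?e = unit_vec m j" "l ?e = 0\<^sub>v n"
      using j by (auto simp: u_def l_def unit_vec_def)
    have z: "u ?z = A *\<^sub>v unit_vec m j" "l ?z = 0\<^sub>v n"
      using Ae r'(3) by (auto simp: u_def l_def intro!: eq_vecI)
    have "\<Phi> (G *\<^sub>v ?e) = snd E (I (unit_vec m j))"
      using rG(4)[of ?e] e T0 vec_mod_homD(1)[OF I, of "unit_vec m j"] by (simp add: \<Phi>_def)
    also have "\<dots> = I (A *\<^sub>v unit_vec m j)"
      using r'(4)[of "unit_vec m j"] i(2)[OF coordD(1)[OF r'(2)], of "unit_vec m j"] by (simp add: I_def)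
    also have "\<dots> = \<Phi> ?z"
      using z T0 vec_mod_homD(1)[OF I Ae] by (simp add: \<Phi>_def)
    finally have "G *\<^sub>v ?e = ?z"
      using coordD(4)[OF co, of "G *\<^sub>v ?e" ?z] rG(3) Ae by simp
    then show "u (G *\<^sub>v ?e) = A *\<^sub>v unit_vec m j" "l (G *\<^sub>v ?e) = 0\<^sub>v n"
      using z by simp_all
  qed
  have col'': "l (G *\<^sub>v unit_vec (m + n) (m + j)) = C *\<^sub>v unit_vec n j" if j: "j < n" for j
  proof -
    let ?e = "unit_vec (m + n) (m + j) :: 'k vec"
    have e: "l ?e = unit_vec n j"
      using j by (auto simp: l_def unit_vec_def)
    have "\<Phi>'' (l (G *\<^sub>v ?e)) = q (snd E (\<Phi> ?e))"
      using q\<Phi>[of "G *\<^sub>v ?e"] rG(4)[of ?e] by simp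
    also have "\<dots> = snd E'' (\<Phi>'' (unit_vec n j))"
      using q(2)[OF coordD(1)[OF co], of ?e] q\<Phi>[of ?e] e by simp
    also have "\<dots> = \<Phi>'' (C *\<^sub>v unit_vec n j)"
      using r''(4) by simp
    finally show ?thesis
      using coordD(4)[OF r''(2), of "l (G *\<^sub>v ?e)" "C *\<^sub>v unit_vec n j"] r''(3) by simp
  qed
  have "G = four_block_mat A B (0\<^sub>m n m) C"
  proof (rule eq_matI)
    fix a b assume "a < dim_row (four_block_mat A B (0\<^sub>m n m) C)"
        "b < dim_col (four_block_mat A B (0\<^sub>m n m) C)"
    then have ab: "a < m + n" "b < m + n" using r'(3) r''(3) by auto
    have Gab: "(G *\<^sub>v unit_vec (m + n) b) $ a = G $$ (a, b)"
      using rG(3) ab by simp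
    consider "b < m" "a < m" | "b < m" "a \<ge> m" | "b \<ge> m" "a < m" | "b \<ge> m" "a \<ge> m" by linarith
    then show "G $$ (a, b) = four_block_mat A B (0\<^sub>m n m) C $$ (a, b)"
    proof cases
      case 1
      then have "G $$ (a, b) = u (G *\<^sub>v unit_vec (m + n) b) $ a" using Gab by (simp add: u_def)
      then show ?thesis using 1 col'(1) r'(3) r''(3) by simp
    next
      case 2
      then have "G $$ (a, b) = l (G *\<^sub>v unit_vec (m + n) b) $ (a - m)" using Gab ab by (simp add: l_def)
      then show ?thesis using 2 ab col'(2) r'(3) r''(3) by simp
    next
      case 3
      then show ?thesis using ab r'(3) r''(3) by (simp add: B_def)
    next
      case 4
      then have mm: "m + (a - m) = a" "m + (b - m) = b" by simp_all
      have "a - m < n" using 4 ab by simp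
      then have "G $$ (a, b) = l (G *\<^sub>v unit_vec (m + n) (m + (b - m))) $ (a - m)"
        using Gab by (simp add: l_def mm)
      then show ?thesis using 4 ab col''[of "b - m"] r'(3) r''(3) by simp
    qed
  qed (use rG(3) r'(3) r''(3) in auto)
  then show thesis
    using that[of B \<Phi>] G by (simp add: B_def)
qed

lemma End_char_poly_exact:
  fixes E' :: "('k::field, 'b) endo" and E :: "('k, 'c) endo" and E'' :: "('k, 'd) endo"
  assumes E': "E' \<in> End_obj type_ring" and E: "E \<in> End_obj type_ring" and E'': "E'' \<in> End_obj type_ring"
    and exact: "End_exact type_ring E' E E''"
  shows "End_char_poly E = End_char_poly E' * End_char_poly E''"
proof -
  obtain m A \<Phi>' n C \<Phi>'' where r: "mat_rep E' m A \<Phi>'" "mat_rep E'' n C \<Phi>''"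
    using E' E'' by (auto simp: End_obj_iff_mat_rep)
  obtain B \<Phi> where B: "B \<in> carrier_mat m n" and rep: "mat_rep E (m + n) (four_block_mat A B (0\<^sub>m n m) C) \<Phi>"
    by (rule exact_mat_rep[OF End_objD[OF E] r exact])
  show ?thesis
    using End_char_poly_mat_rep[OF rep] End_char_poly_mat_rep[OF r(1)] End_char_poly_mat_rep[OF r(2)]
      char_poly_four_block_lower_left_zero[OF mat_repD(3)[OF r(1)] B mat_repD(3)[OF r(2)]]
    by simp
qed

section \<open>Isomorphisms and exact sequences of endomorphisms\<close>

lemma End_homI:
  assumes "h \<in> module_hom R (fst E) (fst D)" "\<And>x. x \<in> carrier (fst E) \<Longrightarrow> h (snd E x) = snd D (h x)"
  shows "h \<in> End_hom R E D"
  using assms by (simp add: End_hom_def)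

lemma End_homD:
  assumes "h \<in> End_hom R E D"
  shows "h \<in> module_hom R (fst E) (fst D)"
    and "x \<in> carrier (fst E) \<Longrightarrow> h x \<in> carrier (fst D)"
    and "x \<in> carrier (fst E) \<Longrightarrow> h (snd E x) = snd D (h x)"
  using assms by (auto simp: End_hom_def module_hom_def)

lemma End_hom_comp: "f \<in> End_hom R E D \<Longrightarrow> g \<in> End_hom R D C \<Longrightarrow> g \<circ> f \<in> End_hom R E C"
  by (rule End_homI[OF module_hom_comp[OF End_homD(1) End_homD(1)]]) (simp_all add: End_homD)

lemma End_iso_sym:
  assumes E: "module R (fst E)" "snd E \<in> module_hom R (fst E) (fst E)" and iso: "End_iso R E D"
  shows "End_iso R D E"
proof -
  obtain h where h: "h \<in> End_hom R E D" "bij_betw h (carrier (fst E)) (carrier (fst D))"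
    using iso by (auto simp: End_iso_def)
  let ?g = "inv_into (carrier (fst E)) h"
  have g: "bij_betw ?g (carrier (fst D)) (carrier (fst E))"
    using h(2) by (rule bij_betw_inv_into)
  have gh: "?g (h x) = x" if "x \<in> carrier (fst E)" for x
    using h(2) that by (simp add: bij_betw_inv_into_left)
  have hg: "h (?g y) = y" if "y \<in> carrier (fst D)" for y
    using h(2) that by (simp add: bij_betw_inv_into_right)
  have gc: "?g y \<in> carrier (fst E)" if "y \<in> carrier (fst D)" for y
    using g that by (auto simp: bij_betw_def)
  have "?g \<in> End_hom R D E"
  proof (rule End_homI)
    show "?g \<in> module_hom R (fst D) (fst E)"
      by (rule module_hom_inv_into[OF E(1) End_homD(1)[OF h(1)] h(2)])
    show "?g (snd D y) = snd E (?g y)" if "y \<in> carrier (fst D)" for y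
      using End_homD(3)[OF h(1) gc[OF that]] hg[OF that] gh[of "snd E (?g y)"]
          module_homD(1)[OF E(2) gc[OF that]]
      by simp
  qed
  with g show ?thesis by (auto simp: End_iso_def)
qed

lemma End_iso_trans: "End_iso R E D \<Longrightarrow> End_iso R D C \<Longrightarrow> End_iso R E C"
  unfolding End_iso_def by (meson End_hom_comp bij_betw_trans)

text \<open>This and the next two lemmas each replace one term of an exact sequence by an isomorphic
  pair. Together they carry a sequence over any element types to the chosen representatives
  \<open>End_rep\<close>, as in \<open>End_exact_End_rep\<close>.\<close>

lemma End_exact_iso_left:
  assumes iso: "End_iso R D' E'" and exact: "End_exact R E' E E''"
  shows "End_exact R D' E E''"
proof -
  obtain g where g: "g \<in> End_hom R D' E'" "bij_betw g (carrier (fst D')) (carrier (fst E'))"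
    using iso by (auto simp: End_iso_def)
  obtain i q where iq: "i \<in> End_hom R E' E" "q \<in> End_hom R E E''" "inj_on i (carrier (fst E'))"
    "q ` carrier (fst E) = carrier (fst E'')" "{x \<in> carrier (fst E). q x = \<zero>\<^bsub>fst E''\<^esub>} = i ` carrier (fst E')"
    using exact unfolding End_exact_def by blast
  have "inj_on (i \<circ> g) (carrier (fst D'))" "(i \<circ> g) ` carrier (fst D') = i ` carrier (fst E')"
    using g(2) iq(3) unfolding image_comp[symmetric] by (auto simp: bij_betw_def intro: comp_inj_on)
  with iq End_hom_comp[OF g(1) iq(1)] show ?thesis
    unfolding End_exact_def by (intro bexI[of _ "i \<circ> g"] bexI[of _ q] conjI) simp_all
qed

lemma End_exact_iso_right:
  assumes E'': "module R (fst E'')" and D'': "module R (fst D'')"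
    and iso: "End_iso R E'' D''" and exact: "End_exact R E' E E''"
  shows "End_exact R E' E D''"
proof -
  obtain g where g: "g \<in> End_hom R E'' D''" "bij_betw g (carrier (fst E'')) (carrier (fst D''))"
    using iso by (auto simp: End_iso_def)
  obtain i q where iq: "i \<in> End_hom R E' E" "q \<in> End_hom R E E''" "inj_on i (carrier (fst E'))"
    "q ` carrier (fst E) = carrier (fst E'')" "{x \<in> carrier (fst E). q x = \<zero>\<^bsub>fst E''\<^esub>} = i ` carrier (fst E')"
    using exact unfolding End_exact_def by blast
  interpret E'': module R "fst E''" by (rule E'')
  have g0: "g x = \<zero>\<^bsub>fst D''\<^esub> \<longleftrightarrow> x = \<zero>\<^bsub>fst E''\<^esub>" if "x \<in> carrier (fst E'')" for x
    using module_hom_zero[OF E'' D'' End_homD(1)[OF g(1)]] g(2) that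
    by (metis E''.M.zero_closed bij_betw_imp_inj_on inj_onD)
  have "(g \<circ> q) ` carrier (fst E) = carrier (fst D'')"
    using g(2) iq(4) by (metis bij_betw_imp_surj_on image_comp)
  moreover have "{x \<in> carrier (fst E). (g \<circ> q) x = \<zero>\<^bsub>fst D''\<^esub>} = i ` carrier (fst E')"
    using g0 End_homD(2)[OF iq(2)] iq(5) by auto
  ultimately show ?thesis
    using iq(1,3) End_hom_comp[OF iq(2) g(1)] unfolding End_exact_def by blast
qed

lemma End_exact_iso_middle:
  assumes E: "module R (fst E)" "snd E \<in> module_hom R (fst E) (fst E)"
    and iso: "End_iso R E D" and exact: "End_exact R E' E E''"
  shows "End_exact R E' D E''"
proof -
  obtain h where h: "h \<in> End_hom R E D" "bij_betw h (carrier (fst E)) (carrier (fst D))"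
    using iso by (auto simp: End_iso_def)
  obtain i q where iq: "i \<in> End_hom R E' E" "q \<in> End_hom R E E''" "inj_on i (carrier (fst E'))"
    "q ` carrier (fst E) = carrier (fst E'')" "{x \<in> carrier (fst E). q x = \<zero>\<^bsub>fst E''\<^esub>} = i ` carrier (fst E')"
    using exact unfolding End_exact_def by blast
  let ?g = "inv_into (carrier (fst E)) h"
  have gh: "?g (h x) = x" if "x \<in> carrier (fst E)" for x
    using h(2) that by (simp add: bij_betw_inv_into_left)
  have img: "carrier (fst D) = h ` carrier (fst E)"
    using h(2) by (simp add: bij_betw_def)
  have "?g \<in> End_hom R D E"
  proof (rule End_homI)
    show "?g \<in> module_hom R (fst D) (fst E)"
      by (rule module_hom_inv_into[OF E(1) End_homD(1)[OF h(1)] h(2)])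
    show "?g (snd D y) = snd E (?g y)" if y: "y \<in> carrier (fst D)" for y
    proof -
      obtain x where "x \<in> carrier (fst E)" "y = h x" using y img by blast
      then show ?thesis
        using gh module_homD(1)[OF E(2)] End_homD(3)[OF h(1)] by metis
    qed
  qed
  moreover have "(q \<circ> ?g) ` carrier (fst D) = carrier (fst E'')"
    unfolding img image_comp[symmetric] using gh iq(4) by (simp add: image_image)
  moreover have "{y \<in> carrier (fst D). (q \<circ> ?g) y = \<zero>\<^bsub>fst E''\<^esub>} = (h \<circ> i) ` carrier (fst E')"
  proof -
    have "{y \<in> carrier (fst D). (q \<circ> ?g) y = \<zero>\<^bsub>fst E''\<^esub>} = h ` {x \<in> carrier (fst E). q x = \<zero>\<^bsub>fst E''\<^esub>}"
      unfolding img using gh by auto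
    also have "\<dots> = (h \<circ> i) ` carrier (fst E')"
      unfolding iq(5) image_comp ..
    finally show ?thesis .
  qed
  moreover have "inj_on (h \<circ> i) (carrier (fst E'))"
    using iq(3) h(2) End_homD(2)[OF iq(1)] by (intro comp_inj_on) (auto simp: bij_betw_def intro:
        inj_on_subset)
  ultimately show ?thesis
    using End_hom_comp[OF iq(1) h(1)] End_hom_comp[OF _ iq(2)] unfolding End_exact_def by blast
qed

text \<open>An isomorphism viewed as a short exact sequence with zero kernel. Since all relations of
  K_0 come from exact sequences, this is how isomorphic pairs get the same class.\<close>

lemma End_exact_zero_iso:
  assumes Z: "carrier (fst Z) = {\<zero>\<^bsub>fst Z\<^esub>}" "module R (fst Z)" "snd Z \<zero>\<^bsub>fst Z\<^esub> = \<zero>\<^bsub>fst Z\<^esub>"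
    and E: "module R (fst E)" "snd E \<in> module_hom R (fst E) (fst E)" and D: "module R (fst D)" and iso:
        "End_iso R E D"
  shows "End_exact R Z E D"
proof -
  obtain h where h: "h \<in> End_hom R E D" "bij_betw h (carrier (fst E)) (carrier (fst D))"
    using iso by (auto simp: End_iso_def)
  interpret Z: module R "fst Z" by (rule Z)
  interpret E: module R "fst E" by (rule E)
  let ?i = "\<lambda>_. \<zero>\<^bsub>fst E\<^esub>"
  have "?i \<in> End_hom R Z E"
    using module_hom_zero[OF E(1) E(1) E(2)] by (intro End_homI module_homI) simp_all
  moreover have "{x \<in> carrier (fst E). h x = \<zero>\<^bsub>fst D\<^esub>} = ?i ` carrier (fst Z)"
  proof -
    have "h x = \<zero>\<^bsub>fst D\<^esub> \<longleftrightarrow> x = \<zero>\<^bsub>fst E\<^esub>" if "x \<in> carrier (fst E)" for x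
      using module_hom_zero[OF E(1) D End_homD(1)[OF h(1)]] h(2) that
      by (metis E.M.zero_closed bij_betw_imp_inj_on inj_onD)
    then have "{x \<in> carrier (fst E). h x = \<zero>\<^bsub>fst D\<^esub>} = {\<zero>\<^bsub>fst E\<^esub>}"
      using E.M.zero_closed by blast
    then show ?thesis unfolding Z(1) by simp
  qed
  moreover have "inj_on ?i (carrier (fst Z))" unfolding Z(1) by simp
  moreover have "h ` carrier (fst E) = carrier (fst D)" using h(2) by (simp add: bij_betw_def)
  ultimately show ?thesis
    using h(1) unfolding End_exact_def by blast
qed

section \<open>Models of endomorphisms carried by lists\<close>

definition list_module :: "nat \<Rightarrow> ('k::field, 'k list) module" where
  "list_module d =
     \<lparr>carrier = {xs. length xs = d}, mult = undefined, one = undefined,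
      zero = list_of_vec (0\<^sub>v d),
      add = (\<lambda>xs ys. list_of_vec (vec_of_list xs + vec_of_list ys)),
      smult = (\<lambda>r xs. list_of_vec (r \<cdot>\<^sub>v vec_of_list xs))\<rparr>"

definition mat_endo :: "'k::field mat \<Rightarrow> ('k, 'k list) endo" where
  "mat_endo A = (list_module (dim_row A), \<lambda>xs. list_of_vec (A *\<^sub>v vec_of_list xs))"

lemma vec_of_list_carrier: "length xs = d \<Longrightarrow> vec_of_list xs \<in> carrier_vec d"
  by (metis carrier_vec_dim_vec dim_vec_of_list)

lemma module_list_module: "module type_ring (list_module d :: ('k::field, 'k list) module)"
proof (rule module_criteria)
  show "cring (type_ring :: 'k ring)" by (rule cring_from_type_algebra)
  let ?L = "list_module d :: ('k, 'k list) module"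
  show "\<forall>v\<in>carrier ?L. \<exists>neg_v\<in>carrier ?L. v \<oplus>\<^bsub>?L\<^esub> neg_v = \<zero>\<^bsub>?L\<^esub>"
  proof
    fix v assume "v \<in> carrier ?L"
    then have "vec_of_list v \<in> carrier_vec d" by (simp add: list_module_def vec_of_list_carrier)
    then show "\<exists>neg_v\<in>carrier ?L. v \<oplus>\<^bsub>?L\<^esub> neg_v = \<zero>\<^bsub>?L\<^esub>"
      by (intro bexI[of _ "list_of_vec (- vec_of_list v)"]) (auto simp: list_module_def vec_list dest:
          carrier_vecD)
  qed
  show "\<forall>v w x. v \<in> carrier ?L \<and> w \<in> carrier ?L \<and> x \<in> carrier ?L \<longrightarrow>
      v \<oplus>\<^bsub>?L\<^esub> w \<oplus>\<^bsub>?L\<^esub> x = v \<oplus>\<^bsub>?L\<^esub> (w \<oplus>\<^bsub>?L\<^esub> x)"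
    by (auto simp: list_module_def vec_list intro!: arg_cong[of _ _ list_of_vec]
        assoc_add_vec vec_of_list_carrier)
  show "\<forall>v w. v \<in> carrier ?L \<and> w \<in> carrier ?L \<longrightarrow> v \<oplus>\<^bsub>?L\<^esub> w = w \<oplus>\<^bsub>?L\<^esub> v"
    by (auto simp: list_module_def intro!: arg_cong[of _ _ list_of_vec] comm_add_vec vec_of_list_carrier)
  show "\<forall>v\<in>carrier ?L. v \<oplus>\<^bsub>?L\<^esub> \<zero>\<^bsub>?L\<^esub> = v"
  proof -
    have "vec_of_list (replicate n 0) = (0\<^sub>v n :: 'k vec)" for n
      using vec_list[of "0\<^sub>v n :: 'k vec"] by simp
    then show ?thesis
      by (auto simp: list_module_def list_vec right_zero_vec[OF vec_of_list_carrier])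
  qed
  show "\<forall>c v w. c \<in> carrier type_ring \<and> v \<in> carrier ?L \<and> w \<in> carrier ?L \<longrightarrow>
      c \<odot>\<^bsub>?L\<^esub> (v \<oplus>\<^bsub>?L\<^esub> w) = c \<odot>\<^bsub>?L\<^esub> v \<oplus>\<^bsub>?L\<^esub> c \<odot>\<^bsub>?L\<^esub> w"
    by (auto simp: list_module_def vec_list intro!: arg_cong[of _ _ list_of_vec]
        smult_add_distrib_vec vec_of_list_carrier)
  show "\<forall>c0 c1 v. c0 \<in> carrier type_ring \<and> c1 \<in> carrier type_ring \<and> v \<in> carrier ?L \<longrightarrow>
      (c0 \<oplus>\<^bsub>type_ring\<^esub> c1) \<odot>\<^bsub>?L\<^esub> v = c0 \<odot>\<^bsub>?L\<^esub> v \<oplus>\<^bsub>?L\<^esub> c1 \<odot>\<^bsub>?L\<^esub> v"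
    by (auto simp: list_module_def vec_list add_smult_distrib_vec)
  show "\<forall>v\<in>carrier ?L. \<one>\<^bsub>type_ring\<^esub> \<odot>\<^bsub>?L\<^esub> v = v"
    by (auto simp: list_module_def list_vec)
qed (auto simp: list_module_def vec_list smult_smult_assoc)

lemma coord_list_module: "coord (list_module d) d (list_of_vec :: 'k::field vec \<Rightarrow> 'k list)"
  by (rule coordI[where \<Psi> = vec_of_list], rule module_homI)
    (auto simp: list_module_def module_vec_simps vec_list list_vec vec_of_list_carrier)

lemma mat_rep_mat_endo: "A \<in> carrier_mat d d \<Longrightarrow> mat_rep (mat_endo A) d A list_of_vec"
  using module_list_module coord_list_module by (auto simp: mat_rep_def mat_endo_def vec_list)

text \<open>Both pairs are copies of \<open>(k^d, A)\<close>; one inverse coordinate map followed by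
  the other coordinate map is the isomorphism.\<close>

lemma End_iso_mat_rep:
  assumes 1: "mat_rep E d A \<Phi>" and 2: "mat_rep D d A \<Psi>"
  shows "End_iso type_ring E D"
proof -
  note r1 = mat_repD[OF 1] and r2 = mat_repD[OF 2]
  let ?h = "\<Psi> \<circ> inv_into (carrier_vec d) \<Phi>"
  have "?h \<in> End_hom type_ring E D"
  proof (rule End_homI)
    show "?h \<in> module_hom type_ring (fst E) (fst D)"
      using r2(2) coord_inv(1)[OF r1(2)] by (auto simp: coord_def intro: module_hom_comp)
    fix x assume "x \<in> carrier (fst E)"
    then obtain v where v: "v \<in> carrier_vec d" "x = \<Phi> v" by (rule coord_surj[OF r1(2)])
    have Av: "A *\<^sub>v v \<in> carrier_vec d" using r1(3) v by simp
    show "?h (snd E x) = snd D (?h x)"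
      using v r1(4)[OF v(1)] r2(4)[OF v(1)] coord_inv(4)[OF r1(2) v(1)] coord_inv(4)[OF r1(2) Av] by simp
  qed
  moreover have "bij_betw ?h (carrier (fst E)) (carrier (fst D))"
    using r1(2) r2(2) by (auto simp: coord_def intro: bij_betw_trans bij_betw_inv_into)
  ultimately show ?thesis by (auto simp: End_iso_def)
qed

lemma End_char_poly_iso:
  assumes E: "E \<in> End_obj type_ring" and D: "module type_ring (fst D)" and iso: "End_iso type_ring E D"
  shows "End_char_poly D = End_char_poly E"
proof -
  obtain d A \<Phi> where rep: "mat_rep E d A \<Phi>" using E by (auto simp: End_obj_iff_mat_rep)
  moreover obtain h where "mat_rep D d A (h \<circ> \<Phi>)"
    using iso mat_rep_iso[OF rep D] by (auto simp: End_iso_def)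
  ultimately show ?thesis by (simp add: End_char_poly_mat_rep)
qed

text \<open>The choice in \<open>End_rep\<close> has a candidate: the list model
  \<open>mat_endo A\<close> of any matrix representing \<open>E\<close>.\<close>

lemma End_rep:
  fixes E :: "('k::field, 'b) endo"
  assumes E: "E \<in> End_obj type_ring"
  shows "End_rep type_ring E \<in> End_obj type_ring" "End_iso type_ring E (End_rep type_ring E)"
proof -
  obtain d A \<Phi> where rep: "mat_rep E d A \<Phi>" using E by (auto simp: End_obj_iff_mat_rep)
  have "mat_endo A \<in> End_obj type_ring \<and> End_iso type_ring E (mat_endo A)"
    using mat_rep_mat_endo[OF mat_repD(3)[OF rep]] End_iso_mat_rep[OF rep] End_obj_iff_mat_rep by blast
  then have "End_rep type_ring E \<in> End_obj type_ring \<and> End_iso type_ring E (End_rep type_ring E)"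
    unfolding End_rep_def by (rule someI)
  then show "End_rep type_ring E \<in> End_obj type_ring" "End_iso type_ring E (End_rep type_ring E)"
    by auto
qed

lemma End_exact_End_rep:
  assumes E: "E' \<in> End_obj type_ring" "E \<in> End_obj type_ring" "E'' \<in> End_obj type_ring"
    and exact: "End_exact type_ring E' E E''"
  shows "End_exact type_ring (End_rep type_ring E') (End_rep type_ring E) (End_rep type_ring E'')"
proof -
  have "End_iso type_ring (End_rep type_ring E') E'"
    by (rule End_iso_sym[OF End_objD[OF E(1)] End_rep(2)[OF E(1)]])
  then have "End_exact type_ring (End_rep type_ring E') E E''"
    using exact by (rule End_exact_iso_left)
  then have "End_exact type_ring (End_rep type_ring E') (End_rep type_ring E) E''"
    by (rule End_exact_iso_middle[OF End_objD[OF E(2)] End_rep(2)[OF E(2)]])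
  then show ?thesis
    by (rule End_exact_iso_right[OF End_objD(1)[OF E(3)] End_objD(1)[OF End_rep(1)[OF E(3)]]
        End_rep(2)[OF E(3)]])
qed

lemma zero_endo:
  obtains Z :: "('k::field, 'k list) endo"
  where "Z \<in> End_obj type_ring" "carrier (fst Z) = {\<zero>\<^bsub>fst Z\<^esub>}" "snd Z = (\<lambda>x. \<zero>\<^bsub>fst Z\<^esub>)"
proof
  let ?Z = "(list_module 0, \<lambda>x. \<zero>\<^bsub>list_module 0\<^esub>) :: ('k, 'k list) endo"
  have "mat_rep ?Z 0 (0\<^sub>m 0 0) list_of_vec"
    unfolding mat_rep_def fst_conv snd_conv
  proof (intro conjI ballI)
    fix v :: "'k vec" assume "v \<in> carrier_vec 0"
    have "0\<^sub>m 0 0 *\<^sub>v v = 0\<^sub>v 0" by (rule eq_vecI) simp_all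
    then show "\<zero>\<^bsub>list_module 0\<^esub> = list_of_vec (0\<^sub>m 0 0 *\<^sub>v v)"
      by (simp add: list_module_def)
  qed (simp_all add: module_list_module coord_list_module)
  then show "?Z \<in> End_obj type_ring" by (auto simp: End_obj_iff_mat_rep)
  show "carrier (fst ?Z) = {\<zero>\<^bsub>fst ?Z\<^esub>}" "snd ?Z = (\<lambda>x. \<zero>\<^bsub>fst ?Z\<^esub>)"
    by (auto simp: list_module_def)
qed

lemma End_exact_if_iso:
  fixes E :: "('k::field, 'b) endo" and D :: "('k, 'c) endo"
  assumes E: "E \<in> End_obj type_ring" and D: "D \<in> End_obj type_ring" and iso: "End_iso type_ring E D"
    and Z: "Z \<in> End_obj type_ring" "carrier (fst Z) = {\<zero>\<^bsub>fst Z\<^esub>}" "snd Z = (\<lambda>x. \<zero>\<^bsub>fst Z\<^esub>)"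
  shows "End_exact type_ring Z E D"
  using End_exact_zero_iso[OF Z(2) End_objD(1)[OF Z(1)] _ End_objD[OF E] End_objD(1)[OF D] iso] Z(3) by simp

section \<open>The additive group of \<open>W\<^sub>0\<close>\<close>

text \<open>The additive group of \<open>End_formal\<close> is free abelian and ring quotients are
  group quotients additively. Hence homomorphisms out of W_0 can be built and compared with the
  universal properties of free and quotient groups.\<close>

lemma add_monoid_End_formal: "add_monoid (End_formal R) = free_Abelian_group (End_obj R)"
  by (simp add: End_formal_def free_Abelian_group_def)

lemma add_monoid_FactRing: "add_monoid (R Quot I) = add_monoid R Mod I"
  by (simp add: FactRing_def FactGroup_def A_RCOSETS_def set_add_def)

lemma add_monoid_K0_End: "add_monoid (K0_End R) = free_Abelian_group (End_obj R) Mod K0_rel R"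
  unfolding K0_End_def add_monoid_FactRing add_monoid_End_formal ..

lemma add_monoid_W0: "add_monoid (W0 R) = add_monoid (K0_End R) Mod K0_ideal R"
  unfolding W0_def add_monoid_FactRing ..

lemma K0_class_eq: "K0_class R E = K0_rel R #>\<^bsub>free_Abelian_group (End_obj R)\<^esub> frag_of (End_rep R E)"
  unfolding K0_class_def a_r_coset_def add_monoid_End_formal ..

lemma W0_class_eq: "W0_class R E = K0_ideal R #>\<^bsub>add_monoid (K0_End R)\<^esub> K0_class R E"
  unfolding W0_class_def a_r_coset_def ..

lemma K0_rel_gens_subset:
  "{frag_of E - frag_of E' - frag_of E'' | E' E E''.
      E' \<in> End_obj R \<and> E \<in> End_obj R \<and> E'' \<in> End_obj R \<and> End_exact R E' E E''}
    \<subseteq> carrier (free_Abelian_group (End_obj R))" (is "?S \<subseteq> _")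
proof
  fix c assume "c \<in> ?S"
  then obtain E' E E'' where c: "c = frag_of E - frag_of E' - frag_of E''"
    and E: "E' \<in> End_obj R" "E \<in> End_obj R" "E'' \<in> End_obj R" by blast
  have "Poly_Mapping.keys c \<subseteq> {E, E', E''}"
    unfolding c using keys_diff[of "frag_of E - frag_of E'" "frag_of E''"] keys_diff[of "frag_of E"
        "frag_of E'"]
    by auto
  with E show "c \<in> carrier (free_Abelian_group (End_obj R))" by auto
qed

lemma subgroup_K0_rel: "subgroup (K0_rel R) (free_Abelian_group (End_obj R))"
  unfolding K0_rel_def add_monoid_End_formal
  by (rule group.generate_is_subgroup[OF group_free_Abelian_group K0_rel_gens_subset])

lemma comm_group_K0_End: "comm_group (add_monoid (K0_End R))"
  unfolding add_monoid_K0_End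
  by (rule comm_group.abelian_FactGroup[OF abelian_free_Abelian_group subgroup_K0_rel])

lemma K0_rel_normal: "K0_rel R \<lhd> free_Abelian_group (End_obj R)"
  using subgroup_K0_rel abelian_free_Abelian_group
  by (metis comm_group.normal_iff_subgroup)

lemma zero_End_obj:
  fixes M :: "('k::field, 'b) module"
  assumes "finite_projective type_ring M"
  shows "(M, \<lambda>x. \<zero>\<^bsub>M\<^esub>) \<in> End_obj type_ring"
proof -
  interpret module "type_ring :: 'k ring" M
    using assms by (simp add: finite_projective_iff_coord)
  show ?thesis
    using assms by (auto simp: End_obj_def intro!: module_homI)
qed

lemma K0_class_closed:
  fixes E :: "('k::field, 'b) endo"
  assumes "E \<in> End_obj type_ring"
  shows "K0_class type_ring E \<in> carrier (add_monoid (K0_End type_ring))"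
  unfolding K0_class_eq add_monoid_K0_End carrier_FactGroup
  using End_rep(1)[OF assms] by (intro imageI) simp

lemma K0_ideal_gens_subset:
  "{K0_class type_ring (M, \<lambda>x. \<zero>\<^bsub>M\<^esub>) | M :: ('k::field, 'k list) module. finite_projective type_ring M}
    \<subseteq> carrier (add_monoid (K0_End type_ring))"
  using K0_class_closed[OF zero_End_obj] by blast

lemma subgroup_K0_ideal: "subgroup (K0_ideal (type_ring :: 'k::field ring)) (add_monoid (K0_End type_ring))"
  unfolding K0_ideal_def
  by (rule group.generate_is_subgroup[OF comm_group.axioms(2)[OF comm_group_K0_End] K0_ideal_gens_subset])

lemma K0_ideal_normal: "K0_ideal (type_ring :: 'k::field ring) \<lhd> add_monoid (K0_End type_ring)"
  using subgroup_K0_ideal comm_group_K0_End by (metis comm_group.normal_iff_subgroup)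

lemma comm_group_W0: "comm_group (add_monoid (W0 (type_ring :: 'k::field ring)))"
  unfolding add_monoid_W0
  by (rule comm_group.abelian_FactGroup[OF comm_group_K0_End subgroup_K0_ideal])

text \<open>The projection from formal combinations to W_0, through both quotients. In contrast to
  \<open>W0_class\<close> it uses a list pair itself and not its representative
  \<open>End_rep\<close>; \<open>formal_class_eq_W0_class\<close> shows that this makes no
  difference.\<close>

definition formal_class :: "(('k::field, 'k list) endo \<Rightarrow>\<^sub>0 int) \<Rightarrow> (('k, 'k list) endo \<Rightarrow>\<^sub>0 int) set set" where
  "formal_class c = K0_ideal type_ring #>\<^bsub>add_monoid (K0_End type_ring)\<^esub>
     (K0_rel type_ring #>\<^bsub>free_Abelian_group (End_obj type_ring)\<^esub> c)"

lemma W0_class_formal: "W0_class type_ring E = formal_class (frag_of (End_rep type_ring E))"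
  by (simp add: W0_class_eq K0_class_eq formal_class_def)

lemma formal_class_hom:
  "formal_class \<in> hom (free_Abelian_group (End_obj (type_ring :: 'k::field ring))) (add_monoid (W0
      type_ring))"
proof -
  have "(\<lambda>c. K0_rel (type_ring :: 'k ring) #>\<^bsub>free_Abelian_group (End_obj type_ring)\<^esub> c)
      \<in> hom (free_Abelian_group (End_obj type_ring)) (add_monoid (K0_End type_ring))"
    unfolding add_monoid_K0_End by (rule normal.r_coset_hom_Mod[OF K0_rel_normal])
  moreover have "(\<lambda>a. K0_ideal (type_ring :: 'k ring) #>\<^bsub>add_monoid (K0_End type_ring)\<^esub> a)
      \<in> hom (add_monoid (K0_End type_ring)) (add_monoid (W0 type_ring))"
    unfolding add_monoid_W0 by (rule normal.r_coset_hom_Mod[OF K0_ideal_normal])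
  ultimately show ?thesis
    using hom_compose by (fastforce simp: formal_class_def[abs_def] comp_def)
qed

lemma formal_class_surj: "carrier (W0 (type_ring :: 'k::field ring)) =
    formal_class ` carrier (free_Abelian_group (End_obj type_ring))"
proof -
  have "carrier (W0 (type_ring :: 'k ring)) = carrier (add_monoid (W0 (type_ring :: 'k ring)))"
    by simp
  then show ?thesis
    unfolding add_monoid_W0 carrier_FactGroup unfolding add_monoid_K0_End carrier_FactGroup image_image
      formal_class_def add_monoid_K0_End .
qed

lemma group_hom_formal_class:
  "group_hom (free_Abelian_group (End_obj (type_ring :: 'k::field ring))) (add_monoid (W0 type_ring))
      formal_class"
  using formal_class_hom comm_group.axioms(2)[OF comm_group_W0]
  by (simp add: group_hom_def group_hom_axioms_def)

lemma formal_class_exact: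
  fixes E' E E'' :: "('k::field, 'k list) endo"
  assumes E: "E' \<in> End_obj type_ring" "E \<in> End_obj type_ring" "E'' \<in> End_obj type_ring"
    and exact: "End_exact type_ring E' E E''"
  shows "formal_class (frag_of E) = formal_class (frag_of E') \<oplus>\<^bsub>W0 type_ring\<^esub> formal_class (frag_of E'')"
proof -
  let ?F = "free_Abelian_group (End_obj (type_ring :: 'k ring))"
  interpret F: comm_group ?F by (rule abelian_free_Abelian_group)
  interpret K: comm_group "add_monoid (K0_End (type_ring :: 'k ring))" by (rule comm_group_K0_End)
  interpret h: group_hom ?F "add_monoid (W0 (type_ring :: 'k ring))" formal_class
    by (rule group_hom_formal_class)
  let ?r = "frag_of E - frag_of E' - frag_of E''"
  have r: "?r \<in> K0_rel type_ring"
    unfolding K0_rel_def by (rule generate.incl) (use E exact in blast)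
  then have rF: "?r \<in> carrier ?F"
    using subgroup_K0_rel subgroup.subset by blast
  have "K0_rel type_ring #>\<^bsub>?F\<^esub> ?r = K0_rel type_ring"
    by (rule F.coset_join2[OF rF subgroup_K0_rel r])
  then have one: "formal_class ?r = \<one>\<^bsub>add_monoid (W0 type_ring)\<^esub>"
    using h.hom_one F.coset_join2[OF F.one_closed subgroup_K0_rel subgroup.one_closed[OF subgroup_K0_rel]]
    by (simp only: formal_class_def)
  \<comment> \<open>The middle term is written as relation plus outer terms, so that no inverses in
    the quotient have to be moved.\<close>
  have "frag_of E = ?r \<otimes>\<^bsub>?F\<^esub> (frag_of E' \<otimes>\<^bsub>?F\<^esub> frag_of E'')" by simp
  then have "formal_class (frag_of E) = formal_class (?r \<otimes>\<^bsub>?F\<^esub> (frag_of E' \<otimes>\<^bsub>?F\<^esub> frag_of E''))"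
    by (rule arg_cong)
  also have "\<dots> = formal_class (frag_of E') \<otimes>\<^bsub>add_monoid (W0 type_ring)\<^esub> formal_class (frag_of E'')"
  proof -
    have E': "frag_of E' \<in> carrier ?F" "frag_of E'' \<in> carrier ?F" using E by simp_all
    show ?thesis
      unfolding h.hom_mult[OF rF F.m_closed[OF E']] h.hom_mult[OF E'] one
      by (rule h.H.l_one[OF h.H.m_closed[OF h.hom_closed[OF E'(1)] h.hom_closed[OF E'(2)]]])
  qed
  finally show ?thesis by simp
qed

text \<open>\<open>End_rep\<close> may replace even a list pair by another isomorphic one. With a
  zero pair \<open>Z\<close> in front, isomorphic pairs give \<open>[D] = [Z] + [D']\<close>; taking
  \<open>Z\<close> for both \<open>D\<close> and \<open>D'\<close> yields
  \<open>[Z] = [Z] + [Z]\<close>, so \<open>[Z]\<close> vanishes.\<close>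

lemma formal_class_eq_W0_class:
  fixes E :: "('k::field, 'k list) endo"
  assumes E: "E \<in> End_obj type_ring"
  shows "formal_class (frag_of E) = W0_class type_ring E"
proof -
  interpret W: comm_group "add_monoid (W0 (type_ring :: 'k ring))" by (rule comm_group_W0)
  interpret h: group_hom "free_Abelian_group (End_obj (type_ring :: 'k ring))"
      "add_monoid (W0 (type_ring :: 'k ring))" formal_class
    by (rule group_hom_formal_class)
  obtain Z :: "('k, 'k list) endo" where Z: "Z \<in> End_obj type_ring" "carrier (fst Z) = {\<zero>\<^bsub>fst Z\<^esub>}" "snd Z =
      (\<lambda>x. \<zero>\<^bsub>fst Z\<^esub>)"
    by (rule zero_endo)
  have c: "formal_class (frag_of D) \<in> carrier (add_monoid (W0 type_ring))" if "D \<in> End_obj type_ring" for D ::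
      "('k, 'k list) endo"
    using that h.hom_closed[of "frag_of D"] by simp
  have iso: "formal_class (frag_of D) = formal_class (frag_of Z) \<otimes>\<^bsub>add_monoid (W0 type_ring)\<^esub> formal_class
      (frag_of D')"
    if "D \<in> End_obj type_ring" "D' \<in> End_obj type_ring" "End_iso type_ring D D'" for D D' ::
        "('k, 'k list) endo"
    using formal_class_exact[OF Z(1) that(1,2) End_exact_if_iso[OF that Z]] by simp
  have "End_iso type_ring Z Z"
    using End_iso_trans[OF End_rep(2)[OF Z(1)] End_iso_sym[OF End_objD[OF Z(1)] End_rep(2)[OF Z(1)]]] .
  then have "formal_class (frag_of Z) = \<one>\<^bsub>add_monoid (W0 type_ring)\<^esub>"
    using iso[OF Z(1) Z(1)] c[OF Z(1)] W.l_cancel_one by metis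
  then show ?thesis
    unfolding W0_class_formal using iso[OF E End_rep[OF E]] c[OF End_rep(1)[OF E]] W.l_one by metis
qed

lemma W0_class_closed:
  "E \<in> End_obj type_ring \<Longrightarrow> W0_class (type_ring :: 'k::field ring) E \<in> carrier (W0 type_ring)"
  unfolding W0_class_formal formal_class_surj using End_rep(1) by (intro imageI) simp

lemma W0_class_exact:
  assumes E: "E' \<in> End_obj type_ring" "E \<in> End_obj type_ring" "E'' \<in> End_obj type_ring"
    and exact: "End_exact type_ring E' E E''"
  shows "W0_class type_ring E = W0_class type_ring E' \<oplus>\<^bsub>W0 type_ring\<^esub> W0_class type_ring E''"
  unfolding W0_class_formal
  by (rule formal_class_exact) (use E End_rep(1) End_exact_End_rep[OF E exact] in blast)+

lemma W0_class_zero: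
  fixes M :: "('k::field, 'k list) module"
  assumes M: "finite_projective type_ring M"
  shows "W0_class type_ring (M, \<lambda>x. \<zero>\<^bsub>M\<^esub>) = \<zero>\<^bsub>W0 type_ring\<^esub>"
proof -
  interpret K: comm_group "add_monoid (K0_End (type_ring :: 'k ring))" by (rule comm_group_K0_End)
  let ?c = "K0_class type_ring (M, \<lambda>x. \<zero>\<^bsub>M\<^esub>)"
  have "?c \<in> K0_ideal type_ring"
    unfolding K0_ideal_def by (rule generate.incl) (use M in blast)
  then have "K0_ideal type_ring #>\<^bsub>add_monoid (K0_End type_ring)\<^esub> ?c = K0_ideal type_ring"
    by (rule K.coset_join2[OF K0_class_closed[OF zero_End_obj[OF M]] subgroup_K0_ideal])
  then show ?thesis
    by (simp add: W0_class_eq W0_def FactRing_def)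
qed

text \<open>Uniqueness half of \<open>W0_additive\<close>: every element of W_0 comes from a formal
  combination, and those are built from single pairs by differences.\<close>

lemma W0_hom_eqI:
  assumes H: "group H" and h: "h \<in> hom (add_monoid (W0 (type_ring :: 'k::field ring))) H"
      "h' \<in> hom (add_monoid (W0 type_ring)) H"
    and eq: "\<And>E :: ('k, 'k list) endo. E \<in> End_obj type_ring \<Longrightarrow> h (W0_class type_ring E) =
        h' (W0_class type_ring E)"
    and w: "w \<in> carrier (W0 type_ring)"
  shows "h w = h' w"
proof -
  let ?F = "free_Abelian_group (End_obj (type_ring :: 'k ring))"
  let ?W = "add_monoid (W0 (type_ring :: 'k ring))"
  obtain c where c: "c \<in> carrier ?F" "w = formal_class c"
    using w unfolding formal_class_surj by blast
  interpret f: group_hom ?F ?W formal_class by (rule group_hom_formal_class)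
  have g: "group_hom ?F H (h \<circ> formal_class)" "group_hom ?F H (h' \<circ> formal_class)"
    using h H hom_compose[OF formal_class_hom] by (auto simp: group_hom_def group_hom_axioms_def)
  interpret g: group_hom ?F H "h \<circ> formal_class" by (rule g(1))
  interpret g': group_hom ?F H "h' \<circ> formal_class" by (rule g(2))
  have "(h \<circ> formal_class) c = (h' \<circ> formal_class) c"
  proof (rule free_Abelian_group_induct[where S = "End_obj (type_ring :: 'k ring)"])
    show "Poly_Mapping.keys c \<subseteq> End_obj type_ring" using c(1) by simp
    show "(h \<circ> formal_class) 0 = (h' \<circ> formal_class) 0"
      using g.hom_one g'.hom_one by (metis one_free_Abelian_group)
    show "(h \<circ> formal_class) (frag_of E) = (h' \<circ> formal_class) (frag_of E)" if "E \<in> End_obj type_ring"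
        for E :: "('k, 'k list) endo"
      using eq[OF that] formal_class_eq_W0_class[OF that] by simp
    fix x y :: "('k, 'k list) endo \<Rightarrow>\<^sub>0 int"
    assume k: "Poly_Mapping.keys x \<subseteq> End_obj type_ring" "Poly_Mapping.keys y \<subseteq> End_obj type_ring"
      and IH: "(h \<circ> formal_class) x = (h' \<circ> formal_class) x" "(h \<circ> formal_class) y = (h' \<circ> formal_class) y"
    have xy: "x - y = x \<otimes>\<^bsub>?F\<^esub> inv\<^bsub>?F\<^esub> y" using k by simp
    have cc: "x \<in> carrier ?F" "y \<in> carrier ?F" "inv\<^bsub>?F\<^esub> y \<in> carrier ?F"
      using k by simp_all
    show "(h \<circ> formal_class) (x - y) = (h' \<circ> formal_class) (x - y)"
      unfolding xy g.hom_mult[OF cc(1,3)] g'.hom_mult[OF cc(1,3)] g.hom_inv[OF cc(2)] g'.hom_inv[OF cc(2)]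
          IH ..
  qed
  then show ?thesis by (simp add: c(2))
qed

text \<open>Existence half of \<open>W0_additive\<close>. Linear extension of \<open>\<phi>\<close>
  to formal combinations descends twice: \<open>exact\<close> kills the generators of
  \<open>K0_rel\<close>, and \<open>zero\<close> those of \<open>K0_ideal\<close>.\<close>

lemma W0_hom_exists:
  assumes H: "comm_group H" and \<phi>: "\<And>E. E \<in> End_obj type_ring \<Longrightarrow> \<phi> E \<in> carrier H"
    and exact: "\<And>E' E E'' :: ('k::field, 'k list) endo. E' \<in> End_obj type_ring \<Longrightarrow> E \<in> End_obj type_ring \<Longrightarrow>
      E'' \<in> End_obj type_ring \<Longrightarrow> End_exact type_ring E' E E'' \<Longrightarrow> \<phi> E = \<phi> E' \<otimes>\<^bsub>H\<^esub> \<phi> E''"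
    and zero: "\<And>M. finite_projective type_ring M \<Longrightarrow> \<phi> (M, \<lambda>x. \<zero>\<^bsub>M\<^esub>) = \<one>\<^bsub>H\<^esub>"
  obtains h where "h \<in> hom (add_monoid (W0 (type_ring :: 'k ring))) H"
    "\<And>E. E \<in> End_obj type_ring \<Longrightarrow> h (W0_class type_ring E) = \<phi> E"
proof -
  let ?F = "free_Abelian_group (End_obj (type_ring :: 'k ring))"
  let ?K = "add_monoid (K0_End (type_ring :: 'k ring))"
  interpret H: comm_group H by (rule H)
  interpret F: comm_group ?F by (rule abelian_free_Abelian_group)
  interpret K: comm_group ?K by (rule comm_group_K0_End)
  obtain Z :: "('k, 'k list) endo" where Z: "Z \<in> End_obj type_ring" "carrier (fst Z) = {\<zero>\<^bsub>fst Z\<^esub>}" "snd Z =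
      (\<lambda>x. \<zero>\<^bsub>fst Z\<^esub>)"
    by (rule zero_endo)
  have "finite_projective type_ring (fst Z)"
    using Z(1) by (auto simp: End_obj_def)
  then have \<phi>Z: "\<phi> Z = \<one>\<^bsub>H\<^esub>"
    using zero[of "fst Z"] Z(3) by (metis prod.collapse)
  \<comment> \<open>A class is formed from the representative \<open>End_rep\<close>, so
    \<open>\<phi>\<close> must not notice the replacement. This is \<open>exact\<close> for the
    sequence with kernel \<open>Z\<close>, on which \<open>\<phi>\<close> is trivial.\<close>
  have \<phi>_rep: "\<phi> (End_rep type_ring E) = \<phi> E" if E: "E \<in> End_obj type_ring" for E :: "('k, 'k list) endo"
    using exact[OF Z(1) E End_rep(1)[OF E] End_exact_if_iso[OF E End_rep[OF E] Z]] \<phi>[OF End_rep(1)[OF E]] \<phi>Z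
        by simp
  obtain h0 where h0: "h0 \<in> hom ?F H" "\<And>E. E \<in> End_obj type_ring \<Longrightarrow> h0 (frag_of E) = \<phi> E"
    using H.free_Abelian_group_universal[of \<phi> "End_obj type_ring"] \<phi> by blast
  interpret h0: group_hom ?F H h0 using h0(1) by unfold_locales
  have "K0_rel type_ring \<subseteq> kernel ?F H h0"
    unfolding K0_rel_def add_monoid_End_formal
  proof (rule F.generate_subgroup_incl[OF _ h0.subgroup_kernel], rule subsetI)
    fix c :: "('k, 'k list) endo \<Rightarrow>\<^sub>0 int" assume c: "c \<in> {frag_of E - frag_of E' - frag_of E'' | E' E E''.
      E' \<in> End_obj type_ring \<and> E \<in> End_obj type_ring \<and> E'' \<in> End_obj type_ring \<and>
          End_exact type_ring E' E E''}"
    then obtain E' E E'' where E: "c = frag_of E - frag_of E' - frag_of E''"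
      "E' \<in> End_obj type_ring" "E \<in> End_obj type_ring" "E'' \<in> End_obj type_ring"
          "End_exact type_ring E' E E''" by blast
    have cF: "c \<in> carrier ?F" using c K0_rel_gens_subset by blast
    have "frag_of E = c \<otimes>\<^bsub>?F\<^esub> (frag_of E' \<otimes>\<^bsub>?F\<^esub> frag_of E'')" using E(1) by simp
    then have "h0 (frag_of E) = h0 c \<otimes>\<^bsub>H\<^esub> (h0 (frag_of E') \<otimes>\<^bsub>H\<^esub> h0 (frag_of E''))"
      using h0.hom_mult[OF cF F.m_closed[of "frag_of E'" "frag_of E''"]] h0.hom_mult[of "frag_of E'"
          "frag_of E''"] E(2-4)
      by (simp only: frag_of_in_free_Abelian_group)
    then have "h0 c \<otimes>\<^bsub>H\<^esub> \<phi> E = \<phi> E"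
      using E(2-4) h0(2) exact[OF E(2-5)] by simp
    then have "h0 c = \<one>\<^bsub>H\<^esub>"
      using h0.hom_closed[OF cF] \<phi>[OF E(3)] H.r_cancel_one by metis
    then show "c \<in> kernel ?F H h0" using cF by (simp add: kernel_def)
  qed
  then obtain h1 where h1: "h1 \<in> hom ?K H"
      "\<And>c. c \<in> carrier ?F \<Longrightarrow> h1 (K0_rel type_ring #>\<^bsub>?F\<^esub> c) = h0 c"
    using h0.FactGroup_universal_kernel[OF K0_rel_normal] unfolding add_monoid_K0_End by blast
  interpret h1: group_hom ?K H h1 using h1(1) by unfold_locales
  have h1_class: "h1 (K0_class type_ring E) = \<phi> E" if "E \<in> End_obj type_ring" for E :: "('k, 'k list) endo"
    using h1(2)[of "frag_of (End_rep type_ring E)"] End_rep(1)[OF that] h0(2) \<phi>_rep[OF that]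
        by (simp add: K0_class_eq)
  have "K0_ideal type_ring \<subseteq> kernel ?K H h1"
    unfolding K0_ideal_def
  proof (rule K.generate_subgroup_incl[OF _ h1.subgroup_kernel], rule subsetI)
    fix a assume "a \<in> {K0_class type_ring (M, \<lambda>x. \<zero>\<^bsub>M\<^esub>) | M :: ('k, 'k list) module. finite_projective
        type_ring M}"
    then obtain M :: "('k, 'k list) module" where M: "finite_projective type_ring M" "a =
        K0_class type_ring (M, \<lambda>x. \<zero>\<^bsub>M\<^esub>)"
      by blast
    then show "a \<in> kernel ?K H h1"
      using h1_class[OF zero_End_obj[OF M(1)]] K0_class_closed[OF zero_End_obj[OF M(1)]] zero[OF M(1)]
          by (simp add: kernel_def)
  qed
  then obtain h2 where h2: "h2 \<in> hom (add_monoid (W0 (type_ring :: 'k ring))) H"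
      "\<And>a. a \<in> carrier ?K \<Longrightarrow> h2 (K0_ideal type_ring #>\<^bsub>?K\<^esub> a) = h1 a"
    using h1.FactGroup_universal_kernel[OF K0_ideal_normal] unfolding add_monoid_W0 by blast
  show thesis
  proof (rule that[OF h2(1)])
    show "h2 (W0_class type_ring E) = \<phi> E" if "E \<in> End_obj type_ring" for E :: "('k, 'k list) endo"
      using h2(2)[OF K0_class_closed[OF that]] h1_class[OF that] by (simp add: W0_class_eq)
  qed
qed

text \<open>Turns the definite description into usable facts. Any concrete additive map needs no
  more than the conditions on \<open>\<phi>\<close> listed here.\<close>

lemma W0_additive:
  assumes H: "comm_group H" and \<phi>: "\<And>E. E \<in> End_obj type_ring \<Longrightarrow> \<phi> E \<in> carrier H"
    and exact: "\<And>E' E E'' :: ('k::field, 'k list) endo. E' \<in> End_obj type_ring \<Longrightarrow> E \<in> End_obj type_ring \<Longrightarrow>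
      E'' \<in> End_obj type_ring \<Longrightarrow> End_exact type_ring E' E E'' \<Longrightarrow> \<phi> E = \<phi> E' \<otimes>\<^bsub>H\<^esub> \<phi> E''"
    and zero: "\<And>M. finite_projective type_ring M \<Longrightarrow> \<phi> (M, \<lambda>x. \<zero>\<^bsub>M\<^esub>) = \<one>\<^bsub>H\<^esub>"
  shows "W0_additive (type_ring :: 'k ring) H \<phi> \<in> hom (add_monoid (W0 type_ring)) H"
    and "E \<in> End_obj type_ring \<Longrightarrow> W0_additive type_ring H \<phi> (W0_class type_ring E) = \<phi> E"
proof -
  let ?W = "W0 (type_ring :: 'k ring)"
  let ?P = "\<lambda>h. h \<in> extensional (carrier ?W) \<and> h \<in> hom (add_monoid ?W) H \<and>
    (\<forall>E\<in>End_obj type_ring. h (W0_class type_ring E) = \<phi> E)"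
  obtain h where h: "h \<in> hom (add_monoid ?W) H" "\<And>E. E \<in> End_obj type_ring \<Longrightarrow> h (W0_class type_ring E) = \<phi> E"
    using W0_hom_exists[where \<phi> = \<phi>, OF H \<phi> exact zero] by blast
  interpret W: comm_group "add_monoid ?W" by (rule comm_group_W0)
  \<comment> \<open>A homomorphism is determined on the carrier only; cutting it off outside is what
    makes the described function unique.\<close>
  have "?P (restrict h (carrier ?W))"
  proof (intro conjI ballI)
    show "restrict h (carrier ?W) \<in> hom (add_monoid ?W) H"
      using h(1) W.m_closed by (auto simp: hom_def)
    show "restrict h (carrier ?W) (W0_class type_ring E) = \<phi> E" if "E \<in> End_obj type_ring" for E
      using h(2)[OF that] W0_class_closed[OF that] by simp
  qed simp
  moreover have "g = restrict h (carrier ?W)" if "?P g" for g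
  proof (rule extensionalityI)
    show "g \<in> extensional (carrier ?W)" using that by blast
    fix w assume w: "w \<in> carrier ?W"
    have "g w = h w"
      by (rule W0_hom_eqI[OF comm_group.axioms(2)[OF H] _ h(1) _ w]) (use that h(2) in auto)
    then show "g w = restrict h (carrier ?W) w" using w by simp
  qed simp
  ultimately have "?P (W0_additive (type_ring :: 'k ring) H \<phi>)"
    unfolding W0_additive_def by (rule theI)
  then show "W0_additive (type_ring :: 'k ring) H \<phi> \<in> hom (add_monoid ?W) H"
    and "E \<in> End_obj type_ring \<Longrightarrow> W0_additive type_ring H \<phi> (W0_class type_ring E) = \<phi> E"
    by blast+
qed

section \<open>Devissage to dimension one\<close>

lemma submodule_coord:
  fixes M :: "('k::field, 'b) module"
  assumes M: "module type_ring M" and \<Phi>: "coord M d \<Phi>" and N: "submodule type_ring N M"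
  obtains d' \<Psi> where "coord (M\<lparr>carrier := N\<rparr>) d' \<Psi>"
proof -
  interpret V: vectorspace "type_ring :: 'k ring" M by (rule vectorspaceI[OF M])
  have modN: "module type_ring (M\<lparr>carrier := N\<rparr>)" by (rule V.submodule_is_module[OF N])
  interpret W: vectorspace "type_ring :: 'k ring" "M\<lparr>carrier := N\<rparr>" by (rule vectorspaceI[OF modN])
  have fd: "V.fin_dim"
    using coord_basis(3,4)[OF M \<Phi>] unfolding V.fin_dim_def V.basis_def by blast
  have NM: "N \<subseteq> carrier M" using N by (simp add: submodule_def)
  \<comment> \<open>Subsets independent in \<open>N\<close> stay independent in \<open>M\<close>, so
    their size is bounded by the dimension of \<open>M\<close>. The bound provides a maximal
    independent set, which is a basis of \<open>N\<close>.\<close>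
  have bound: "finite S \<and> card S \<le> V.dim" if "S \<subseteq> carrier (M\<lparr>carrier := N\<rparr>) \<and> W.lin_indpt S" for S
  proof -
    have S: "S \<subseteq> N" "\<not> W.lin_dep S" using that by auto
    then have "\<not> V.lin_dep S" using V.span_li_not_depend(2)[OF S(1) N] by simp
    then show ?thesis using V.li_le_dim[OF fd, of S] S(1) NM by blast
  qed
  have "{} \<subseteq> carrier (M\<lparr>carrier := N\<rparr>) \<and> W.lin_indpt {}"
    by (auto simp: W.lin_dep_def)
  then obtain B where B: "finite B" "maximal B (\<lambda>S. S \<subseteq> carrier (M\<lparr>carrier := N\<rparr>) \<and> W.lin_indpt S)"
    using maximal_exists[of "\<lambda>S. S \<subseteq> carrier (M\<lparr>carrier := N\<rparr>) \<and> W.lin_indpt S" V.dim "{}"] bound by blast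
  then have "W.basis B" by (intro W.max_li_is_basis)
  moreover obtain bs where bs: "set bs = B" "distinct bs" using B(1) finite_distinct_list by blast
  ultimately have "coord (M\<lparr>carrier := N\<rparr>) (length bs) (vec_comb (M\<lparr>carrier := N\<rparr>) ((!) bs) (length bs))"
    using basis_iff_coord[OF modN, of bs] by (auto simp: W.basis_def)
  then show thesis by (rule that)
qed

text \<open>An eigenvector of the transposed matrix is a linear functional \<open>g\<close> with
  \<open>g (f x) = \<alpha> * g x\<close>. Its kernel is an invariant hyperplane and the quotient is
  a line with scalar \<open>\<alpha>\<close>.\<close>

lemma mat_rep_line_exact:
  fixes E :: "('k::alg_closed_field, 'k list) endo"
  assumes rep: "mat_rep E (Suc d) A \<Phi>"
  obtains E' E'' :: "('k, 'k list) endo" and A' \<Phi>' \<alpha> \<Phi>''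
  where "mat_rep E' d A' \<Phi>'" "mat_rep E'' 1 (mat 1 1 (\<lambda>_. \<alpha>)) \<Phi>''" "End_exact type_ring E' E E''"
proof -
  note r = mat_repD[OF rep]
  let ?M = "fst E" and ?f = "snd E"
  interpret M: module "type_ring :: 'k ring" ?M by (rule r(1))
  have f: "?f \<in> module_hom type_ring ?M ?M" by (rule mat_rep_hom[OF rep])
  have At: "transpose_mat A \<in> carrier_mat (Suc d) (Suc d)" using r(3) by simp
  have "degree (char_poly (transpose_mat A)) > 0"
    using degree_monic_char_poly[OF At] by simp
  then obtain \<alpha> where "poly (char_poly (transpose_mat A)) \<alpha> = 0"
    using alg_closed_imp_poly_has_root by blast
  then obtain w where w: "w \<in> carrier_vec (Suc d)" "w \<noteq> 0\<^sub>v (Suc d)" "transpose_mat A *\<^sub>v w = \<alpha> \<cdot>\<^sub>v w"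
    using eigenvalue_root_char_poly[OF At] At by (auto simp: eigenvalue_def eigenvector_def)
  let ?\<Psi> = "inv_into (carrier_vec (Suc d)) \<Phi>"
  note \<Psi> = coord_inv[OF r(2)]
  \<comment> \<open>The eigenvector \<open>w\<close> of the transpose, read as a functional on the
    space through the coordinates \<open>?\<Psi>\<close>.\<close>
  define g where "g x = w \<bullet> ?\<Psi> x" for x
  have g_add: "g (x \<oplus>\<^bsub>?M\<^esub> y) = g x + g y" if "x \<in> carrier ?M" "y \<in> carrier ?M" for x y
    using that module_homD(2)[OF \<Psi>(1) that] \<Psi>(2) w(1)
    by (simp add: g_def module_vec_simps scalar_prod_add_distrib[of _ "Suc d"])
  have g_smult: "g (c \<odot>\<^bsub>?M\<^esub> x) = c * g x" if "x \<in> carrier ?M" for c x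
    using module_homD(3)[OF \<Psi>(1) _ that, of c] \<Psi>(2)[OF that] w(1)
    by (simp add: g_def module_vec_simps)
  have g_f: "g (?f x) = \<alpha> * g x" if x: "x \<in> carrier ?M" for x
  proof -
    obtain v where v: "v \<in> carrier_vec (Suc d)" "x = \<Phi> v" using coord_surj[OF r(2) x] .
    have "?\<Psi> (?f x) = A *\<^sub>v v" "?\<Psi> x = v"
      using v r(3) r(4)[OF v(1)] \<Psi>(4)[of "A *\<^sub>v v"] \<Psi>(4)[OF v(1)] by simp_all
    then show ?thesis
      using transpose_vec_mult_scalar[OF r(3) v(1) w(1)] w v(1) by (simp add: g_def)
  qed
  define N where "N = {x \<in> carrier ?M. g x = 0}"
  have g0: "g \<zero>\<^bsub>?M\<^esub> = 0"
    using g_smult[OF M.M.zero_closed, of 0] M.lmult_0[OF M.M.zero_closed] by simp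
  have N: "submodule type_ring N ?M"
    using r(1) g_add g_smult g0 by (auto simp: submodule_def N_def intro: M.smult_closed)
  \<comment> \<open>The subspace keeps the operations and the element type of \<open>E\<close>, so
    the induction never leaves pairs over lists; the quotient is modelled on lists afresh, with
    \<open>g\<close> as projection.\<close>
  let ?E' = "(?M\<lparr>carrier := N\<rparr>, ?f)"
  have E'mod: "module type_ring (fst ?E')" using M.submodule_is_module[OF N] by simp
  have f': "?f \<in> module_hom type_ring (fst ?E') (fst ?E')"
    using f g_f by (auto simp: module_hom_def N_def)
  obtain d' \<Psi>' where "coord (fst ?E') d' \<Psi>'"
    using submodule_coord[OF r(1,2) N] by auto
  then obtain A' where rep': "mat_rep ?E' d' A' \<Psi>'"
    using mat_rep_exists[OF E'mod _ f'] by (metis fst_conv)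
  let ?E'' = "mat_endo (mat 1 1 (\<lambda>_. \<alpha>))"
  have rep'': "mat_rep ?E'' 1 (mat 1 1 (\<lambda>_. \<alpha>)) list_of_vec"
    by (rule mat_rep_mat_endo) simp
  note co = coordD[OF mat_repD(2)[OF rep'']]
  define u where "u x = vec 1 (\<lambda>_. g x)" for x
  have u: "u x \<in> carrier_vec 1" for x by (simp add: u_def)
  have u_eq: "u x = v \<longleftrightarrow> g x = v $ 0" if "v \<in> carrier_vec 1" for x v
    using that by (auto simp: u_def intro!: eq_vecI)
  define q where "q x = list_of_vec (u x)" for x
  have exact: "End_exact type_ring ?E' E ?E''"
    unfolding End_exact_def
  proof (intro bexI conjI)
    show "(\<lambda>x. x) \<in> End_hom type_ring ?E' E"
      by (rule End_homI, rule module_homI) (auto simp: N_def)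
    show "q \<in> End_hom type_ring E ?E''"
    proof (rule End_homI, rule module_homI)
      show "q x \<in> carrier (fst ?E'')" for x using co(1)[OF u] by (simp add: q_def)
      show "q (x \<oplus>\<^bsub>?M\<^esub> y) = q x \<oplus>\<^bsub>fst ?E''\<^esub> q y" if "x \<in> carrier ?M" "y \<in> carrier ?M" for x y
      proof -
        have "u (x \<oplus>\<^bsub>?M\<^esub> y) = u x + u y"
          using g_add[OF that] by (auto simp: u_def)
        then show ?thesis unfolding q_def by (simp only: co(2)[OF u u])
      qed
      show "q (c \<odot>\<^bsub>?M\<^esub> x) = c \<odot>\<^bsub>fst ?E''\<^esub> q x" if "x \<in> carrier ?M" for c x
      proof -
        have "u (c \<odot>\<^bsub>?M\<^esub> x) = c \<cdot>\<^sub>v u x"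
          using g_smult[OF that] by (auto simp: u_def)
        then show ?thesis unfolding q_def by (simp only: co(3)[OF u])
      qed
      show "q (?f x) = snd ?E'' (q x)" if "x \<in> carrier ?M" for x
      proof -
        have "u (?f x) = mat 1 1 (\<lambda>_. \<alpha>) *\<^sub>v u x"
          using g_f[OF that] by (auto simp: u_def scalar_prod_def)
        then show ?thesis unfolding q_def by (simp only: mat_repD(4)[OF rep'' u])
      qed
    qed
    show "inj_on (\<lambda>x. x) (carrier (fst ?E'))" by simp
    show "q ` carrier ?M = carrier (fst ?E'')"
    proof
      show "q ` carrier ?M \<subseteq> carrier (fst ?E'')" using co(1)[OF u] by (auto simp: q_def)
      \<comment> \<open>A nonzero coordinate of \<open>w\<close> gives a unit vector on which
        \<open>g\<close> does not vanish; rescaling it reaches every element of the line.\<close>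
      obtain i where i: "i < Suc d" "w $ i \<noteq> 0"
        using w(1,2) by (metis carrier_vecD eq_vecI index_zero_vec)
      let ?x = "\<Phi> (unit_vec (Suc d) i)"
      have x: "?x \<in> carrier ?M" "g ?x \<noteq> 0"
        using coordD(1)[OF r(2)] \<Psi>(4)[of "unit_vec (Suc d) i"] i w(1) by (simp_all add: g_def)
      show "carrier (fst ?E'') \<subseteq> q ` carrier ?M"
      proof
        fix y assume "y \<in> carrier (fst ?E'')"
        then obtain v where v: "v \<in> carrier_vec 1" "y = list_of_vec v"
            by (rule coord_surj[OF mat_repD(2)[OF rep'']])
        have "q ((v $ 0 / g ?x) \<odot>\<^bsub>?M\<^esub> ?x) = y"
        proof -
          have "u ((v $ 0 / g ?x) \<odot>\<^bsub>?M\<^esub> ?x) = v"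
            unfolding u_eq[OF v(1)] g_smult[OF x(1)] using x(2) by simp
          then show ?thesis by (simp only: q_def v(2))
        qed
        moreover have "(v $ 0 / g ?x) \<odot>\<^bsub>?M\<^esub> ?x \<in> carrier ?M" using x(1) by (intro M.smult_closed) simp_all
        ultimately show "y \<in> q ` carrier ?M" by blast
      qed
    qed
    have z: "\<zero>\<^bsub>fst ?E''\<^esub> = list_of_vec (0\<^sub>v 1)"
      by (simp add: mat_endo_def list_module_def)
    have "q x = \<zero>\<^bsub>fst ?E''\<^esub> \<longleftrightarrow> g x = 0" for x
      unfolding z q_def co(4)[OF u zero_carrier_vec] using u_eq[OF zero_carrier_vec] by simp
    then show "{x \<in> carrier ?M. q x = \<zero>\<^bsub>fst ?E''\<^esub>} = (\<lambda>x. x) ` carrier (fst ?E')"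
      by (auto simp: N_def)
  qed
  \<comment> \<open>The coordinates of the hyperplane came with an unknown number \<open>d'\<close>;
    comparing sizes of two matrices of \<open>E\<close> shows \<open>d' = d\<close>.\<close>
  obtain B \<Phi>2 where "mat_rep E (d' + 1) (four_block_mat A' B (0\<^sub>m 1 d') (mat 1 1 (\<lambda>_. \<alpha>))) \<Phi>2"
    using exact_mat_rep[OF r(1) f rep' rep'' exact] by blast
  then have "d' + 1 = Suc d" by (rule mat_rep_unique(1)[OF rep])
  then have "d' = d" by simp
  with rep' rep'' exact that show thesis by blast
qed

text \<open>Induction on the dimension, splitting off a one-dimensional quotient by
  \<open>mat_rep_line_exact\<close> at each step.\<close>

lemma End_devissage:
  fixes E :: "('k::alg_closed_field, 'k list) endo"
  assumes E: "E \<in> End_obj type_ring"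
    and exact: "\<And>E' E E''. E' \<in> End_obj type_ring \<Longrightarrow> E \<in> End_obj type_ring \<Longrightarrow> E'' \<in> End_obj type_ring \<Longrightarrow>
      End_exact type_ring E' E E'' \<Longrightarrow> P E' \<Longrightarrow> P E'' \<Longrightarrow> P E"
    and zero: "\<And>E A \<Phi>. mat_rep E 0 A \<Phi> \<Longrightarrow> P E"
    and line: "\<And>E \<alpha> \<Phi>. mat_rep E 1 (mat 1 1 (\<lambda>_. \<alpha>)) \<Phi> \<Longrightarrow> P E"
  shows "P E"
proof -
  have "P E" if "mat_rep E d A \<Phi>" for d A \<Phi> and E :: "('k, 'k list) endo"
    using that
  proof (induction d arbitrary: E A \<Phi>)
    case 0
    then show ?case by (rule zero)
  next
    case (Suc d)
    obtain E' E'' :: "('k, 'k list) endo" and A' \<Phi>' \<alpha> \<Phi>''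
      where "mat_rep E' d A' \<Phi>'" "mat_rep E'' 1 (mat 1 1 (\<lambda>_. \<alpha>)) \<Phi>''" "End_exact type_ring E' E E''"
      by (rule mat_rep_line_exact[OF Suc.prems])
    then show ?case
      using Suc.IH line Suc.prems by (intro exact[of E' E E'']) (auto simp: End_obj_iff_mat_rep)
  qed
  moreover obtain d A \<Phi> where "mat_rep E d A \<Phi>"
    using E by (auto simp: End_obj_iff_mat_rep)
  ultimately show ?thesis by blast
qed

text \<open>In contrast to \<open>formal_class_eq_W0_class\<close> the two pairs may live over
  different element types. The zero pair in front of the sequence carries the zero map, so its class
  lies in the ideal.\<close>

lemma W0_class_iso:
  fixes E :: "('k::field, 'b) endo" and D :: "('k, 'c) endo"
  assumes E: "E \<in> End_obj type_ring" and D: "D \<in> End_obj type_ring" and iso: "End_iso type_ring E D"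
  shows "W0_class type_ring E = W0_class type_ring D"
proof -
  interpret W: comm_group "add_monoid (W0 (type_ring :: 'k ring))" by (rule comm_group_W0)
  obtain Z :: "('k, 'k list) endo" where Z: "Z \<in> End_obj type_ring" "carrier (fst Z) = {\<zero>\<^bsub>fst Z\<^esub>}" "snd Z =
      (\<lambda>x. \<zero>\<^bsub>fst Z\<^esub>)"
    by (rule zero_endo)
  have "W0_class type_ring Z = \<zero>\<^bsub>W0 type_ring\<^esub>"
    using W0_class_zero[of "fst Z"] Z(1,3) by (metis (no_types, lifting) End_obj_def case_prodE fst_conv
        mem_Collect_eq prod.collapse)
  then show ?thesis
    using W0_class_exact[OF Z(1) E D End_exact_if_iso[OF E D iso Z]] W.l_one[of "W0_class type_ring D"]
        W0_class_closed[OF D]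
    by simp
qed

lemma End_hom_id: "(\<And>x. x \<in> carrier M \<Longrightarrow> f x = g x) \<Longrightarrow> (\<lambda>x. x) \<in> End_hom R (M, f) (M, g)"
  by (rule End_homI, rule module_homI) simp_all

text \<open>The generators of \<open>K0_ideal\<close> use the function that is zero on the whole
  type. A map vanishing only on the carrier is another HOL function but gives an isomorphic
  pair.\<close>

lemma W0_class_zero_on_carrier:
  fixes E :: "('k::field, 'k list) endo"
  assumes E: "E \<in> End_obj type_ring" and zero: "\<And>x. x \<in> carrier (fst E) \<Longrightarrow> snd E x = \<zero>\<^bsub>fst E\<^esub>"
  shows "W0_class type_ring E = \<zero>\<^bsub>W0 type_ring\<^esub>"
proof -
  have M: "finite_projective type_ring (fst E)" using E by (auto simp: End_obj_def)
  have "(\<lambda>x. x) \<in> End_hom type_ring E (fst E, \<lambda>x. \<zero>\<^bsub>fst E\<^esub>)"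
    using End_hom_id[of "fst E" "snd E" "\<lambda>x. \<zero>\<^bsub>fst E\<^esub>"] zero by simp
  then have "End_iso type_ring E (fst E, \<lambda>x. \<zero>\<^bsub>fst E\<^esub>)"
    unfolding End_iso_def by (intro bexI[of _ "\<lambda>x. x"]) (simp_all add: bij_betw_def)
  then show ?thesis
    using W0_class_iso[OF E zero_End_obj[OF M]] W0_class_zero[OF M] by simp
qed

lemma End_hom_funpow:
  assumes "h \<in> End_hom R E D" "snd E \<in> module_hom R (fst E) (fst E)" "x \<in> carrier (fst E)"
  shows "h ((snd E ^^ n) x) = (snd D ^^ n) (h x)" "(snd E ^^ n) x \<in> carrier (fst E)"
proof -
  have "h ((snd E ^^ n) x) = (snd D ^^ n) (h x) \<and> (snd E ^^ n) x \<in> carrier (fst E)"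
    by (induction n) (use assms module_homD(1)[OF assms(2)] End_homD(3)[OF assms(1)] in auto)
  then show "h ((snd E ^^ n) x) = (snd D ^^ n) (h x)" "(snd E ^^ n) x \<in> carrier (fst E)" by auto
qed

lemma mat_rep_lineD:
  assumes rep: "mat_rep E 1 (mat 1 1 (\<lambda>_. \<alpha>)) \<Phi>" and v: "v \<in> carrier_vec 1"
  shows "snd E (\<Phi> v) = \<alpha> \<odot>\<^bsub>fst E\<^esub> \<Phi> v"
proof -
  have "mat 1 1 (\<lambda>_. \<alpha>) *\<^sub>v v = \<alpha> \<cdot>\<^sub>v v"
    using v by (auto simp: scalar_prod_def)
  then show ?thesis
    using mat_repD(4)[OF rep v] coordD(3)[OF mat_repD(2)[OF rep] v] by simp
qed

lemma mat_rep_line_funpow: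
  assumes rep: "mat_rep E 1 (mat 1 1 (\<lambda>_. \<alpha>)) \<Phi>" and v: "v \<in> carrier_vec 1"
  shows "(snd E ^^ n) (\<Phi> v) = \<alpha> ^ n \<odot>\<^bsub>fst E\<^esub> \<Phi> v"
proof -
  interpret module type_ring "fst E" by (rule mat_repD(1)[OF rep])
  note f = mat_rep_hom[OF rep]
  have x: "\<Phi> v \<in> carrier (fst E)" using coordD(1)[OF mat_repD(2)[OF rep] v] .
  show ?thesis
  proof (induction n)
    case 0
    then show ?case using smult_one[OF x] by simp
  next
    case (Suc n)
    then have "(snd E ^^ Suc n) (\<Phi> v) = \<alpha> ^ n \<odot>\<^bsub>fst E\<^esub> (\<alpha> \<odot>\<^bsub>fst E\<^esub> \<Phi> v)"
      using module_homD(3)[OF f _ x, of "\<alpha> ^ n"] mat_rep_lineD[OF rep v] by simp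
    then show ?case
      using smult_assoc1[OF _ _ x, of "\<alpha> ^ n" \<alpha>] by (simp add: mult.commute)
  qed
qed

text \<open>Nilpotency passes to subobjects, by injectivity of \<open>i\<close>, and to quotients,
  by surjectivity of \<open>q\<close>. On a line \<open>\<alpha> ^ N = 0\<close> forces
  \<open>\<alpha> = 0\<close>, and such a line vanishes in W_0.\<close>

lemma W0_class_nilpotent_list:
  fixes E :: "('k::alg_closed_field, 'k list) endo"
  assumes E: "E \<in> End_obj type_ring" and nil: "\<And>x. x \<in> carrier (fst E) \<Longrightarrow> (snd E ^^ N) x = \<zero>\<^bsub>fst E\<^esub>"
  shows "W0_class type_ring E = \<zero>\<^bsub>W0 type_ring\<^esub>"
proof -
  interpret W: comm_group "add_monoid (W0 (type_ring :: 'k ring))" by (rule comm_group_W0)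
  let ?P = "\<lambda>E :: ('k, 'k list) endo. (\<forall>x\<in>carrier (fst E). (snd E ^^ N) x = \<zero>\<^bsub>fst E\<^esub>) \<longrightarrow> W0_class type_ring E =
      \<zero>\<^bsub>W0 type_ring\<^esub>"
  have "?P E"
    using E
  proof (rule End_devissage[where P = ?P])
    fix E' E E'' :: "('k, 'k list) endo"
    assume E: "E' \<in> End_obj type_ring" "E \<in> End_obj type_ring" "E'' \<in> End_obj type_ring"
      and exact: "End_exact type_ring E' E E''" and IH: "?P E'" "?P E''"
    show "?P E"
    proof
      assume nil: "\<forall>x\<in>carrier (fst E). (snd E ^^ N) x = \<zero>\<^bsub>fst E\<^esub>"
      obtain i q where iq: "i \<in> End_hom type_ring E' E" "q \<in> End_hom type_ring E E''"
        "inj_on i (carrier (fst E'))" "q ` carrier (fst E) = carrier (fst E'')"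
        using exact unfolding End_exact_def by blast
      note mods = End_objD[OF E(1)] End_objD[OF E(2)] End_objD[OF E(3)]
      interpret E': module "type_ring :: 'k ring" "fst E'" by (rule mods(1))
      have "(snd E' ^^ N) x = \<zero>\<^bsub>fst E'\<^esub>" if x: "x \<in> carrier (fst E')" for x
      proof -
        have "i ((snd E' ^^ N) x) = i \<zero>\<^bsub>fst E'\<^esub>"
          using End_hom_funpow(1)[OF iq(1) mods(2) x] nil End_homD(2)[OF iq(1) x]
            module_hom_zero[OF mods(1,3) End_homD(1)[OF iq(1)]] by simp
        then show ?thesis
          using iq(3) End_hom_funpow(2)[OF iq(1) mods(2) x] E'.M.zero_closed by (meson inj_onD)
      qed
      moreover have "(snd E'' ^^ N) y = \<zero>\<^bsub>fst E''\<^esub>" if y: "y \<in> carrier (fst E'')" for y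
      proof -
        obtain x where x: "x \<in> carrier (fst E)" "y = q x" using y iq(4) by blast
        then show ?thesis
          using End_hom_funpow(1)[OF iq(2) mods(4) x(1), of N] nil
            module_hom_zero[OF mods(3,5) End_homD(1)[OF iq(2)]] by simp
      qed
      ultimately show "W0_class type_ring E = \<zero>\<^bsub>W0 type_ring\<^esub>"
        using IH W0_class_exact[OF E exact] W.l_one[OF W.one_closed] by simp
    qed
  next
    fix E :: "('k, 'k list) endo" and A \<Phi> assume rep: "mat_rep E 0 A \<Phi>"
    then have E: "E \<in> End_obj type_ring" by (auto simp: End_obj_iff_mat_rep)
    interpret module "type_ring :: 'k ring" "fst E" by (rule mat_repD(1)[OF rep])
    have "x = y" if "x \<in> carrier (fst E)" "y \<in> carrier (fst E)" for x y
      using that coord_surj[OF mat_repD(2)[OF rep]] by (metis carrier_vecD vec_of_dim_0)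
    then have "snd E x = \<zero>\<^bsub>fst E\<^esub>" if "x \<in> carrier (fst E)" for x
      using that module_homD(1)[OF mat_rep_hom[OF rep]] M.zero_closed by blast
    then show "?P E" using W0_class_zero_on_carrier[OF E] by blast
  next
    fix E :: "('k, 'k list) endo" and \<alpha> \<Phi> assume rep: "mat_rep E 1 (mat 1 1 (\<lambda>_. \<alpha>)) \<Phi>"
    then have E: "E \<in> End_obj type_ring" by (auto simp: End_obj_iff_mat_rep)
    interpret module "type_ring :: 'k ring" "fst E" by (rule mat_repD(1)[OF rep])
    note co = coordD[OF mat_repD(2)[OF rep]]
    have \<Phi>0: "\<Phi> (0\<^sub>v 1) = \<zero>\<^bsub>fst E\<^esub>"
      using module_hom_zero[OF module_vec_mod mat_repD(1)[OF rep]] mat_repD(2)[OF rep]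
      by (simp add: coord_def module_vec_simps)
    show "?P E"
    proof
      assume nil: "\<forall>x\<in>carrier (fst E). (snd E ^^ N) x = \<zero>\<^bsub>fst E\<^esub>"
      let ?e = "unit_vec 1 0 :: 'k vec"
      \<comment> \<open>The hypothesis is tested on the basis vector of the line, whose coordinate
        after \<open>N\<close> steps is \<open>\<alpha> ^ N\<close>.\<close>
      have "\<Phi> (\<alpha> ^ N \<cdot>\<^sub>v ?e) = \<Phi> (0\<^sub>v 1)"
        using mat_rep_line_funpow[OF rep, of ?e N] nil co(1)[of ?e] co(3)[of ?e "\<alpha> ^ N"] \<Phi>0 by simp
      then have "\<alpha> ^ N \<cdot>\<^sub>v ?e = 0\<^sub>v 1" using co(4)[of "\<alpha> ^ N \<cdot>\<^sub>v ?e" "0\<^sub>v 1"] by simp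
      then have "(\<alpha> ^ N \<cdot>\<^sub>v ?e) $ 0 = 0\<^sub>v 1 $ 0" by (rule arg_cong)
      then have "\<alpha> = 0" by simp
      have "snd E x = \<zero>\<^bsub>fst E\<^esub>" if x: "x \<in> carrier (fst E)" for x
      proof -
        obtain v where "v \<in> carrier_vec 1" "x = \<Phi> v" by (rule coord_surj[OF mat_repD(2)[OF rep] x])
        then show ?thesis using mat_rep_lineD[OF rep] lmult_0[OF x] \<open>\<alpha> = 0\<close> by simp
      qed
      then show "W0_class type_ring E = \<zero>\<^bsub>W0 type_ring\<^esub>" using W0_class_zero_on_carrier[OF E] by blast
    qed
  qed
  then show ?thesis using nil by blast
qed

section \<open>Torsion in \<open>\<rat>/\<int>\<close>\<close>

lemma qmodz_eq_iff: "qmodz x = qmodz y \<longleftrightarrow> x - y \<in> \<int>"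
  by (simp add: qmodz.abs_eq_iff)

lemma qmodz_eq_0_iff: "qmodz x = 0 \<longleftrightarrow> x \<in> \<int>"
  by (simp add: zero_qmodz_def qmodz_eq_iff)

lemma qmodz_cases: obtains x where "\<gamma> = qmodz x"
  using qmodz.abs_induct[of "\<lambda>\<gamma>. \<exists>x. \<gamma> = qmodz x" \<gamma>] by blast

lemma qmodz_mult_add: "qmodz_mult n (\<gamma> + \<delta>) = qmodz_mult n \<gamma> + qmodz_mult n \<delta>"
  by transfer (simp add: distrib_left)

lemma qmodz_mult_diff: "qmodz_mult n (\<gamma> - \<delta>) = qmodz_mult n \<gamma> - qmodz_mult n \<delta>"
  by transfer (simp add: right_diff_distrib)

lemma qmodz_mult_zero [simp]: "qmodz_mult n 0 = 0"
  by transfer simp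

lemma qmodz_mult_0 [simp]: "qmodz_mult 0 \<gamma> = 0"
  by transfer simp

lemma qmodz_mult_1 [simp]: "qmodz_mult (Suc 0) \<gamma> = \<gamma>"
  by transfer simp

lemma qmodz_mult_add_left: "qmodz_mult (m + n) \<gamma> = qmodz_mult m \<gamma> + qmodz_mult n \<gamma>"
  by transfer (simp add: distrib_right)

lemma qmodz_mult_mult: "qmodz_mult (m * n) \<gamma> = qmodz_mult m (qmodz_mult n \<gamma>)"
  by transfer (simp add: mult.assoc)

lemma qmodz_mult_dvd: "qmodz_mult m \<gamma> = 0 \<Longrightarrow> m dvd n \<Longrightarrow> qmodz_mult n \<gamma> = 0"
  by (metis dvd_def mult.commute qmodz_mult_mult qmodz_mult_zero)

lemma qmodz_torsion:
  obtains N where "N > 0" "qmodz_mult N \<gamma> = 0"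
proof -
  obtain x where x: "\<gamma> = qmodz x" by (rule qmodz_cases)
  obtain a b where ab: "quotient_of x = (a, b)" by fastforce
  then have b: "b > 0" "x = of_int a / of_int b"
    using quotient_of_denom_pos quotient_of_div by blast+
  have "of_nat (nat b) * x = of_int a"
    using b by simp
  then have "qmodz_mult (nat b) \<gamma> = 0"
    by (simp add: x qmodz_mult.abs_eq qmodz_eq_0_iff)
  with b(1) show thesis by (intro that[of "nat b"]) simp_all
qed

text \<open>The \<open>n\<close>-torsion consists of the classes of \<open>a / n\<close> with
  \<open>a < n\<close>, pairwise distinct because two such numerators differ by less than
  \<open>n\<close>.\<close>

lemma card_qmodz_torsion:
  assumes n: "n > 0"
  shows "finite {\<gamma>. qmodz_mult n \<gamma> = 0}" "card {\<gamma>. qmodz_mult n \<gamma> = 0} = n"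
proof -
  let ?f = "\<lambda>a. qmodz (of_nat a / of_nat n)"
  have "bij_betw ?f {..<n} {\<gamma>. qmodz_mult n \<gamma> = 0}"
    unfolding bij_betw_def
  proof
    show "inj_on ?f {..<n}"
    proof (rule inj_onI)
      fix a b assume ab: "a \<in> {..<n}" "b \<in> {..<n}" "?f a = ?f b"
      then obtain k where "(of_nat a / of_nat n - of_nat b / of_nat n :: rat) = of_int k"
        by (auto simp: qmodz_eq_iff elim: Ints_cases)
      then have "(of_int (int a - int b) :: rat) = of_int (k * int n)"
        using n by (simp add: field_simps)
      then have "int a - int b = k * int n" by (simp only: of_int_eq_iff)
      moreover have "\<bar>int a - int b\<bar> < int n" using ab by auto
      ultimately have "k = 0" using n by (auto simp: abs_mult)
      with \<open>int a - int b = k * int n\<close> show "a = b" by simp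
    qed
    show "?f ` {..<n} = {\<gamma>. qmodz_mult n \<gamma> = 0}"
    proof (intro equalityI subsetI)
      fix \<gamma> assume "\<gamma> \<in> ?f ` {..<n}"
      then show "\<gamma> \<in> {\<gamma>. qmodz_mult n \<gamma> = 0}"
        using n by (auto simp: qmodz_mult.abs_eq qmodz_eq_0_iff)
    next
      fix \<gamma> assume "\<gamma> \<in> {\<gamma>. qmodz_mult n \<gamma> = 0}"
      moreover obtain x where x: "\<gamma> = qmodz x" by (rule qmodz_cases)
      ultimately obtain k where k: "of_nat n * x = of_int k"
        by (auto simp: qmodz_mult.abs_eq qmodz_eq_0_iff elim: Ints_cases)
      \<comment> \<open>Changing \<open>x\<close> by the integer \<open>k div n\<close> replaces the
        numerator \<open>k\<close> by its remainder.\<close>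
      let ?a = "nat (k mod int n)"
      have "of_int k = (of_int (int n * (k div int n) + k mod int n) :: rat)" by simp
      also have "\<dots> = of_nat n * of_int (k div int n) + of_nat ?a"
        using n by (simp only: of_int_add of_int_mult of_int_of_nat_eq) simp
      finally have "x - of_nat ?a / of_nat n = of_int (k div int n)"
        using n k by (simp add: field_simps)
      then have "\<gamma> = ?f ?a" by (simp add: x qmodz_eq_iff)
      moreover have "?a < n" using n by (simp add: nat_less_iff)
      ultimately show "\<gamma> \<in> ?f ` {..<n}" by blast
    qed
  qed
  then show "finite {\<gamma>. qmodz_mult n \<gamma> = 0}" "card {\<gamma>. qmodz_mult n \<gamma> = 0} = n"
    using bij_betw_finite bij_betw_same_card by fastforce+
qed

text \<open>A nonempty fibre is a translate of the \<open>n\<close>-torsion. Finiteness matters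
  because a sum over an infinite set is 0 by convention, which would falsify
  \<open>qz_rho\<close>.\<close>

lemma finite_qmodz_fibre:
  assumes n: "n > 0"
  shows "finite {\<gamma>'. qmodz_mult n \<gamma>' = \<gamma>}"
proof (cases "\<exists>\<delta>. qmodz_mult n \<delta> = \<gamma>")
  case True
  then obtain \<delta> where "qmodz_mult n \<delta> = \<gamma>" by blast
  then have "{\<gamma>'. qmodz_mult n \<gamma>' = \<gamma>} \<subseteq> (\<lambda>\<epsilon>. \<epsilon> + \<delta>) ` {\<epsilon>. qmodz_mult n \<epsilon> = 0}"
    by (intro subsetI, rule_tac x = "x - \<delta>" in image_eqI) (simp_all add: qmodz_mult_diff)
  then show ?thesis
    using card_qmodz_torsion(1)[OF n] by (meson finite_imageI finite_subset)
qed auto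

text \<open>Replaces denominators by torsion, the form in which the subgroup meets multiplication
  maps and roots of unity.\<close>

lemma qmodz_prime_to_iff:
  "\<gamma> \<in> qmodz_prime_to p \<longleftrightarrow> (\<exists>b>0. coprime b p \<and> qmodz_mult b \<gamma> = 0)"
proof
  assume "\<gamma> \<in> qmodz_prime_to p"
  then show "\<exists>b>0. coprime b p \<and> qmodz_mult b \<gamma> = 0"
    by (auto simp: qmodz_prime_to_def qmodz_mult.abs_eq qmodz_eq_0_iff)
next
  assume "\<exists>b>0. coprime b p \<and> qmodz_mult b \<gamma> = 0"
  then obtain b where b: "b > 0" "coprime b p" "qmodz_mult b \<gamma> = 0" by blast
  obtain x where x: "\<gamma> = qmodz x" by (rule qmodz_cases)
  with b obtain a where "of_nat b * x = of_int a"
    by (auto simp: qmodz_mult.abs_eq qmodz_eq_0_iff elim: Ints_cases)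
  then have "x = of_int a / of_nat b" using b(1) by (simp add: field_simps)
  with x b show "\<gamma> \<in> qmodz_prime_to p"
    by (auto simp: qmodz_prime_to_def)
qed

lemma qmodz_prime_to_diff:
  assumes "\<gamma> \<in> qmodz_prime_to p" "\<delta> \<in> qmodz_prime_to p"
  shows "\<gamma> - \<delta> \<in> qmodz_prime_to p"
proof -
  obtain b c where "b > 0" "coprime b p" "qmodz_mult b \<gamma> = 0" "c > 0" "coprime c p" "qmodz_mult c \<delta> = 0"
    using assms by (auto simp: qmodz_prime_to_iff)
  then show ?thesis
    unfolding qmodz_prime_to_iff
    using qmodz_mult_dvd[of b \<gamma> "b * c"] qmodz_mult_dvd[of c \<delta> "b * c"]
    by (intro exI[of _ "b * c"]) (simp add: qmodz_mult_diff)
qed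

lemma qmodz_primary_diff:
  assumes "\<gamma> \<in> qmodz_primary p" "\<delta> \<in> qmodz_primary p"
  shows "\<gamma> - \<delta> \<in> qmodz_primary p"
proof -
  obtain k l where "qmodz_mult (p ^ k) \<gamma> = 0" "qmodz_mult (p ^ l) \<delta> = 0"
    using assms by (auto simp: qmodz_primary_def)
  then show ?thesis
    unfolding qmodz_primary_def mem_Collect_eq
    using qmodz_mult_dvd[of "p ^ k" \<gamma> "p ^ (k + l)"] qmodz_mult_dvd[of "p ^ l" \<delta> "p ^ (k + l)"]
    by (intro exI[of _ "k + l"]) (simp add: qmodz_mult_diff le_imp_power_dvd)
qed

text \<open>Bezout's identity; it takes the place of an order of an element.\<close>

lemma qmodz_mult_gcd:
  assumes a: "a > 0" and 0: "qmodz_mult a \<gamma> = 0" "qmodz_mult b \<gamma> = 0"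
  shows "qmodz_mult (gcd a b) \<gamma> = 0"
proof -
  obtain x y where "a * x = b * y + gcd a b" using bezout_nat[of a b] a by blast
  then have "qmodz_mult (a * x) \<gamma> = qmodz_mult (b * y) \<gamma> + qmodz_mult (gcd a b) \<gamma>"
    by (simp add: qmodz_mult_add_left)
  then show ?thesis
    using qmodz_mult_dvd[OF 0(1) dvd_triv_left[of a x]] qmodz_mult_dvd[OF 0(2) dvd_triv_left[of b y]] by simp
qed

lemma qmodz_prime_to_primary:
  assumes "\<gamma> \<in> qmodz_prime_to p" "\<gamma> \<in> qmodz_primary p"
  shows "\<gamma> = 0"
proof -
  obtain b k where b: "b > 0" "coprime b p" "qmodz_mult b \<gamma> = 0" "qmodz_mult (p ^ k) \<gamma> = 0"
    using assms by (auto simp: qmodz_prime_to_iff qmodz_primary_def)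
  then have "gcd b (p ^ k) = 1" by simp
  then show ?thesis using qmodz_mult_gcd[OF b(1,3,4)] by simp
qed

lemma prime_power_coprime_decomp:
  assumes "prime (p :: nat)" "n > 0"
  obtains a m where "n = p ^ a * m" "coprime m p" "m > 0"
proof -
  have "\<not> is_unit p" using assms(1) by auto
  then obtain m where "n = p ^ multiplicity p n * m" "\<not> p dvd m"
    using multiplicity_decompose'[of n p] assms by auto
  then show thesis
    using assms that by (metis coprime_commute gr0I mult_0_right prime_imp_coprime nat_less_le)
qed

text \<open>The description in \<open>qmodz_proj\<close> has at most one solution because the
  prime-to-\<open>p\<close> and \<open>p\<close>-primary subgroups meet only in 0. A solution is
  produced from a Bezout identity for the two coprime factors of an annihilator of
  \<open>\<gamma>\<close>.\<close>

lemma qmodz_proj: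
  assumes p: "prime p"
  shows "qmodz_proj p \<gamma> \<in> qmodz_prime_to p" "\<gamma> - qmodz_proj p \<gamma> \<in> qmodz_primary p"
    and "\<delta> \<in> qmodz_prime_to p \<Longrightarrow> \<gamma> - \<delta> \<in> qmodz_primary p \<Longrightarrow> qmodz_proj p \<gamma> = \<delta>"
proof -
  have unique: "\<delta> = \<delta>'" if "\<delta> \<in> qmodz_prime_to p" "\<gamma> - \<delta> \<in> qmodz_primary p"
    "\<delta>' \<in> qmodz_prime_to p" "\<gamma> - \<delta>' \<in> qmodz_primary p" for \<delta> \<delta>'
  proof -
    have "\<delta>' - \<delta> \<in> qmodz_primary p" using qmodz_primary_diff[OF that(2,4)] by simp
    then show ?thesis using qmodz_prime_to_primary[OF qmodz_prime_to_diff[OF that(3,1)]] by simp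
  qed
  obtain N where N: "N > 0" "qmodz_mult N \<gamma> = 0" by (rule qmodz_torsion)
  then obtain k m where m: "N = p ^ k * m" "coprime m p" "m > 0"
    using prime_power_coprime_decomp[OF p] by blast
  have "p ^ k \<noteq> 0" "gcd (p ^ k) m = 1"
    using p m by (auto simp: coprime_commute)
  then obtain v t where t: "p ^ k * v = Suc 0 + m * t"
    using bezout_nat[of "p ^ k" m] by auto
  \<comment> \<open>\<open>p^k * v\<close> is divisible by \<open>p^k\<close> and congruent to 1
    modulo \<open>m\<close>: so \<open>?\<delta>\<close> is killed by \<open>m\<close>, while
    \<open>\<gamma> - ?\<delta>\<close> is a multiple of \<open>m * \<gamma>\<close> and is killed
    by \<open>p^k\<close>.\<close>
  let ?\<delta> = "qmodz_mult (p ^ k * v) \<gamma>"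
  have "qmodz_mult m ?\<delta> = 0"
  proof -
    have "m * (p ^ k * v) = N * v" by (simp add: m(1))
    then have "N dvd m * (p ^ k * v)" by (rule dvdI)
    then show ?thesis using qmodz_mult_dvd[OF N(2)] by (simp only: qmodz_mult_mult[symmetric])
  qed
  then have 1: "?\<delta> \<in> qmodz_prime_to p" using m by (auto simp: qmodz_prime_to_iff)
  have "?\<delta> = \<gamma> + qmodz_mult (m * t) \<gamma>" unfolding t qmodz_mult_add_left by simp
  moreover have "qmodz_mult (p ^ k) (qmodz_mult (m * t) \<gamma>) = 0"
  proof -
    have "p ^ k * (m * t) = N * t" by (simp add: m(1))
    then have "N dvd p ^ k * (m * t)" by (rule dvdI)
    then show ?thesis using qmodz_mult_dvd[OF N(2)] by (simp only: qmodz_mult_mult[symmetric])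
  qed
  ultimately have "qmodz_mult (p ^ k) (\<gamma> - ?\<delta>) = 0" using qmodz_mult_diff[of "p ^ k" 0 "qmodz_mult (m * t) \<gamma>"]
      by simp
  then have 2: "\<gamma> - ?\<delta> \<in> qmodz_primary p" by (auto simp: qmodz_primary_def)
  have "qmodz_proj p \<gamma> = ?\<delta>"
    unfolding qmodz_proj_def using 1 2 unique by (intro the_equality) blast+
  then show "qmodz_proj p \<gamma> \<in> qmodz_prime_to p" "\<gamma> - qmodz_proj p \<gamma> \<in> qmodz_primary p"
    and "\<delta> \<in> qmodz_prime_to p \<Longrightarrow> \<gamma> - \<delta> \<in> qmodz_primary p \<Longrightarrow> qmodz_proj p \<gamma> = \<delta>"
    using 1 2 unique by simp_all
qed

lemma qmodz_mult_prime_to: "\<gamma> \<in> qmodz_prime_to p \<Longrightarrow> qmodz_mult n \<gamma> \<in> qmodz_prime_to p"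
  unfolding qmodz_prime_to_iff by (metis mult.commute qmodz_mult_mult qmodz_mult_zero)

lemma qmodz_mult_primary: "\<gamma> \<in> qmodz_primary p \<Longrightarrow> qmodz_mult n \<gamma> \<in> qmodz_primary p"
  unfolding qmodz_primary_def mem_Collect_eq by (metis mult.commute qmodz_mult_mult qmodz_mult_zero)

text \<open>A \<open>p\<close>-primary element killed by \<open>p^a * m\<close> is killed by the gcd
  with some power of \<open>p\<close>, which divides \<open>p^a\<close> as \<open>m\<close> is prime
  to \<open>p\<close>. What remains is the full \<open>p^a\<close>-torsion.\<close>

lemma card_qmodz_primary_torsion:
  assumes p: "prime p" and m: "coprime m p" "m > 0"
  shows "card {\<epsilon> \<in> qmodz_primary p. qmodz_mult (p ^ a * m) \<epsilon> = 0} = p ^ a"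
proof -
  have pa: "p ^ a > 0" using p by (simp add: prime_gt_0_nat)
  have "{\<epsilon> \<in> qmodz_primary p. qmodz_mult (p ^ a * m) \<epsilon> = 0} = {\<epsilon>. qmodz_mult (p ^ a) \<epsilon> = 0}"
  proof (intro equalityI subsetI)
    fix \<epsilon> assume "\<epsilon> \<in> {\<epsilon> \<in> qmodz_primary p. qmodz_mult (p ^ a * m) \<epsilon> = 0}"
    then obtain k where k: "qmodz_mult (p ^ k) \<epsilon> = 0" "qmodz_mult (p ^ a * m) \<epsilon> = 0"
      by (auto simp: qmodz_primary_def)
    have "qmodz_mult (gcd (p ^ a * m) (p ^ k)) \<epsilon> = 0"
      by (rule qmodz_mult_gcd) (use k pa m in auto)
    moreover have "gcd (p ^ a * m) (p ^ k) dvd p ^ a"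
    proof -
      have "coprime m (gcd (p ^ a * m) (p ^ k))"
        using m(1) by (metis coprime_power_right_iff coprime_divisors dvd_refl gcd_dvd2)
      moreover have "gcd (p ^ a * m) (p ^ k) dvd p ^ a * m" by simp
      ultimately show ?thesis by (metis coprime_commute coprime_dvd_mult_left_iff)
    qed
    ultimately show "\<epsilon> \<in> {\<epsilon>. qmodz_mult (p ^ a) \<epsilon> = 0}" using qmodz_mult_dvd by blast
  next
    fix \<epsilon> assume "\<epsilon> \<in> {\<epsilon>. qmodz_mult (p ^ a) \<epsilon> = 0}"
    then show "\<epsilon> \<in> {\<epsilon> \<in> qmodz_primary p. qmodz_mult (p ^ a * m) \<epsilon> = 0}"
      using qmodz_mult_dvd[OF _ dvd_triv_left[of "p ^ a" m]] by (auto simp: qmodz_primary_def)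
  qed
  then show ?thesis using card_qmodz_torsion(2)[OF pa] by simp
qed

text \<open>Splitting each \<open>n\<close>-th root of \<open>\<gamma>\<close> into its prime-to-\<open>p\<close> and its \<open>p\<close>-primary part.\<close>

lemma qz_retract_rho:
  fixes p n :: nat
  assumes p: "prime p" and m: "coprime m p" "m > 0" and \<gamma>: "\<gamma> \<in> qmodz_prime_to p"
  shows "qz_retract p (qz_rho (p ^ a * m) (frag_of \<gamma>)) =
    of_nat (p ^ a) * (\<Sum>\<delta> | \<delta> \<in> qmodz_prime_to p \<and> qmodz_mult (p ^ a * m) \<delta> = \<gamma>. frag_of \<delta>)"
proof -
  let ?n = "p ^ a * m"
  let ?D = "{\<delta>. \<delta> \<in> qmodz_prime_to p \<and> qmodz_mult ?n \<delta> = \<gamma>}"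
  let ?T = "{\<epsilon> \<in> qmodz_primary p. qmodz_mult ?n \<epsilon> = 0}"
  have n: "?n > 0" using p m by (simp add: prime_gt_0_nat)
  have bij: "bij_betw (\<lambda>(\<delta>, \<epsilon>). \<delta> + \<epsilon>) (?D \<times> ?T) {\<gamma>'. qmodz_mult ?n \<gamma>' = \<gamma>}"
  proof (rule bij_betw_byWitness[where f' = "\<lambda>\<gamma>'. (qmodz_proj p \<gamma>', \<gamma>' - qmodz_proj p \<gamma>')"])
    show "\<forall>x\<in>?D \<times> ?T. (\<lambda>\<gamma>'. (qmodz_proj p \<gamma>', \<gamma>' - qmodz_proj p \<gamma>')) (case x of (\<delta>, \<epsilon>) \<Rightarrow> \<delta> + \<epsilon>) = x"
      using qmodz_proj(3)[OF p] by auto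
    show "(\<lambda>(\<delta>, \<epsilon>). \<delta> + \<epsilon>) ` (?D \<times> ?T) \<subseteq> {\<gamma>'. qmodz_mult ?n \<gamma>' = \<gamma>}"
      by (auto simp: qmodz_mult_add)
    show "(\<lambda>\<gamma>'. (qmodz_proj p \<gamma>', \<gamma>' - qmodz_proj p \<gamma>')) ` {\<gamma>'. qmodz_mult ?n \<gamma>' = \<gamma>} \<subseteq> ?D \<times> ?T"
    proof (rule image_subsetI)
      fix \<gamma>' assume "\<gamma>' \<in> {\<gamma>'. qmodz_mult ?n \<gamma>' = \<gamma>}"
      then have \<gamma>': "\<gamma> = qmodz_mult ?n \<gamma>'" by simp
      note pr = qmodz_proj(1,2)[OF p, of \<gamma>']
      have eq: "qmodz_mult ?n (\<gamma>' - qmodz_proj p \<gamma>') = \<gamma> - qmodz_mult ?n (qmodz_proj p \<gamma>')"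
        by (simp add: qmodz_mult_diff \<gamma>')
      \<comment> \<open>This element is prime-to-\<open>p\<close> as a difference of such elements,
        and \<open>p\<close>-primary as \<open>n\<close> times the primary part of
        \<open>\<gamma>'\<close>; hence it is 0, and the projection of an \<open>n\<close>-th root
        of \<open>\<gamma>\<close> is again one.\<close>
      have "\<gamma> - qmodz_mult ?n (qmodz_proj p \<gamma>') = 0"
        by (rule qmodz_prime_to_primary)
          (use qmodz_prime_to_diff[OF \<gamma> qmodz_mult_prime_to[OF pr(1)]] qmodz_mult_primary[OF pr(2), of ?n]
              eq in simp_all)
      then show "(qmodz_proj p \<gamma>', \<gamma>' - qmodz_proj p \<gamma>') \<in> ?D \<times> ?T"
        using pr eq by simp
    qed
  qed auto
  have "(\<Sum>\<gamma>' | qmodz_mult ?n \<gamma>' = \<gamma>. frag_of (qmodz_proj p \<gamma>')) =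
      (\<Sum>x\<in>?D \<times> ?T. frag_of (qmodz_proj p (case x of (\<delta>, \<epsilon>) \<Rightarrow> \<delta> + \<epsilon>)))"
    using sum.reindex_bij_betw[OF bij, of "\<lambda>\<gamma>'. frag_of (qmodz_proj p \<gamma>')"] by simp
  also have "\<dots> = (\<Sum>(\<delta>, \<epsilon>)\<in>?D \<times> ?T. frag_of \<delta>)"
    by (rule sum.cong) (use qmodz_proj(3)[OF p] in auto)
  also have "\<dots> = (\<Sum>\<delta>\<in>?D. of_nat (card ?T) * frag_of \<delta>)"
    by (simp add: sum.cartesian_product[symmetric])
  also have "\<dots> = of_nat (p ^ a) * (\<Sum>\<delta>\<in>?D. frag_of \<delta>)"
    by (simp only: card_qmodz_primary_torsion[OF p m] sum_distrib_left)
  finally show ?thesis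
    using finite_qmodz_fibre[OF n]
    by (simp add: qz_retract_def qz_rho_def frag_extend_sum)
qed

section \<open>Roots of \<open>X\<^sup>n - \<alpha>\<close> in characteristic \<open>p\<close>\<close>

lemma size_proots_alg_closed:
  fixes q :: "'k::alg_closed_field poly"
  assumes "q \<noteq> 0"
  shows "size (proots q) = degree q"
proof -
  obtain A where A: "size A = degree q" "q = Polynomial.smult (lead_coeff q) (\<Prod>x\<in>#A. [:-x, 1:])"
    using alg_closed_imp_factorization[OF assms] by blast
  have "proots (\<Prod>x\<in>#A. [:-x, 1:]) = A"
  proof (induction A)
    case (add x A)
    have nz: "(\<Prod>x\<in>#A. [:-x, 1:]) \<noteq> 0" by (auto simp: prod_mset_zero_iff)
    have "proots ([:-x, 1:] * (\<Prod>x\<in>#A. [:-x, 1:])) = proots [:-x, 1:] + proots (\<Prod>x\<in>#A. [:-x, 1:])"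
      by (rule proots_mult[OF _ nz]) simp
    also have "\<dots> = add_mset x A"
      unfolding proots_linear_factor add.IH by simp
    finally have "proots ([:-x, 1:] * (\<Prod>x\<in>#A. [:-x, 1:])) = add_mset x A" .
    then show ?case by (simp only: image_mset_add_mset prod_mset.add_mset)
  qed simp
  moreover have "proots q = proots (\<Prod>x\<in>#A. [:-x, 1:])"
  proof -
    have "lead_coeff q \<noteq> 0" using assms by simp
    from proots_smult[OF this] arg_cong[OF A(2), of proots] show ?thesis by simp
  qed
  ultimately show ?thesis using A(1) by simp
qed

lemma root_poly_simps:
  fixes \<beta> :: "'k::field"
  assumes "m > 0"
  shows "poly (monom 1 m - [:\<beta>:]) x = x ^ m - \<beta>" "degree (monom 1 m - [:\<beta>:]) = m" "monom 1 m - [:\<beta>:] \<noteq> 0"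
proof -
  show "poly (monom 1 m - [:\<beta>:]) x = x ^ m - \<beta>" by (simp add: poly_monom)
  show d: "degree (monom 1 m - [:\<beta>:]) = m"
    using degree_add_eq_left[of "- [:\<beta>:]" "monom 1 m"] assms
    by (simp only: diff_conv_add_uminus) (simp add: degree_monom_eq)
  with assms show "monom 1 m - [:\<beta>:] \<noteq> 0" by auto
qed

text \<open>A multiple root would be a root of the derivative \<open>m X^(m-1)\<close>, hence 0,
  which is no root as \<open>\<beta> \<noteq> 0\<close>. All roots being simple, their number is the
  degree.\<close>

lemma proots_separable_root_poly:
  fixes \<beta> :: "'k::alg_closed_field"
  assumes \<beta>: "\<beta> \<noteq> 0" and m: "of_nat m \<noteq> (0 :: 'k)"
  shows "proots (monom 1 m - [:\<beta>:]) = mset_set {x. x ^ m = \<beta>}" "card {x. x ^ m = \<beta>} = m"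
    "finite {x. x ^ m = \<beta>}"
proof -
  have m0: "m > 0" using m by (auto intro: gr0I)
  let ?q = "monom 1 m - [:\<beta>:]"
  note q = root_poly_simps[OF m0, of \<beta>]
  have roots: "{x. x ^ m = \<beta>} = {x. poly ?q x = 0}" using q(1) by auto
  show fin: "finite {x. x ^ m = \<beta>}" unfolding roots by (rule poly_roots_finite[OF q(3)])
  have ord: "order x ?q \<le> 1" for x
  proof (rule ccontr)
    assume "\<not> order x ?q \<le> 1"
    then have "[:- x, 1:] ^ 2 dvd ?q"
      by (metis le_imp_power_dvd dvd_trans order_1 not_less_eq_eq numeral_2_eq_2 One_nat_def)
    then obtain r where r: "?q = [:- x, 1:] * ([:- x, 1:] * r)"
      by (elim dvdE) (simp only: power2_eq_square mult.assoc)
    have "poly (pderiv ?q) x = 0" unfolding r pderiv_mult by simp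
    moreover have "poly (pderiv ?q) x = of_nat m * x ^ (m - 1)"
      by (simp add: pderiv_diff pderiv_monom poly_monom)
    ultimately have "x = 0" using m by auto
    moreover have "poly ?q x = 0" unfolding r by simp
    ultimately show False using q(1)[of x] \<beta> m0 by (simp add: zero_power)
  qed
  show pr: "proots ?q = mset_set {x. x ^ m = \<beta>}"
  proof (rule multiset_eqI)
    fix x
    have "count (proots ?q) x = order x ?q" using q(3) by simp
    also have "\<dots> = (if x ^ m = \<beta> then 1 else 0)"
      using ord[of x] order_root[of ?q x] q(1)[of x] q(3) by (auto simp: le_Suc_eq)
    finally show "count (proots ?q) x = count (mset_set {x. x ^ m = \<beta>}) x"
      using fin by simp
  qed
  show "card {x. x ^ m = \<beta>} = m"
    using size_proots_alg_closed[OF q(3)] unfolding pr q(2) by simp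
qed

text \<open>Iterated Frobenius is additive, so the difference \<open>x - y\<close> has a vanishing
  power.\<close>

lemma inj_power_CHAR:
  fixes x y :: "'k::field"
  assumes p: "prime CHAR('k)" and eq: "x ^ (CHAR('k) ^ a) = y ^ (CHAR('k) ^ a)"
  shows "x = y"
proof -
  have "((x - y) + y) ^ (CHAR('k) ^ a) = (x - y) ^ (CHAR('k) ^ a) + y ^ (CHAR('k) ^ a)"
    by (rule freshmans_dream'[OF p refl])
  with eq have "(x - y) ^ (CHAR('k) ^ a) = 0" by simp
  then show ?thesis by simp
qed

text \<open>Choosing \<open>\<beta>\<close> with \<open>\<beta> ^ (p^a) = \<alpha>\<close>, the
  polynomial \<open>X^(p^a m) - \<alpha>\<close> is the \<open>p^a\<close>-th power of the separable
  \<open>X^m - \<beta>\<close>, and injectivity of iterated Frobenius shows that both have the same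
  roots.\<close>

lemma proots_root_poly:
  fixes \<alpha> :: "'k::alg_closed_field"
  assumes p: "prime CHAR('k)" and \<alpha>: "\<alpha> \<noteq> 0" and m: "coprime m CHAR('k)"
  shows "proots (monom 1 (CHAR('k) ^ a * m) - [:\<alpha>:]) = repeat_mset (CHAR('k) ^ a) (mset_set {x. x ^ (CHAR('k)
      ^ a * m) = \<alpha>})"
    and "finite {x :: 'k. x ^ (CHAR('k) ^ a * m) = \<alpha>}"
proof -
  let ?P = "CHAR('k) ^ a"
  have P: "?P > 0" using p by (simp add: prime_gt_0_nat)
  obtain \<beta> where \<beta>: "\<beta> ^ ?P = \<alpha>" using nth_root_exists[OF P] by blast
  then have \<beta>0: "\<beta> \<noteq> 0" using \<alpha> P by auto
  have m0: "of_nat m \<noteq> (0 :: 'k)"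
    using p m by (metis of_nat_eq_0_iff_char_dvd coprime_absorb_right coprime_commute not_prime_unit)
  have "(monom 1 m - [:\<beta>:]) ^ ?P = monom 1 (?P * m) - [:\<alpha>:]"
  proof -
    \<comment> \<open>The additive law is applied to the sum
      \<open>(X^m - \<beta>) + \<beta>\<close> and solved for the power of the difference, which
      avoids a sign \<open>(-1)^(p^a)\<close>.\<close>
    have "((monom 1 m - [:\<beta>:]) + [:\<beta>:]) ^ ?P = (monom 1 m - [:\<beta>:]) ^ ?P + [:\<beta>:] ^ ?P"
      by (rule freshmans_dream') (use p in simp_all)
    moreover have "[:\<beta>:] ^ ?P = [:\<alpha>:]" using \<beta> by (simp add: poly_const_pow)
    moreover have "monom (1::'k) m ^ ?P = monom 1 (?P * m)"
      by (simp add: monom_power mult.commute)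
    ultimately show ?thesis by (simp add: algebra_simps)
  qed
  moreover have "{x. x ^ m = \<beta>} = {x. x ^ (?P * m) = \<alpha>}"
    using inj_power_CHAR[OF p] \<beta> by (auto simp: power_mult mult.commute[of _ m])
  ultimately show "proots (monom 1 (?P * m) - [:\<alpha>:]) = repeat_mset ?P (mset_set {x. x ^ (?P * m) = \<alpha>})"
    and "finite {x :: 'k. x ^ (?P * m) = \<alpha>}"
    using proots_separable_root_poly(1,3)[OF \<beta>0 m0] proots_power[of "monom 1 m - [:\<beta>:]" ?P] by simp_all
qed

text \<open>The function \<open>\<sigma>\<close> is total on the field but only its values on units
  are constrained, so 0 is excluded explicitly throughout.\<close>

locale qmodz_embedding =
  fixes \<sigma> :: "'k::alg_closed_field \<Rightarrow> qmodz"
  assumes prime_CHAR: "prime CHAR('k)"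
    and \<sigma>_mult: "\<And>\<alpha> \<beta>. \<alpha> \<noteq> 0 \<Longrightarrow> \<beta> \<noteq> 0 \<Longrightarrow> \<sigma> (\<alpha> * \<beta>) = \<sigma> \<alpha> + \<sigma> \<beta>"
    and \<sigma>_inj: "inj_on \<sigma> {\<alpha>. \<alpha> \<noteq> 0}"
begin

lemma \<sigma>_one: "\<sigma> 1 = 0"
  using \<sigma>_mult[of 1 1] by simp

lemma \<sigma>_power: "\<alpha> \<noteq> 0 \<Longrightarrow> \<sigma> (\<alpha> ^ n) = qmodz_mult n (\<sigma> \<alpha>)"
proof (induction n)
  case (Suc n)
  then show ?case
    using \<sigma>_mult[of \<alpha> "\<alpha> ^ n"] qmodz_mult_add_left[of "Suc 0" n "\<sigma> \<alpha>"] by simp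
qed (simp add: \<sigma>_one)

lemma \<sigma>_eq_iff: "\<alpha> \<noteq> 0 \<Longrightarrow> \<beta> \<noteq> 0 \<Longrightarrow> \<sigma> \<alpha> = \<sigma> \<beta> \<longleftrightarrow> \<alpha> = \<beta>"
  using \<sigma>_inj by (auto simp: inj_on_def)

lemma \<sigma>_prime_to:
  assumes "\<alpha> \<noteq> 0"
  shows "\<sigma> \<alpha> \<in> qmodz_prime_to CHAR('k)"
proof -
  obtain N where N: "N > 0" "qmodz_mult N (\<sigma> \<alpha>) = 0" by (rule qmodz_torsion)
  obtain a m where m: "N = CHAR('k) ^ a * m" "coprime m CHAR('k)" "m > 0"
    using prime_power_coprime_decomp[OF prime_CHAR N(1)] by blast
  have "\<sigma> (\<alpha> ^ N) = \<sigma> 1" using N \<sigma>_power[OF assms] by (simp add: \<sigma>_one)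
  then have "\<alpha> ^ N = 1" using \<sigma>_eq_iff assms by simp
  then have "(\<alpha> ^ m) ^ (CHAR('k) ^ a) = 1 ^ (CHAR('k) ^ a)"
    by (simp add: m(1) mult.commute flip: power_mult)
  then have "\<alpha> ^ m = 1" by (rule inj_power_CHAR[OF prime_CHAR])
  then have "qmodz_mult m (\<sigma> \<alpha>) = 0" using \<sigma>_power[OF assms, of m] by (simp add: \<sigma>_one)
  with m show ?thesis by (auto simp: qmodz_prime_to_iff)
qed

text \<open>For \<open>b\<close> prime to the characteristic, the \<open>b\<close>-th roots of unity and the \<open>b\<close>-torsion
  of \<open>\<rat>/\<int>\<close> both have \<open>b\<close> elements, so the embedding is onto.\<close>

lemma \<sigma>_surj:
  assumes "\<delta> \<in> qmodz_prime_to CHAR('k)"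
  obtains \<alpha> where "\<alpha> \<noteq> 0" "\<sigma> \<alpha> = \<delta>"
proof -
  obtain b where b: "b > 0" "coprime b CHAR('k)" "qmodz_mult b \<delta> = 0"
    using assms by (auto simp: qmodz_prime_to_iff)
  have b0: "of_nat b \<noteq> (0 :: 'k)"
    using prime_CHAR b(2) by (metis of_nat_eq_0_iff_char_dvd coprime_absorb_right coprime_commute
        not_prime_unit)
  let ?U = "{x :: 'k. x ^ b = 1}"
  note U = proots_separable_root_poly(2,3)[OF one_neq_zero b0]
  have nz: "x \<noteq> 0" if "x \<in> ?U" for x
    using that b(1) by (auto simp: zero_power)
  have "\<sigma> ` ?U = {\<gamma>. qmodz_mult b \<gamma> = 0}"
  proof (rule card_subset_eq[OF card_qmodz_torsion(1)[OF b(1)]])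
    show "\<sigma> ` ?U \<subseteq> {\<gamma>. qmodz_mult b \<gamma> = 0}"
    proof (rule image_subsetI)
      fix x assume x: "x \<in> ?U"
      then have "\<sigma> (x ^ b) = 0" using \<sigma>_one by simp
      then show "\<sigma> x \<in> {\<gamma>. qmodz_mult b \<gamma> = 0}" using \<sigma>_power[OF nz[OF x]] by simp
    qed
    have "inj_on \<sigma> ?U" by (rule inj_on_subset[OF \<sigma>_inj]) (use nz in blast)
    then show "card (\<sigma> ` ?U) = card {\<gamma>. qmodz_mult b \<gamma> = 0}"
      using card_qmodz_torsion(2)[OF b(1)] U(1) by (simp add: card_image)
  qed
  with b(3) have "\<delta> \<in> \<sigma> ` ?U" by simp
  then obtain x where "x \<in> ?U" "\<sigma> x = \<delta>" by (elim imageE) simp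
  with nz that show thesis by metis
qed

lemma sum_proots_root_poly:
  assumes \<alpha>: "\<alpha> \<noteq> 0" and n: "n > 0"
  shows "(\<Sum>x\<in>#proots (monom 1 n - [:\<alpha>:]). frag_of (\<sigma> x)) = qz_retract CHAR('k) (qz_rho n (frag_of (\<sigma> \<alpha>)))"
proof -
  obtain a m where m: "n = CHAR('k) ^ a * m" "coprime m CHAR('k)" "m > 0"
    using prime_power_coprime_decomp[OF prime_CHAR n] by blast
  note pr = proots_root_poly[OF prime_CHAR \<alpha> m(2), of a, folded m(1)]
  let ?D = "{\<delta>. \<delta> \<in> qmodz_prime_to CHAR('k) \<and> qmodz_mult n \<delta> = \<sigma> \<alpha>}"
  have nz: "x \<noteq> 0" if "x ^ n = \<alpha>" for x using that \<alpha> n by auto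
  have bij: "bij_betw \<sigma> {x. x ^ n = \<alpha>} ?D"
    unfolding bij_betw_def
  proof
    show "inj_on \<sigma> {x. x ^ n = \<alpha>}" by (rule inj_on_subset[OF \<sigma>_inj]) (use nz in blast)
    show "\<sigma> ` {x. x ^ n = \<alpha>} = ?D"
    proof (intro equalityI subsetI)
      fix \<delta> assume "\<delta> \<in> \<sigma> ` {x. x ^ n = \<alpha>}"
      then show "\<delta> \<in> ?D" using \<sigma>_prime_to \<sigma>_power nz by auto
    next
      fix \<delta> assume \<delta>: "\<delta> \<in> ?D"
      \<comment> \<open>Surjectivity of \<open>\<sigma>\<close> onto the prime-to-\<open>p\<close>
        part supplies a candidate root \<open>x\<close>; that its \<open>n\<close>-th power is
        \<open>\<alpha>\<close> follows from injectivity of \<open>\<sigma>\<close>.\<close>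
      then obtain x where x: "x \<noteq> 0" "\<sigma> x = \<delta>" using \<sigma>_surj by blast
      then have "\<sigma> (x ^ n) = \<sigma> \<alpha>" using \<sigma>_power \<delta> by simp
      then have "x ^ n = \<alpha>" using \<sigma>_eq_iff x \<alpha> by simp
      with x show "\<delta> \<in> \<sigma> ` {x. x ^ n = \<alpha>}" by blast
    qed
  qed
  have rep: "(\<Sum>x\<in>#repeat_mset k M. f x) = of_nat k * (\<Sum>x\<in>#M. f x)" for k and M :: "'k multiset" and f ::
      "'k \<Rightarrow> qz_ring"
  proof (induction k)
    case (Suc k)
    have "repeat_mset (Suc k) M = M + repeat_mset k M" by simp
    then have "(\<Sum>x\<in>#repeat_mset (Suc k) M. f x) = (\<Sum>x\<in>#M. f x) + (\<Sum>x\<in>#repeat_mset k M. f x)"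
      by (simp only: image_mset_union sum_mset.union)
    also have "\<dots> = of_nat (Suc k) * (\<Sum>x\<in>#M. f x)"
      unfolding Suc.IH of_nat_Suc distrib_right mult_1 ..
    finally show ?case .
  qed simp
  have "(\<Sum>x\<in>#proots (monom 1 n - [:\<alpha>:]). frag_of (\<sigma> x)) = of_nat (CHAR('k) ^ a) * (\<Sum>x | x ^ n =
      \<alpha>. frag_of (\<sigma> x))"
    unfolding pr(1) rep by (simp add: sum_unfold_sum_mset)
  also have "(\<Sum>x | x ^ n = \<alpha>. frag_of (\<sigma> x)) = (\<Sum>\<delta>\<in>?D. frag_of \<delta>)"
    by (rule sum.reindex_bij_betw[OF bij])
  finally show ?thesis
    using qz_retract_rho[OF prime_CHAR m(2,3) \<sigma>_prime_to[OF \<alpha>], of a] by (simp add: m(1))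
qed

end

section \<open>Frobenius and Verschiebung\<close>

definition frob_endo :: "nat \<Rightarrow> ('k, 'b) endo \<Rightarrow> ('k, 'b) endo" where
  "frob_endo n E = (fst E, snd E ^^ n)"

definition ver_endo :: "nat \<Rightarrow> ('k, 'b) endo \<Rightarrow> ('k, nat \<Rightarrow> 'b) endo" where
  "ver_endo n E = (power_module n (fst E), Verschiebung_map n (snd E))"

lemma frob_endo_End_obj:
  fixes E :: "('k::field, 'b) endo"
  assumes E: "E \<in> End_obj type_ring"
  shows "frob_endo n E \<in> End_obj type_ring"
proof -
  have fp: "finite_projective type_ring (fst E)" using E by (auto simp: End_obj_def)
  have "snd E ^^ n \<in> module_hom type_ring (fst E) (fst E)"
  proof (induction n)
    case 0
    show ?case by (rule module_homI) simp_all
  next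
    case (Suc n)
    then show ?case using module_hom_comp[OF Suc.IH End_objD(2)[OF E]] by (simp only: funpow.simps)
  qed
  with fp show ?thesis by (simp add: frob_endo_def End_obj_def)
qed

lemma frob_endo_hom:
  assumes h: "h \<in> End_hom R E D" and f: "snd E \<in> module_hom R (fst E) (fst E)"
  shows "h \<in> End_hom R (frob_endo n E) (frob_endo n D)"
proof (rule End_homI)
  show "h \<in> module_hom R (fst (frob_endo n E)) (fst (frob_endo n D))"
    using End_homD(1)[OF h] by (simp add: frob_endo_def)
  show "h (snd (frob_endo n E) x) = snd (frob_endo n D) (h x)" if "x \<in> carrier (fst (frob_endo n E))" for x
    using End_hom_funpow(1)[OF h f] that by (simp add: frob_endo_def)
qed

lemma frob_endo_exact:
  assumes E: "E' \<in> End_obj (type_ring :: 'k::field ring)" "E \<in> End_obj type_ring" and exact: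
      "End_exact type_ring E' E E''"
  shows "End_exact type_ring (frob_endo n E') (frob_endo n E) (frob_endo n E'')"
proof -
  obtain i q where "i \<in> End_hom type_ring E' E" "q \<in> End_hom type_ring E E''"
    "inj_on i (carrier (fst E'))" "q ` carrier (fst E) = carrier (fst E'')"
    "{x \<in> carrier (fst E). q x = \<zero>\<^bsub>fst E''\<^esub>} = i ` carrier (fst E')"
    using exact unfolding End_exact_def by blast
  then show ?thesis
    unfolding End_exact_def
    by (intro bexI[of _ i] bexI[of _ q] conjI)
      (use frob_endo_hom End_objD(2)[OF E(1)] End_objD(2)[OF E(2)] in \<open>simp_all add: frob_endo_def\<close>)
qed

lemma frob_endo_line:
  assumes rep: "mat_rep E 1 (mat 1 1 (\<lambda>_. \<alpha>)) \<Phi>"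
  shows "mat_rep (frob_endo n E) 1 (mat 1 1 (\<lambda>_. \<alpha> ^ n)) \<Phi>"
proof -
  note r = mat_repD[OF rep]
  have "(snd E ^^ n) (\<Phi> v) = \<Phi> (mat 1 1 (\<lambda>_. \<alpha> ^ n) *\<^sub>v v)" if v: "v \<in> carrier_vec 1" for v
  proof -
    have "mat 1 1 (\<lambda>_. \<alpha> ^ n) *\<^sub>v v = \<alpha> ^ n \<cdot>\<^sub>v v"
      using v by (auto simp: scalar_prod_def)
    then show ?thesis
      using mat_rep_line_funpow[OF rep v] coordD(3)[OF r(2) v] by simp
  qed
  with r show ?thesis by (simp add: mat_rep_def frob_endo_def)
qed

section \<open>The Verschiebung on powers of a module\<close>

lemma module_power_module:
  fixes M :: "('k::field, 'b) module"
  assumes M: "module type_ring M"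
  shows "module type_ring (power_module n M)"
proof -
  interpret module "type_ring :: 'k ring" M by (rule M)
  have sm: "c \<odot>\<^bsub>M\<^esub> x \<in> carrier M" if "x \<in> carrier M" for c x using smult_closed[OF _ that] by simp
  let ?P = "power_module n M"
  show ?thesis
  proof (rule module_criteria)
    show "cring (type_ring :: 'k ring)" by (rule cring_from_type_algebra)
    show "\<forall>v\<in>carrier ?P. \<exists>neg_v\<in>carrier ?P. v \<oplus>\<^bsub>?P\<^esub> neg_v = \<zero>\<^bsub>?P\<^esub>"
    proof
      fix v assume "v \<in> carrier ?P"
      then show "\<exists>neg_v\<in>carrier ?P. v \<oplus>\<^bsub>?P\<^esub> neg_v = \<zero>\<^bsub>?P\<^esub>"
        by (intro bexI[of _ "\<lambda>j\<in>{1..n}. \<ominus>\<^bsub>M\<^esub> v j"]) (auto simp: power_module_def PiE_iff M.r_neg intro!: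
            restrict_ext)
    qed
    show "\<forall>v\<in>carrier ?P. v \<oplus>\<^bsub>?P\<^esub> \<zero>\<^bsub>?P\<^esub> = v"
    proof
      fix v assume v: "v \<in> carrier ?P"
      show "v \<oplus>\<^bsub>?P\<^esub> \<zero>\<^bsub>?P\<^esub> = v"
        by (rule PiE_ext[where k = "{1..n}" and s = "\<lambda>_. carrier M"]) (use v in \<open>auto simp: power_module_def
            PiE_iff\<close>)
    qed
    show "\<forall>v\<in>carrier ?P. \<one>\<^bsub>type_ring\<^esub> \<odot>\<^bsub>?P\<^esub> v = v"
    proof
      fix v assume v: "v \<in> carrier ?P"
      show "\<one>\<^bsub>type_ring\<^esub> \<odot>\<^bsub>?P\<^esub> v = v"
        by (rule PiE_ext[where k = "{1..n}" and s = "\<lambda>_. carrier M"]) (use v smult_one in \<open>auto simp: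
            power_module_def PiE_iff sm\<close>)
    qed
  qed (auto simp: power_module_def PiE_iff sm M.a_ac smult_r_distr smult_l_distr smult_assoc1
      simp flip: smult_assoc1[simplified] intro!: restrict_ext smult_l_distr[simplified]
          smult_assoc1[simplified])
qed

text \<open>A vector of length \<open>n * d\<close> is cut into \<open>n\<close> blocks of length
  \<open>d\<close>. Components of \<open>power_module\<close> are numbered from 1 and vector entries
  from 0, so block \<open>j\<close> starts at entry \<open>(j - 1) * d\<close>.\<close>

definition power_coord :: "nat \<Rightarrow> nat \<Rightarrow> ('k vec \<Rightarrow> 'b) \<Rightarrow> 'k vec \<Rightarrow> nat \<Rightarrow> 'b" where
  "power_coord n d \<Phi> v = (\<lambda>j\<in>{1..n}. \<Phi> (vec d (\<lambda>i. v $ ((j - 1) * d + i))))"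

lemma block_index_less: "j \<in> {1..n} \<Longrightarrow> i < d \<Longrightarrow> (j - 1) * d + i < n * (d::nat)"
proof -
  assume j: "j \<in> {1..n}" and i: "i < d"
  have "(j - 1) * d + i < Suc (j - 1) * d" using i by simp
  also have "\<dots> \<le> n * d" using j by (intro mult_le_mono1) auto
  finally show ?thesis .
qed

lemma coord_power_module:
  fixes M :: "('k::field, 'b) module"
  assumes \<Phi>: "coord M d \<Phi>"
  shows "coord (power_module n M) (n * d) (power_coord n d \<Phi>)"
\<comment> \<open>The inverse: entry \<open>k\<close> lies in block \<open>Suc (k div d)\<close>, at
  position \<open>k mod d\<close>.\<close>
proof (rule coordI[where \<Psi> = "\<lambda>\<xi>. vec (n * d) (\<lambda>k. inv_into (carrier_vec d) \<Phi> (\<xi> (Suc (k div d))) $ (k mod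
    d))"])
  note co = coordD[OF \<Phi>] and inv = coord_inv(2-4)[OF \<Phi>]
  let ?b = "\<lambda>v j. vec d (\<lambda>i. v $ ((j - 1) * d + i)) :: 'k vec"
  show "power_coord n d \<Phi> \<in> module_hom type_ring (vec_mod (n * d)) (power_module n M)"
  proof (rule module_homI)
    show "power_coord n d \<Phi> v \<in> carrier (power_module n M)" for v
      using co(1) by (auto simp: power_coord_def power_module_def)
    fix v w assume vw: "v \<in> carrier (vec_mod (n * d) :: ('k, 'k vec) module)"
        "w \<in> carrier (vec_mod (n * d) :: ('k, 'k vec) module)"
    have "?b (v + w) j = ?b v j + ?b w j" if "j \<in> {1..n}" for j
      using vw block_index_less[OF that] by (auto simp: module_vec_simps)
    then show "power_coord n d \<Phi> (v \<oplus>\<^bsub>vec_mod (n * d)\<^esub> w) =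
        power_coord n d \<Phi> v \<oplus>\<^bsub>power_module n M\<^esub> power_coord n d \<Phi> w"
      using co(2) by (auto simp: power_coord_def power_module_def module_vec_simps intro!: restrict_ext)
  next
    fix c v assume v: "v \<in> carrier (vec_mod (n * d) :: ('k, 'k vec) module)"
    have "?b (c \<cdot>\<^sub>v v) j = c \<cdot>\<^sub>v ?b v j" if "j \<in> {1..n}" for j
      using v block_index_less[OF that] by (auto simp: module_vec_simps)
    then show "power_coord n d \<Phi> (c \<odot>\<^bsub>vec_mod (n * d)\<^esub> v) = c \<odot>\<^bsub>power_module n M\<^esub> power_coord n d \<Phi> v"
      using co(3) by (auto simp: power_coord_def power_module_def module_vec_simps intro!: restrict_ext)
  qed
  fix \<xi> assume \<xi>: "\<xi> \<in> carrier (power_module n M)"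
  let ?v = "vec (n * d) (\<lambda>k. inv_into (carrier_vec d) \<Phi> (\<xi> (Suc (k div d))) $ (k mod d))"
  show "?v \<in> carrier_vec (n * d)" by simp
  have \<xi>j: "\<xi> j \<in> carrier M" if "j \<in> {1..n}" for j using \<xi> that by (auto simp: power_module_def)
  show "power_coord n d \<Phi> ?v = \<xi>"
  proof (rule PiE_ext[where k = "{1..n}" and s = "\<lambda>_. carrier M"])
    show "power_coord n d \<Phi> ?v \<in> {1..n} \<rightarrow>\<^sub>E carrier M" using co(1) by (auto simp: power_coord_def)
    show "\<xi> \<in> {1..n} \<rightarrow>\<^sub>E carrier M" using \<xi> by (simp add: power_module_def)
    fix j assume j: "j \<in> {1..n}"
    have "?b ?v j = inv_into (carrier_vec d) \<Phi> (\<xi> j)"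
    proof (rule eq_vecI)
      fix i assume "i < dim_vec (inv_into (carrier_vec d) \<Phi> (\<xi> j))"
      then have i: "i < d" using carrier_vecD[OF inv(1)[OF \<xi>j[OF j]]] by simp
      have "((j - 1) * d + i) div d = j - 1" "((j - 1) * d + i) mod d = i" "Suc (j - 1) = j" using i j by auto
      then show "?b ?v j $ i = inv_into (carrier_vec d) \<Phi> (\<xi> j) $ i"
        using i block_index_less[OF j i] by simp
    qed (use carrier_vecD[OF inv(1)[OF \<xi>j[OF j]]] in simp)
    then show "power_coord n d \<Phi> ?v j = \<xi> j"
      using j inv(2)[OF \<xi>j[OF j]] by (simp add: power_coord_def)
  qed
next
  note inv = coord_inv(2-4)[OF \<Phi>]
  fix v :: "'k vec" assume v: "v \<in> carrier_vec (n * d)"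
  show "vec (n * d) (\<lambda>k. inv_into (carrier_vec d) \<Phi> (power_coord n d \<Phi> v (Suc (k div d))) $ (k mod d)) = v"
  proof (rule eq_vecI)
    fix k assume "k < dim_vec v"
    then have k: "k < n * d" using v by simp
    then have d: "d > 0" and "k div d < n" by (auto simp: less_mult_imp_div_less intro: gr0I)
    then have "Suc (k div d) \<in> {1..n}" "k mod d < d" by auto
    then show "vec (n * d) (\<lambda>k. inv_into (carrier_vec d) \<Phi> (power_coord n d \<Phi> v (Suc (k div d))) $ (k mod d))
        $ k = v $ k"
      using k inv(3) by (simp add: power_coord_def)
  qed (use v in simp)
qed

lemma Verschiebung_hom:
  assumes "module R M" "f \<in> module_hom R M M"
  shows "Verschiebung_map n f \<in> module_hom R (power_module n M) (power_module n M)"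
proof -
  have "j \<in> {1..n} \<Longrightarrow> j \<noteq> 1 \<Longrightarrow> j - 1 \<in> {1..n}" "j \<in> {1..n} \<Longrightarrow> n \<in> {1..n}" for j by auto
  then show ?thesis
    using module_homD[OF assms(2)]
    by (intro module_homI) (auto simp: Verschiebung_map_def power_module_def PiE_iff intro!: restrict_ext)
qed

lemma ver_endo_End_obj:
  fixes E :: "('k::field, 'b) endo"
  assumes E: "E \<in> End_obj type_ring"
  shows "ver_endo n E \<in> End_obj type_ring"
proof -
  obtain d \<Phi> where "coord (fst E) d \<Phi>"
    using E by (auto simp: End_obj_def finite_projective_iff_coord)
  then have "finite_projective type_ring (power_module n (fst E))"
    unfolding finite_projective_iff_coord
    using module_power_module[OF End_objD(1)[OF E]] coord_power_module by blast
  then show ?thesis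
    using Verschiebung_hom[OF End_objD[OF E]] by (simp add: ver_endo_def End_obj_def)
qed

lemma ver_endo_hom:
  assumes h: "h \<in> End_hom R E D"
  shows "(\<lambda>\<xi>. \<lambda>j\<in>{1..n}. h (\<xi> j)) \<in> End_hom R (ver_endo n E) (ver_endo n D)"
proof -
  have "j \<in> {1..n} \<Longrightarrow> j \<noteq> 1 \<Longrightarrow> j - 1 \<in> {1..n}" "j \<in> {1..n} \<Longrightarrow> n \<in> {1..n}" for j by auto
  then show ?thesis
    using End_homD[OF h] module_homD[OF End_homD(1)[OF h]]
    by (intro End_homI module_homI)
      (auto simp: ver_endo_def Verschiebung_map_def power_module_def PiE_iff intro!: restrict_ext)
qed

lemma carrier_ver_endo: "carrier (fst (ver_endo n E)) = {1..n} \<rightarrow>\<^sub>E carrier (fst E)"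
  by (simp add: ver_endo_def power_module_def)

text \<open>Exactness of a power is checked in each component; preimages are chosen componentwise
  and cut off outside the index set so as to lie in the carrier.\<close>

lemma ver_endo_exact:
  assumes exact: "End_exact R E' E E''"
  shows "End_exact R (ver_endo n E') (ver_endo n E) (ver_endo n E'')"
proof -
  obtain i q where iq: "i \<in> End_hom R E' E" "q \<in> End_hom R E E''"
    "inj_on i (carrier (fst E'))" "q ` carrier (fst E) = carrier (fst E'')"
    "{x \<in> carrier (fst E). q x = \<zero>\<^bsub>fst E''\<^esub>} = i ` carrier (fst E')"
    using exact unfolding End_exact_def by blast
  let ?i = "\<lambda>\<xi>. \<lambda>j\<in>{1..n}. i (\<xi> j)" and ?q = "\<lambda>\<xi>. \<lambda>j\<in>{1..n}. q (\<xi> j)"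
  note c = carrier_ver_endo
  have "inj_on ?i (carrier (fst (ver_endo n E')))"
  proof (rule inj_onI)
    fix \<xi> \<eta> assume \<xi>\<eta>: "\<xi> \<in> carrier (fst (ver_endo n E'))" "\<eta> \<in> carrier (fst (ver_endo n E'))" "?i \<xi> = ?i \<eta>"
    show "\<xi> = \<eta>"
    proof (rule PiE_ext[where k = "{1..n}" and s = "\<lambda>_. carrier (fst E')"])
      fix j assume j: "j \<in> {1..n}"
      have "i (\<xi> j) = i (\<eta> j)" using fun_cong[OF \<xi>\<eta>(3), of j] j by simp
      then show "\<xi> j = \<eta> j" using \<xi>\<eta> j iq(3) unfolding c by (meson PiE_mem inj_onD)
    qed (use \<xi>\<eta>(1,2) in \<open>simp_all only: c\<close>)
  qed
  moreover have "?q ` carrier (fst (ver_endo n E)) = carrier (fst (ver_endo n E''))"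
  proof
    show "?q ` carrier (fst (ver_endo n E)) \<subseteq> carrier (fst (ver_endo n E''))"
      using iq(4) unfolding c by (auto simp: PiE_iff)
    show "carrier (fst (ver_endo n E'')) \<subseteq> ?q ` carrier (fst (ver_endo n E))"
    proof
      fix \<eta> assume \<eta>: "\<eta> \<in> carrier (fst (ver_endo n E''))"
      define \<xi> where "\<xi> = (\<lambda>j\<in>{1..n}. inv_into (carrier (fst E)) q (\<eta> j))"
      have e: "\<eta> j \<in> q ` carrier (fst E)" if "j \<in> {1..n}" for j using \<eta> that iq(4) unfolding c by auto
      have "?q \<xi> = \<eta>"
        by (rule PiE_ext[where k = "{1..n}" and s = "\<lambda>_. carrier (fst E'')"])
          (use \<eta>[unfolded c] e in \<open>auto simp: \<xi>_def f_inv_into_f PiE_iff\<close>)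
      moreover have "\<xi> \<in> carrier (fst (ver_endo n E))"
        unfolding c using e by (auto simp: \<xi>_def intro: inv_into_into)
      ultimately show "\<eta> \<in> ?q ` carrier (fst (ver_endo n E))" by blast
    qed
  qed
  moreover have "{\<xi> \<in> carrier (fst (ver_endo n E)). ?q \<xi> = \<zero>\<^bsub>fst (ver_endo n E'')\<^esub>} =
      ?i ` carrier (fst (ver_endo n E'))"
  proof (intro equalityI subsetI)
    fix \<xi> assume "\<xi> \<in> {\<xi> \<in> carrier (fst (ver_endo n E)). ?q \<xi> = \<zero>\<^bsub>fst (ver_endo n E'')\<^esub>}"
    then have \<xi>: "\<xi> \<in> {1..n} \<rightarrow>\<^sub>E carrier (fst E)" "?q \<xi> = (\<lambda>j\<in>{1..n}. \<zero>\<^bsub>fst E''\<^esub>)"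
      unfolding c by (auto simp: ver_endo_def power_module_def)
    have "q (\<xi> j) = \<zero>\<^bsub>fst E''\<^esub>" if "j \<in> {1..n}" for j using fun_cong[OF \<xi>(2), of j] that by simp
    then have e: "\<xi> j \<in> i ` carrier (fst E')" if "j \<in> {1..n}" for j using \<xi>(1) that iq(5) by blast
    define \<eta> where "\<eta> = (\<lambda>j\<in>{1..n}. inv_into (carrier (fst E')) i (\<xi> j))"
    have "?i \<eta> = \<xi>"
      by (rule PiE_ext[where k = "{1..n}" and s = "\<lambda>_. carrier (fst E)"])
        (use \<xi>(1) e iq(5) in \<open>auto simp: \<eta>_def f_inv_into_f\<close>)
    moreover have "\<eta> \<in> carrier (fst (ver_endo n E'))"
      unfolding c using e by (auto simp: \<eta>_def intro: inv_into_into)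
    ultimately show "\<xi> \<in> ?i ` carrier (fst (ver_endo n E'))" by blast
  next
    fix \<xi> assume "\<xi> \<in> ?i ` carrier (fst (ver_endo n E'))"
    then obtain \<eta> where \<eta>: "\<eta> \<in> {1..n} \<rightarrow>\<^sub>E carrier (fst E')" "\<xi> = ?i \<eta>" unfolding c by blast
    have "i (\<eta> j) \<in> {x \<in> carrier (fst E). q x = \<zero>\<^bsub>fst E''\<^esub>}" if "j \<in> {1..n}" for j
      using \<eta>(1) that iq(5) by blast
    then show "\<xi> \<in> {\<xi> \<in> carrier (fst (ver_endo n E)). ?q \<xi> = \<zero>\<^bsub>fst (ver_endo n E'')\<^esub>}"
      unfolding c \<eta>(2) by (auto simp: ver_endo_def power_module_def intro!: restrict_ext)
  qed
  ultimately show ?thesis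
    using ver_endo_hom[OF iq(1)] ver_endo_hom[OF iq(2)] unfolding End_exact_def by blast
qed

text \<open>With \<open>f = 0\<close> the map is a shift that inserts 0 in front, so after
  \<open>k\<close> steps the first \<open>k\<close> components vanish. This is what makes V_n
  respect the ideal of the pairs \<open>(M, 0)\<close>.\<close>

lemma Verschiebung_zero_nilpotent:
  fixes M :: "('k::field, 'b) module"
  assumes M: "module type_ring M" and \<xi>: "\<xi> \<in> carrier (power_module n M)"
  shows "(Verschiebung_map n (\<lambda>x. \<zero>\<^bsub>M\<^esub>) ^^ n) \<xi> = \<zero>\<^bsub>power_module n M\<^esub>"
proof -
  let ?V = "Verschiebung_map n (\<lambda>x. \<zero>\<^bsub>M\<^esub>)"
  have "j \<in> {1..n} \<longrightarrow> j \<le> k \<longrightarrow> (?V ^^ k) \<xi> j = \<zero>\<^bsub>M\<^esub>" for k j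
  proof (induction k arbitrary: j)
    case (Suc k)
    show ?case
    proof (intro impI)
      assume j: "j \<in> {1..n}" "j \<le> Suc k"
      show "(?V ^^ Suc k) \<xi> j = \<zero>\<^bsub>M\<^esub>"
      proof (cases "j = 1")
        case False
        then have "j - 1 \<in> {1..n}" "j - 1 \<le> k" using j by auto
        then have "(?V ^^ k) \<xi> (j - 1) = \<zero>\<^bsub>M\<^esub>" using Suc.IH by blast
        then show ?thesis using j(1) False by (simp add: Verschiebung_map_def)
      qed (use j in \<open>simp add: Verschiebung_map_def\<close>)
    qed
  qed auto
  then have "(?V ^^ n) \<xi> j = \<zero>\<^bsub>M\<^esub>" if "j \<in> {1..n}" for j using that by simp
  \<comment> \<open>Equality of functions also needs agreement outside the index set. For
    \<open>n = 0\<close> it comes from \<open>\<xi>\<close> itself, otherwise from the outermost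
    application.\<close>
  moreover have "(?V ^^ n) \<xi> \<in> extensional {1..n}"
    using \<xi> by (cases n) (auto simp: Verschiebung_map_def power_module_def PiE_def)
  ultimately show ?thesis
    by (auto simp: power_module_def intro!: extensionalityI[of _ "{1..n}"])
qed

text \<open>The matrix of V_n on a line with scalar \<open>\<alpha>\<close>: ones below the diagonal
  and \<open>\<alpha>\<close> in the upper right corner, a companion matrix of
  \<open>X^n - \<alpha>\<close>.\<close>

definition cyclic_mat :: "nat \<Rightarrow> 'k::field \<Rightarrow> 'k mat" where
  "cyclic_mat n \<alpha> = mat n n (\<lambda>(i, j). if i = 0 then if j = n - 1 then \<alpha> else 0 else if i =
      Suc j then 1 else 0)"

lemma ver_endo_line:
  fixes E :: "('k::field, 'b) endo"
  assumes rep: "mat_rep E 1 (mat 1 1 (\<lambda>_. \<alpha>)) \<Phi>" and n: "n > 0"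
  shows "mat_rep (ver_endo n E) n (cyclic_mat n \<alpha>) (power_coord n 1 \<Phi>)"
proof -
  note r = mat_repD[OF rep]
  have co: "coord (power_module n (fst E)) n (power_coord n 1 \<Phi>)"
    using coord_power_module[OF r(2), of n] by simp
  have "Verschiebung_map n (snd E) (power_coord n 1 \<Phi> v) = power_coord n 1 \<Phi> (cyclic_mat n \<alpha> *\<^sub>v v)"
    if v: "v \<in> carrier_vec n" for v
  proof -
    let ?b = "\<lambda>v j. vec 1 (\<lambda>i. v $ ((j - 1) * 1 + i)) :: 'k vec"
    have first: "(cyclic_mat n \<alpha> *\<^sub>v v) $ 0 = \<alpha> * v $ (n - 1)"
    proof -
      have "(cyclic_mat n \<alpha> *\<^sub>v v) $ 0 = (\<Sum>j = 0..<n. (if j = n - 1 then \<alpha> else 0) * v $ j)"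
        using v n by (simp add: cyclic_mat_def scalar_prod_def)
      also have "\<dots> = (\<Sum>j = 0..<n. if j = n - 1 then \<alpha> * v $ j else 0)"
        by (rule sum.cong) simp_all
      finally have "(cyclic_mat n \<alpha> *\<^sub>v v) $ 0 = (\<Sum>j = 0..<n. if j = n - 1 then \<alpha> * v $ j else 0)" .
      then show ?thesis using n by simp
    qed
    have rest: "(cyclic_mat n \<alpha> *\<^sub>v v) $ Suc k = v $ k" if k: "Suc k < n" for k
    proof -
      have "(cyclic_mat n \<alpha> *\<^sub>v v) $ Suc k = (\<Sum>j = 0..<n. (if k = j then 1 else 0) * v $ j)"
        using v k by (simp add: cyclic_mat_def scalar_prod_def)
      also have "\<dots> = (\<Sum>j = 0..<n. if k = j then v $ j else 0)"
        by (rule sum.cong) simp_all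
      finally have "(cyclic_mat n \<alpha> *\<^sub>v v) $ Suc k = (\<Sum>j = 0..<n. if k = j then v $ j else 0)" .
      then show ?thesis using k by simp
    qed
    show ?thesis
      unfolding Verschiebung_map_def power_coord_def
    proof (rule restrict_ext)
      fix j assume j: "j \<in> {1..n}"
      show "(if j = 1 then snd E ((\<lambda>j\<in>{1..n}. \<Phi> (?b v j)) n) else (\<lambda>j\<in>{1..n}. \<Phi> (?b v j)) (j - 1)) =
          \<Phi> (?b (cyclic_mat n \<alpha> *\<^sub>v v) j)"
      proof (cases "j = 1")
        case True
        have "?b (cyclic_mat n \<alpha> *\<^sub>v v) 1 = mat 1 1 (\<lambda>_. \<alpha>) *\<^sub>v ?b v n"
          using first by (auto simp: scalar_prod_def)
        then show ?thesis using True n r(4)[of "?b v n"] by simp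
      next
        case False
        \<comment> \<open>Component \<open>j = Suc (Suc k)\<close> is entry \<open>Suc k\<close> of
          the vector; row \<open>Suc k\<close> of the matrix picks entry \<open>k\<close>, which is
          component \<open>j - 1\<close>.\<close>
        then obtain k where k: "j = Suc (Suc k)" using j
            by (metis One_nat_def atLeastAtMost_iff not0_implies_Suc not_less_eq_eq le0)
        then have "?b (cyclic_mat n \<alpha> *\<^sub>v v) j = ?b v (j - 1)"
          using rest[of k] j by auto
        then show ?thesis using k j by simp
      qed
    qed
  qed
  then show ?thesis
    using co module_power_module[OF r(1)] by (simp add: mat_rep_def ver_endo_def cyclic_mat_def)
qed

text \<open>Expansion along the first row, where only the two end entries are nonzero. Their minors
  are triangular: one has \<open>X\<close> on the diagonal, the other \<open>-1\<close>, and the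
  resulting power of \<open>-1\<close> cancels the cofactor sign. For \<open>m = 0\<close> the two
  entries coincide, hence the separate case.\<close>

lemma char_poly_cyclic_mat:
  "char_poly (cyclic_mat (Suc m) \<alpha>) = monom 1 (Suc m) - [:\<alpha> :: 'k::field:]"
proof -
  let ?C = "char_poly_matrix (cyclic_mat (Suc m) \<alpha>)"
  have C: "?C \<in> carrier_mat (Suc m) (Suc m)" by (simp add: cyclic_mat_def)
  have Cij: "?C $$ (i, j) = (if i = j then [:0, 1:] else 0) +
      (if i = 0 then if j = m then [:- \<alpha>:] else 0 else if i = Suc j then [:- 1:] else 0)" if "i < Suc m"
          "j < Suc m" for i j
    using that by (auto simp: char_poly_matrix_def cyclic_mat_def)
  show ?thesis
  proof (cases "m = 0")
    case True
    then show ?thesis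
      using Cij[of 0 0] C det_single[of ?C] by (simp add: char_poly_def monom_altdef)
  next
    case False
    have d0: "det (mat_delete ?C 0 0) = monom 1 m"
    proof -
      have D: "mat_delete ?C 0 0 \<in> carrier_mat m m" using mat_delete_carrier[OF C] by simp
      have "det (mat_delete ?C 0 0) = prod_list (diag_mat (mat_delete ?C 0 0))"
        by (rule det_lower_triangular[OF _ D]) (use C in \<open>auto simp: mat_delete_def Cij\<close>)
      also have "diag_mat (mat_delete ?C 0 0) = map (\<lambda>_. [:0, 1:]) [0..<m]"
        using C by (auto simp: diag_mat_def mat_delete_def Cij)
      finally show ?thesis by (simp add: map_replicate_const monom_altdef)
    qed
    have dm: "det (mat_delete ?C 0 m) = [:- 1:] ^ m"
    proof -
      have D: "mat_delete ?C 0 m \<in> carrier_mat m m" using mat_delete_carrier[OF C] by simp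
      have "det (mat_delete ?C 0 m) = prod_list (diag_mat (mat_delete ?C 0 m))"
        by (rule det_upper_triangular[OF _ D]) (use C in \<open>auto simp: upper_triangular_def mat_delete_def Cij\<close>)
      also have "diag_mat (mat_delete ?C 0 m) = map (\<lambda>_. [:- 1:]) [0..<m]"
        using C by (auto simp: diag_mat_def mat_delete_def Cij)
      finally show ?thesis by (simp add: map_replicate_const)
    qed
    have "det ?C = (\<Sum>j<Suc m. ?C $$ (0, j) * cofactor ?C 0 j)"
      by (rule laplace_expansion_row[OF C]) simp
    also have "\<dots> = (\<Sum>j\<in>{0, m}. ?C $$ (0, j) * cofactor ?C 0 j)"
      by (rule sum.mono_neutral_right) (auto simp: Cij)
    also have "\<dots> = [:0, 1:] * monom 1 m + [:- \<alpha>:] * ((- 1) ^ m * [:- 1:] ^ m)"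
      using False d0 dm by (simp add: Cij cofactor_def)
    also have "(- 1) ^ m * [:- 1:] ^ m = (1 :: 'k poly)"
    proof -
      have "[:- 1:] = (- 1 :: 'k poly)" by (simp add: one_pCons)
      then show ?thesis by (simp flip: power_mult_distrib)
    qed
    also have "[:0, 1:] * monom 1 m + [:- \<alpha>:] * 1 = monom 1 (Suc m) - [:\<alpha>:]"
      by (simp add: monom_Suc)
    finally show ?thesis by (simp add: char_poly_def)
  qed
qed

text \<open>Extends \<open>W0_class_nilpotent_list\<close> to any element type by passing to
  \<open>End_rep\<close>, as V_n (M, 0) consists of functions on indices.\<close>

lemma W0_class_nilpotent:
  fixes E :: "('k::alg_closed_field, 'b) endo"
  assumes E: "E \<in> End_obj type_ring" and nil: "\<And>x. x \<in> carrier (fst E) \<Longrightarrow> (snd E ^^ N) x = \<zero>\<^bsub>fst E\<^esub>"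
  shows "W0_class type_ring E = \<zero>\<^bsub>W0 type_ring\<^esub>"
proof -
  let ?D = "End_rep type_ring E"
  note D = End_rep[OF E]
  obtain h where h: "h \<in> End_hom type_ring E ?D" "bij_betw h (carrier (fst E)) (carrier (fst ?D))"
    using D(2) by (auto simp: End_iso_def)
  have "(snd ?D ^^ N) y = \<zero>\<^bsub>fst ?D\<^esub>" if "y \<in> carrier (fst ?D)" for y
  proof -
    obtain x where x: "x \<in> carrier (fst E)" "y = h x" using h(2) \<open>y \<in> _\<close> by (auto simp: bij_betw_def)
    show ?thesis
      using End_hom_funpow(1)[OF h(1) End_objD(2)[OF E] x(1), of N] nil[OF x(1)] x(2)
        module_hom_zero[OF End_objD(1)[OF E] End_objD(1)[OF D(1)] End_homD(1)[OF h(1)]] by simp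
  qed
  then have "W0_class type_ring ?D = \<zero>\<^bsub>W0 type_ring\<^esub>"
    by (rule W0_class_nilpotent_list[OF D(1)])
  then show ?thesis
    using W0_class_iso[OF E D] by simp
qed

section \<open>The two maps on classes in W_0\<close>

lemma W0_Frobenius:
  fixes E :: "('k::alg_closed_field, 'k list) endo"
  assumes n: "n > 0"
  shows "W0_Frobenius (type_ring :: 'k ring) n \<in> hom (add_monoid (W0 type_ring)) (add_monoid (W0 type_ring))"
    and "E \<in> End_obj type_ring \<Longrightarrow> W0_Frobenius (type_ring :: 'k ring) n (W0_class type_ring E) =
        W0_class type_ring (frob_endo n E)"
proof -
  have "(\<lambda>(M, f). W0_class type_ring (M, f ^^ n)) = (\<lambda>E :: ('k, 'k list) endo. W0_class type_ring (frob_endo n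
      E))"
    by (simp add: fun_eq_iff frob_endo_def)
  then have F: "W0_Frobenius (type_ring :: 'k ring) n = W0_additive type_ring (add_monoid (W0 type_ring)) (\<lambda>E.
      W0_class type_ring (frob_endo n E))"
    by (simp only: W0_Frobenius_def)
  have closed: "W0_class type_ring (frob_endo n E) \<in> carrier (add_monoid (W0 type_ring))"
    if "E \<in> End_obj type_ring" for E :: "('k, 'k list) endo"
    using W0_class_closed[OF frob_endo_End_obj[OF that]] by simp
  have exact: "W0_class type_ring (frob_endo n E) = W0_class type_ring (frob_endo n E') \<otimes>\<^bsub>add_monoid (W0
      type_ring)\<^esub> W0_class type_ring (frob_endo n E'')"
    if "E' \<in> End_obj type_ring" "E \<in> End_obj type_ring" "E'' \<in> End_obj type_ring"
        "End_exact type_ring E' E E''"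
    for E' E E'' :: "('k, 'k list) endo"
    using W0_class_exact[OF frob_endo_End_obj[OF that(1)] frob_endo_End_obj[OF that(2)]
        frob_endo_End_obj[OF that(3)], of n n n]
      frob_endo_exact[OF that(1,2,4), of n] by simp
  \<comment> \<open>Positivity of \<open>n\<close> enters here: a positive power of the zero map is
    zero, whereas its 0-th power is the identity.\<close>
  have zero: "W0_class type_ring (frob_endo n (M, \<lambda>x. \<zero>\<^bsub>M\<^esub>)) = \<one>\<^bsub>add_monoid (W0 type_ring)\<^esub>" if
      "finite_projective type_ring M" for M :: "('k, 'k list) module"
  proof -
    have "W0_class type_ring (frob_endo n (M, \<lambda>x. \<zero>\<^bsub>M\<^esub>)) = \<zero>\<^bsub>W0 type_ring\<^esub>"
      by (rule W0_class_zero_on_carrier[OF frob_endo_End_obj[OF zero_End_obj[OF that]]])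
        (use n in \<open>cases n; simp add: frob_endo_def\<close>)
    then show ?thesis by simp
  qed
  show "W0_Frobenius (type_ring :: 'k ring) n \<in> hom (add_monoid (W0 type_ring)) (add_monoid (W0 type_ring))"
    unfolding F by (rule W0_additive(1)[where \<phi> = "(\<lambda>E :: ('k, 'k list) endo. W0_class type_ring (frob_endo n
        E))", OF comm_group_W0 closed exact zero])
  show "W0_Frobenius (type_ring :: 'k ring) n (W0_class type_ring E) = W0_class type_ring (frob_endo n E)"
    if "E \<in> End_obj type_ring"
    unfolding F by (rule W0_additive(2)[where \<phi> = "(\<lambda>E :: ('k, 'k list) endo. W0_class type_ring (frob_endo n
        E))", OF comm_group_W0 closed exact zero that])
qed

lemma W0_Verschiebung:
  fixes E :: "('k::alg_closed_field, 'k list) endo"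
  shows "W0_Verschiebung (type_ring :: 'k ring) n \<in> hom (add_monoid (W0 type_ring)) (add_monoid (W0
      type_ring))"
    and "E \<in> End_obj type_ring \<Longrightarrow> W0_Verschiebung (type_ring :: 'k ring) n (W0_class type_ring E) =
        W0_class type_ring (ver_endo n E)"
proof -
  have "(\<lambda>(M, f). W0_class type_ring (power_module n M, Verschiebung_map n f)) =
      (\<lambda>E :: ('k, 'k list) endo. W0_class type_ring (ver_endo n E))"
    by (simp add: fun_eq_iff ver_endo_def)
  then have V: "W0_Verschiebung (type_ring :: 'k ring) n =
      W0_additive type_ring (add_monoid (W0 type_ring)) (\<lambda>E. W0_class type_ring (ver_endo n E))"
    by (simp only: W0_Verschiebung_def)
  have closed: "W0_class type_ring (ver_endo n E) \<in> carrier (add_monoid (W0 type_ring))"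
    if "E \<in> End_obj type_ring" for E :: "('k, 'k list) endo"
    using W0_class_closed[OF ver_endo_End_obj[OF that]] by simp
  have exact: "W0_class type_ring (ver_endo n E) = W0_class type_ring (ver_endo n E') \<otimes>\<^bsub>add_monoid (W0
      type_ring)\<^esub> W0_class type_ring (ver_endo n E'')"
    if "E' \<in> End_obj type_ring" "E \<in> End_obj type_ring" "E'' \<in> End_obj type_ring"
        "End_exact type_ring E' E E''"
    for E' E E'' :: "('k, 'k list) endo"
    using W0_class_exact[OF ver_endo_End_obj[OF that(1)] ver_endo_End_obj[OF that(2)]
        ver_endo_End_obj[OF that(3)], of n n n]
      ver_endo_exact[OF that(4), of n] by simp
  \<comment> \<open>The shift on the power of \<open>M\<close> is nilpotent of exponent
    \<open>n\<close>, not zero, so the vanishing of nilpotent pairs is used.\<close>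
  have zero: "W0_class type_ring (ver_endo n (M, \<lambda>x. \<zero>\<^bsub>M\<^esub>)) = \<one>\<^bsub>add_monoid (W0 type_ring)\<^esub>" if M:
      "finite_projective type_ring M" for M :: "('k, 'k list) module"
  proof -
    have "W0_class type_ring (ver_endo n (M, \<lambda>x. \<zero>\<^bsub>M\<^esub>)) = \<zero>\<^bsub>W0 type_ring\<^esub>"
      by (rule W0_class_nilpotent[OF ver_endo_End_obj[OF zero_End_obj[OF M]], where N = n])
        (use Verschiebung_zero_nilpotent[of M] M in \<open>simp add: ver_endo_def finite_projective_iff_coord\<close>)
    then show ?thesis by simp
  qed
  show "W0_Verschiebung (type_ring :: 'k ring) n \<in> hom (add_monoid (W0 type_ring)) (add_monoid (W0
      type_ring))"
    unfolding V by (rule W0_additive(1)[where \<phi> = "(\<lambda>E :: ('k, 'k list) endo. W0_class type_ring (ver_endo n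
        E))", OF comm_group_W0 closed exact zero])
  show "W0_Verschiebung (type_ring :: 'k ring) n (W0_class type_ring E) = W0_class type_ring (ver_endo n E)"
    if "E \<in> End_obj type_ring"
    unfolding V by (rule W0_additive(2)[where \<phi> = "(\<lambda>E :: ('k, 'k list) endo. W0_class type_ring (ver_endo n
        E))", OF comm_group_W0 closed exact zero that])
qed

section \<open>Eigenvalue sums as functions of the characteristic polynomial\<close>

definition eigen_sum :: "('k::field \<Rightarrow> qmodz) \<Rightarrow> 'k poly \<Rightarrow> qz_ring" where
  "eigen_sum \<sigma> \<chi> = (\<Sum>\<alpha>\<in>#proots \<chi>. if \<alpha> = 0 then 0 else frag_of (\<sigma> \<alpha>))"

lemma eigen_sum_mult: "\<chi> \<noteq> 0 \<Longrightarrow> \<psi> \<noteq> 0 \<Longrightarrow> eigen_sum \<sigma> (\<chi> * \<psi>) = eigen_sum \<sigma> \<chi> + eigen_sum \<sigma> \<psi>"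
  by (simp add: eigen_sum_def proots_mult)

lemma eigen_sum_1 [simp]: "eigen_sum \<sigma> 1 = 0"
  by (simp add: eigen_sum_def)

lemma eigen_sum_linear: "eigen_sum \<sigma> [:- \<alpha>, 1:] = (if \<alpha> = 0 then 0 else frag_of (\<sigma> \<alpha>))"
  unfolding eigen_sum_def proots_linear_factor by simp

lemma sum_mset_eq_sum_count:
  fixes f :: "'a \<Rightarrow> 'b::semiring_1"
  shows "(\<Sum>x\<in>#M. f x) = (\<Sum>x\<in>set_mset M. of_nat (count M x) * f x)"
proof (induction M)
  case (add y M)
  let ?S = "insert y (set_mset M)"
  have "(\<Sum>x\<in>?S. of_nat (count (add_mset y M) x) * f x) = (\<Sum>x\<in>?S. of_nat (count M x) * f x + (if x =
      y then f x else 0))"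
    by (rule sum.cong) (auto simp: distrib_right add.commute)
  also have "\<dots> = (\<Sum>x\<in>?S. of_nat (count M x) * f x) + f y"
    by (simp add: sum.distrib)
  also have "(\<Sum>x\<in>?S. of_nat (count M x) * f x) = (\<Sum>x\<in>set_mset M. of_nat (count M x) * f x)"
    by (rule sum.mono_neutral_right) (auto simp: not_in_iff)
  finally show ?case using add.IH by (simp add: add.commute)
qed simp

lemma char_poly_nonzero: "A \<in> carrier_mat d d \<Longrightarrow> char_poly A \<noteq> 0"
  using degree_monic_char_poly[of A d] by auto

lemma End_char_poly_nonzero: "E \<in> End_obj type_ring \<Longrightarrow> End_char_poly E \<noteq> 0"
  unfolding End_obj_iff_mat_rep using char_poly_nonzero mat_repD(3) End_char_poly_mat_rep by metis

text \<open>The defining sum runs over the set of eigenvalues with multiplicities as factors;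
  summing over the multiset of roots instead makes additivity a consequence of the multiplicativity
  of \<open>End_char_poly\<close>.\<close>

lemma eigenvalue_sum_eq_eigen_sum:
  assumes E: "E \<in> End_obj type_ring"
  shows "(\<Sum>\<alpha>\<in>End_eigenvalues E - {0}. of_nat (algebraic_multiplicity E \<alpha>) * frag_of (\<sigma> \<alpha>)) =
      eigen_sum \<sigma> (End_char_poly E)"
proof -
  obtain d A \<Phi> where rep: "mat_rep E d A \<Phi>" using E by (auto simp: End_obj_iff_mat_rep)
  let ?\<chi> = "End_char_poly E"
  have nz: "?\<chi> \<noteq> 0" by (rule End_char_poly_nonzero[OF E])
  have roots: "End_eigenvalues E = {\<alpha>. poly ?\<chi> \<alpha> = 0}"
    by (simp add: End_eigenvalues_mat_rep[OF rep] End_char_poly_mat_rep[OF rep])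
  have "eigen_sum \<sigma> ?\<chi> = (\<Sum>\<alpha>\<in>End_eigenvalues E. of_nat (algebraic_multiplicity E \<alpha>) * (if \<alpha> =
      0 then 0 else frag_of (\<sigma> \<alpha>)))"
    using nz unfolding eigen_sum_def sum_mset_eq_sum_count roots by (simp add: algebraic_multiplicity_def)
  also have "\<dots> = (\<Sum>\<alpha>\<in>End_eigenvalues E - {0}. of_nat (algebraic_multiplicity E \<alpha>) * (if \<alpha> =
      0 then 0 else frag_of (\<sigma> \<alpha>)))"
    by (rule sum.mono_neutral_right) (use poly_roots_finite[OF nz] roots in auto)
  also have "\<dots> = (\<Sum>\<alpha>\<in>End_eigenvalues E - {0}. of_nat (algebraic_multiplicity E \<alpha>) * frag_of (\<sigma> \<alpha>))"
    by (rule sum.cong) auto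
  finally show ?thesis ..
qed

lemma End_char_poly_dim_0: "mat_rep E 0 A \<Phi> \<Longrightarrow> End_char_poly E = 1"
proof -
  assume rep: "mat_rep E 0 A \<Phi>"
  have "degree (char_poly A) = 0" "coeff (char_poly A) 0 = 1"
    using degree_monic_char_poly[OF mat_repD(3)[OF rep]] by auto
  then show ?thesis
    using End_char_poly_mat_rep[OF rep] by (metis degree_0_id one_poly_eq_simps(1) pCons_one)
qed

lemma End_char_poly_line: "mat_rep E 1 (mat 1 1 (\<lambda>_. \<alpha>)) \<Phi> \<Longrightarrow> End_char_poly E = [:- \<alpha>, 1:]"
  by (simp add: End_char_poly_mat_rep char_poly_def char_poly_matrix_def det_single)

lemma eigen_sum_exact:
  assumes "E' \<in> End_obj type_ring" "E \<in> End_obj type_ring" "E'' \<in> End_obj type_ring"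
      "End_exact type_ring E' E E''"
  shows "eigen_sum \<sigma> (End_char_poly E) = eigen_sum \<sigma> (End_char_poly E') + eigen_sum \<sigma> (End_char_poly E'')"
  unfolding End_char_poly_exact[OF assms] using assms by (intro eigen_sum_mult End_char_poly_nonzero)

text \<open>A nonzero eigenvalue of the zero map could be inverted and would force the eigenvector
  to be 0; so the sum is empty.\<close>

lemma eigen_sum_zero:
  fixes M :: "('k::field, 'b) module"
  assumes M: "finite_projective type_ring M"
  shows "eigen_sum \<sigma> (End_char_poly (M, \<lambda>x. \<zero>\<^bsub>M\<^esub>)) = 0"
proof -
  let ?E = "(M, \<lambda>x. \<zero>\<^bsub>M\<^esub>)"
  interpret vectorspace "type_ring :: 'k ring" M
    using M by (intro vectorspaceI) (simp add: finite_projective_iff_coord)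
  have "\<alpha> = 0" if "\<alpha> \<in> End_eigenvalues ?E" for \<alpha>
  proof (rule ccontr)
    assume \<alpha>: "\<alpha> \<noteq> 0"
    have "\<exists>v\<in>carrier M. v \<noteq> \<zero>\<^bsub>M\<^esub> \<and> \<zero>\<^bsub>M\<^esub> = \<alpha> \<odot>\<^bsub>M\<^esub> v"
      using that by (simp add: End_eigenvalues_def)
    then obtain v where v: "v \<in> carrier M" "v \<noteq> \<zero>\<^bsub>M\<^esub>" "\<zero>\<^bsub>M\<^esub> = \<alpha> \<odot>\<^bsub>M\<^esub> v" by blast
    have "inverse \<alpha> \<odot>\<^bsub>M\<^esub> (\<alpha> \<odot>\<^bsub>M\<^esub> v) = v"
      using smult_assoc1[of "inverse \<alpha>" \<alpha> v] smult_one[OF v(1)] v(1) \<alpha> by simp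
    then show False using v smult_r_null[of "inverse \<alpha>"] by simp
  qed
  then have "End_eigenvalues ?E - {0} = {}" by blast
  then show ?thesis
    unfolding eigenvalue_sum_eq_eigen_sum[OF zero_End_obj[OF M], symmetric] by (simp only: sum.empty)
qed

lemma comm_group_qz: "comm_group (add_monoid (ring_of_type_algebra :: qz_ring ring))"
  by (rule abelian_group.a_comm_group) (use ring.axioms(1) ring_from_type_algebra in blast)

text \<open>The second part covers pairs over any element type, such as those produced by V_n:
  neither the class nor the characteristic polynomial changes on passing to
  \<open>End_rep\<close>.\<close>

lemma sigma_tilde:
  fixes \<sigma> :: "'k::field \<Rightarrow> qmodz"
  shows "sigma_tilde \<sigma> \<in> hom (add_monoid (W0 type_ring)) (add_monoid ring_of_type_algebra)"
    and "E \<in> End_obj type_ring \<Longrightarrow> sigma_tilde \<sigma> (W0_class type_ring E) = eigen_sum \<sigma> (End_char_poly E)"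
proof -
  let ?\<phi> = "\<lambda>E :: ('k, 'k list) endo. \<Sum>\<alpha>\<in>End_eigenvalues E - {0}. of_nat (algebraic_multiplicity E \<alpha>) *
      frag_of (\<sigma> \<alpha>) :: qz_ring"
  have closed: "?\<phi> E \<in> carrier (add_monoid ring_of_type_algebra)" for E
    by (simp add: ring_of_type_algebra_def)
  have exact: "?\<phi> E = ?\<phi> E' \<otimes>\<^bsub>add_monoid ring_of_type_algebra\<^esub> ?\<phi> E''"
    if "E' \<in> End_obj type_ring" "E \<in> End_obj type_ring" "E'' \<in> End_obj type_ring"
        "End_exact type_ring E' E E''"
    for E' E E'' :: "('k, 'k list) endo"
    using eigen_sum_exact[OF that, of \<sigma>] that(1-3) by (simp add: eigenvalue_sum_eq_eigen_sum
        ring_of_type_algebra_def)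
  have zero: "?\<phi> (M, \<lambda>x. \<zero>\<^bsub>M\<^esub>) = \<one>\<^bsub>add_monoid ring_of_type_algebra\<^esub>" if "finite_projective type_ring M"
      for M :: "('k, 'k list) module"
    using eigen_sum_zero[OF that, of \<sigma>] eigenvalue_sum_eq_eigen_sum[OF zero_End_obj[OF that], of \<sigma>]
        by (simp add: ring_of_type_algebra_def)
  show "sigma_tilde \<sigma> \<in> hom (add_monoid (W0 type_ring)) (add_monoid ring_of_type_algebra)"
    unfolding sigma_tilde_def by (rule W0_additive(1)[where \<phi> = ?\<phi>, OF comm_group_qz closed exact zero])
  have list: "sigma_tilde \<sigma> (W0_class type_ring E) = eigen_sum \<sigma> (End_char_poly E)" if "E \<in> End_obj type_ring"
      for E :: "('k, 'k list) endo"
    unfolding sigma_tilde_def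
    by (rule trans[OF W0_additive(2)[where \<phi> = ?\<phi>, OF comm_group_qz closed exact zero that]
        eigenvalue_sum_eq_eigen_sum[OF that]])
  show "sigma_tilde \<sigma> (W0_class type_ring E) = eigen_sum \<sigma> (End_char_poly E)" if E: "E \<in> End_obj type_ring"
      for E :: "('k, 'b) endo"
    using list[OF End_rep(1)[OF E]] W0_class_iso[OF E End_rep[OF E]]
        End_char_poly_iso[OF E End_objD(1)[OF End_rep(1)[OF E]] End_rep(2)[OF E]]
    by simp
qed

lemma qz_sigma_add: "qz_sigma n (a + b) = qz_sigma n a + qz_sigma n b"
  by (simp add: qz_sigma_def frag_extend_add)

lemma qz_retract_rho_add: "qz_retract p (qz_rho n (a + b)) =
    qz_retract p (qz_rho n a) + qz_retract p (qz_rho n b)"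
  by (simp add: qz_retract_def qz_rho_def frag_extend_add)

section \<open>The two formulas on single pairs\<close>

context qmodz_embedding
begin

text \<open>For \<open>\<alpha> = 0\<close> every root of \<open>X^n\<close> is 0 and contributes
  nothing; otherwise no root is 0, and the case distinction inside \<open>eigen_sum\<close>
  disappears.\<close>

lemma eigen_sum_root_poly:
  assumes n: "n > 0"
  shows "eigen_sum \<sigma> (monom 1 n - [:\<alpha>:]) = (if \<alpha> = 0 then 0 else qz_retract CHAR('k) (qz_rho n (frag_of (\<sigma>
      \<alpha>))))"
proof -
  have root: "x ^ n = \<alpha>" if "x \<in># proots (monom 1 n - [:\<alpha>:])" for x
    using that root_poly_simps[OF n, of \<alpha>] by simp
  show ?thesis
  proof (cases "\<alpha> = 0")
    case True
    have "(\<Sum>x\<in>#proots (monom 1 n - [:\<alpha>:]). if x = 0 then 0 else frag_of (\<sigma> x)) =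
        (\<Sum>x\<in>#proots (monom 1 n - [:\<alpha>:]). 0)"
      by (rule arg_cong[where f = sum_mset], rule image_mset_cong) (use root True in auto)
    then show ?thesis using True by (simp add: eigen_sum_def)
  next
    case False
    have "(\<Sum>x\<in>#proots (monom 1 n - [:\<alpha>:]). if x = 0 then 0 else frag_of (\<sigma> x)) =
        (\<Sum>x\<in>#proots (monom 1 n - [:\<alpha>:]). frag_of (\<sigma> x))"
      by (rule arg_cong[where f = sum_mset], rule image_mset_cong) (use root[of 0] False zero_power[OF n]
          in auto)
    then show ?thesis using False sum_proots_root_poly[OF False n] by (simp add: eigen_sum_def)
  qed
qed

text \<open>On a line the formula is \<open>\<sigma>_power\<close>; as \<open>n\<close> is positive,
  \<open>\<alpha> ^ n\<close> vanishes exactly when \<open>\<alpha>\<close> does, so both sides skip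
  the scalar 0 together.\<close>

lemma eigen_sum_frob_endo:
  fixes E :: "('k, 'k list) endo"
  assumes E: "E \<in> End_obj type_ring" and n: "n > 0"
  shows "eigen_sum \<sigma> (End_char_poly (frob_endo n E)) = qz_sigma n (eigen_sum \<sigma> (End_char_poly E))" (is "?P E")
  using E
proof (rule End_devissage)
  fix E' E E'' :: "('k, 'k list) endo"
  assume E: "E' \<in> End_obj type_ring" "E \<in> End_obj type_ring" "E'' \<in> End_obj type_ring"
      "End_exact type_ring E' E E''"
    and IH: "?P E'" "?P E''"
  show "?P E"
    unfolding eigen_sum_exact[OF E] qz_sigma_add IH[symmetric]
    using E by (intro eigen_sum_exact frob_endo_End_obj frob_endo_exact)
next
  fix E :: "('k, 'k list) endo" and A \<Phi> assume rep: "mat_rep E 0 A \<Phi>"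
  then have F: "frob_endo n E \<in> End_obj type_ring" by (intro frob_endo_End_obj) (auto simp:
      End_obj_iff_mat_rep)
  obtain B where "mat_rep (frob_endo n E) 0 B \<Phi>"
    using mat_rep_exists[OF mat_repD(1,2)[OF rep], of "snd E ^^ n"] End_objD(2)[OF F] unfolding frob_endo_def
        by auto
  then show "?P E"
    using rep by (simp add: End_char_poly_dim_0 qz_sigma_def)
next
  fix E :: "('k, 'k list) endo" and \<alpha> \<Phi> assume rep: "mat_rep E 1 (mat 1 1 (\<lambda>_. \<alpha>)) \<Phi>"
  show "?P E"
    unfolding End_char_poly_line[OF rep] End_char_poly_line[OF frob_endo_line[OF rep]] eigen_sum_linear
    using n \<sigma>_power[of \<alpha> n] by (simp add: qz_sigma_def)
qed

lemma eigen_sum_ver_endo: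
  fixes E :: "('k, 'k list) endo"
  assumes E: "E \<in> End_obj type_ring" and n: "n > 0"
  shows "eigen_sum \<sigma> (End_char_poly (ver_endo n E)) = qz_retract CHAR('k) (qz_rho n (eigen_sum \<sigma>
      (End_char_poly E)))" (is "?P E")
  using E
proof (rule End_devissage)
  fix E' E E'' :: "('k, 'k list) endo"
  assume E: "E' \<in> End_obj type_ring" "E \<in> End_obj type_ring" "E'' \<in> End_obj type_ring"
      "End_exact type_ring E' E E''"
    and IH: "?P E'" "?P E''"
  show "?P E"
    unfolding eigen_sum_exact[OF E] qz_retract_rho_add IH[symmetric]
    using E by (intro eigen_sum_exact ver_endo_End_obj ver_endo_exact)
next
  fix E :: "('k, 'k list) endo" and A \<Phi> assume rep: "mat_rep E 0 A \<Phi>"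
  then have V: "ver_endo n E \<in> End_obj type_ring" by (intro ver_endo_End_obj) (auto simp: End_obj_iff_mat_rep)
  \<comment> \<open>Zero-dimensional pairs stay zero-dimensional, as \<open>n * 0 = 0\<close>; both
    characteristic polynomials are then 1.\<close>
  have "coord (power_module n (fst E)) 0 (power_coord n 0 \<Phi>)"
    using coord_power_module[OF mat_repD(2)[OF rep], of n] by simp
  from mat_rep_exists[OF module_power_module[OF mat_repD(1)[OF rep]] this, of "Verschiebung_map n (snd E)"]
  obtain B where "mat_rep (ver_endo n E) 0 B (power_coord n 0 \<Phi>)"
    using End_objD(2)[OF V] unfolding ver_endo_def by auto
  then show "?P E"
    using rep by (simp add: End_char_poly_dim_0 qz_rho_def qz_retract_def)
next
  fix E :: "('k, 'k list) endo" and \<alpha> \<Phi> assume rep: "mat_rep E 1 (mat 1 1 (\<lambda>_. \<alpha>)) \<Phi>"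
  \<comment> \<open>The determinant was computed for size \<open>Suc m\<close>; here
    \<open>m = n - 1\<close>, which is legitimate as \<open>n > 0\<close>.\<close>
  have "End_char_poly (ver_endo n E) = monom 1 n - [:\<alpha>:]"
    using End_char_poly_mat_rep[OF ver_endo_line[OF rep n]] char_poly_cyclic_mat[of "n - 1" \<alpha>] n by simp
  then show "?P E"
    using eigen_sum_root_poly[OF n] unfolding End_char_poly_line[OF rep] eigen_sum_linear
    by (simp add: qz_rho_def qz_retract_def)
qed

end

theorem proposition4p4:
  fixes p n :: nat and \<sigma> :: "'k::alg_closed_field \<Rightarrow> qmodz"
  assumes "prime p"
    and "algebraic_closure_of_Fp p TYPE('k)"
    and "\<forall>\<alpha> \<beta>. \<alpha> \<noteq> 0 \<longrightarrow> \<beta> \<noteq> 0 \<longrightarrow> \<sigma> (\<alpha> * \<beta>) = \<sigma> \<alpha> + \<sigma> \<beta>"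
    and "inj_on \<sigma> {\<alpha>. \<alpha> \<noteq> 0}"
    and "n > 0"
  shows "(\<forall>w\<in>carrier (W0 (type_ring :: 'k ring)).
            sigma_tilde \<sigma> (W0_Frobenius type_ring n w) = qz_sigma n (sigma_tilde \<sigma> w)) \<and>
         (\<forall>w\<in>carrier (W0 (type_ring :: 'k ring)).
            sigma_tilde \<sigma> (W0_Verschiebung type_ring n w) =
              qz_retract p (qz_rho n (sigma_tilde \<sigma> w)))"
proof -
  have p: "CHAR('k) = p" using assms(2) by (simp add: algebraic_closure_of_Fp_def)
  interpret qmodz_embedding \<sigma>
    using assms p by unfold_locales auto
  let ?W = "add_monoid (W0 (type_ring :: 'k ring))"
  let ?G = "add_monoid (ring_of_type_algebra :: qz_ring ring)"
  have G: "group ?G" using comm_group_qz by (rule comm_group.axioms(2))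
  \<comment> \<open>The carrier of the group ring is the whole type, so an additive function is a
    homomorphism without further conditions.\<close>
  have add: "T \<in> hom ?G ?G" if "\<And>a b. T (a + b) = T a + T b" for T
    using that by (auto simp: hom_def ring_of_type_algebra_def)
  have \<sigma>n: "qz_sigma n \<in> hom ?G ?G" by (rule add[OF qz_sigma_add])
  have \<rho>n: "(\<lambda>a. qz_retract p (qz_rho n a)) \<in> hom ?G ?G" by (rule add[OF qz_retract_rho_add])
  \<comment> \<open>Both composites are homomorphisms on W_0, so it suffices to compare them on
    classes of pairs, where the claim is \<open>eigen_sum_frob_endo\<close>.\<close>
  have F: "(sigma_tilde \<sigma> \<circ> W0_Frobenius type_ring n) w = (qz_sigma n \<circ> sigma_tilde \<sigma>) w" if w:
      "w \<in> carrier (W0 (type_ring :: 'k ring))" for w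
  proof (rule W0_hom_eqI[OF G _ _ _ w])
    show "sigma_tilde \<sigma> \<circ> W0_Frobenius type_ring n \<in> hom ?W ?G"
      by (rule hom_compose[OF W0_Frobenius(1)[OF assms(5)] sigma_tilde(1)])
    show "qz_sigma n \<circ> sigma_tilde \<sigma> \<in> hom ?W ?G"
      by (rule hom_compose[OF sigma_tilde(1) \<sigma>n])
    show "(sigma_tilde \<sigma> \<circ> W0_Frobenius type_ring n) (W0_class type_ring E) =
        (qz_sigma n \<circ> sigma_tilde \<sigma>) (W0_class type_ring E)"
      if E: "E \<in> End_obj type_ring" for E :: "('k, 'k list) endo"
      using eigen_sum_frob_endo[OF E assms(5)]
      by (simp add: W0_Frobenius(2)[OF assms(5) E] sigma_tilde(2)[OF frob_endo_End_obj[OF E]]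
          sigma_tilde(2)[OF E])
  qed
  \<comment> \<open>The same reduction, ending in \<open>eigen_sum_ver_endo\<close>; here
    \<open>sigma_tilde\<close> is evaluated at a pair that does not live on lists.\<close>
  have V: "(sigma_tilde \<sigma> \<circ> W0_Verschiebung type_ring n) w =
      ((\<lambda>a. qz_retract p (qz_rho n a)) \<circ> sigma_tilde \<sigma>) w" if w: "w \<in> carrier (W0 (type_ring :: 'k ring))"
      for w
  proof (rule W0_hom_eqI[OF G _ _ _ w])
    show "sigma_tilde \<sigma> \<circ> W0_Verschiebung type_ring n \<in> hom ?W ?G"
      by (rule hom_compose[OF W0_Verschiebung(1) sigma_tilde(1)])
    show "(\<lambda>a. qz_retract p (qz_rho n a)) \<circ> sigma_tilde \<sigma> \<in> hom ?W ?G"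
      by (rule hom_compose[OF sigma_tilde(1) \<rho>n])
    show "(sigma_tilde \<sigma> \<circ> W0_Verschiebung type_ring n) (W0_class type_ring E) =
        ((\<lambda>a. qz_retract p (qz_rho n a)) \<circ> sigma_tilde \<sigma>) (W0_class type_ring E)"
      if E: "E \<in> End_obj type_ring" for E :: "('k, 'k list) endo"
      using eigen_sum_ver_endo[OF E assms(5)]
      by (simp add: W0_Verschiebung(2)[OF E] sigma_tilde(2)[OF ver_endo_End_obj[OF E]] sigma_tilde(2)[OF E] p)
  qed
  from F V show ?thesis by simp
qed

end
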